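(* Let $\tau$ be a monomial order on $S=K[x_1,\dots,x_n]$ (in the sense of the context). If $reg(gin_\tau(I))=reg(gin_{\mathrm{rlex}}(I))$ for all homogeneous ideals $I\subset S$, then $\tau=\mathrm{rlex}$.
   Context: $K$ is an algebraically closed field of characteristic $0$ and $S=K[x_1,\dots,x_n]$ is the standard graded polynomial ring; $S_1$ is its space of linear forms. A monomial order $\tau$ means a total order $>_\tau$ on the monomials of $S$ with $x_1>_\tau x_2>_\tau\dots>_\tau x_n$ that is graded ($\deg f>\deg g$ implies $f>_\tau g$ for monomials $f,g$) and multiplicative ($f>_\tau g$ implies $fh>_\tau gh$ for monomials $f,g,h$). $\mathrm{rlex}$ denotes the graded reverse lexicographic order: monomials of larger degree are larger, and for distinct monomials $x_1^{a_1}\cdots x_n^{a_n}$ and $x_1^{b_1}\cdots x_n^{b_n}$ of the same degree, the first is larger if and only if $a_K<b_K$, where $K$ here is the largest index $i$ with $a_i\neq b_i$. For a nonzero $f\in S$, $in_\tau(f)$ is its $\tau$-largest monomial, and for an ideal $I$, $in_\tau(I)$ is the monomial ideal generated by all $in_\tau(f)$, $0\neq f\in I$. A matrix $g\in GL(S_1)$ acts on $S$ by the induced linear change of coordinates. By a theorem of Galligo, for a given ideal $I$ and monomial order $\tau$ there is a nonempty Zariski open subset $U\subset GL(S_1)$ such that $in_\tau(g(I))$ is the same ideal for all $g\in U$; this ideal is the generic initial ideal, denoted $gin_\tau(I)$. For a homogeneous ideal $I$ with minimal graded free resolution $0\to\bigoplus_j S(-a_{lj})\to\cdots\to\bigoplus_j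 S(-a_{1j})\to\bigoplus_j S(-a_{0j})\to I\to 0$, the regularity $reg(I)$ is the least $d$ such that $a_{ij}\le d+i$ for all $i,j$. *)

theory Defs
  imports
    "HOL-Library.Poly_Mapping"
    "HOL-Computational_Algebra.Polynomial"
    "HOL-Analysis.Cartesian_Space"
    "Jordan_Normal_Form.Matrix"
begin

text \<open>
  The variables \<open>x\<^sub>1, \<dots>, x\<^sub>n\<close> are indexed by a finite linearly ordered type \<open>'n\<close>, listed in
  increasing order of the index; so \<open>n = CARD('n)\<close>. The ring \<open>S = K[x\<^sub>1, \<dots>, x\<^sub>n]\<close> is the type
  \<open>('n, 'k) mpoly\<close>, which is a commutative ring by convolution.
\<close>

type_synonym 'v monomial = "'v \<Rightarrow>\<^sub>0 nat"
type_synonym ('v, 'a) mpoly = "'v monomial \<Rightarrow>\<^sub>0 'a"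

definition mdeg :: "'v monomial \<Rightarrow> nat" where
  "mdeg m = (\<Sum>v\<in>Poly_Mapping.keys m. Poly_Mapping.lookup m v)"

text \<open>Homogeneous polynomials include \<open>0\<close>.\<close>

definition homogeneous :: "('v, 'a::zero) mpoly \<Rightarrow> bool" where
  "homogeneous f \<longleftrightarrow> (\<exists>e. \<forall>m\<in>Poly_Mapping.keys f. mdeg m = e)"

text \<open>
  \<open>mpoly_subst c f p\<close> replaces every coefficient \<open>a\<close> of \<open>p\<close> by \<open>c a\<close> and every variable \<open>v\<close> by \<open>f v\<close>.
\<close>

definition mpoly_subst ::
    "('a::zero \<Rightarrow> 'b::comm_semiring_1) \<Rightarrow> ('v \<Rightarrow> 'b) \<Rightarrow> ('v, 'a) mpoly \<Rightarrow> 'b" where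
  "mpoly_subst c f p = (\<Sum>m\<in>Poly_Mapping.keys p. c (Poly_Mapping.lookup p m) * (\<Prod>v\<in>Poly_Mapping.keys m. f v ^ Poly_Mapping.lookup m v))"


subsection \<open>Ideals\<close>

text \<open>
  Ideals are the submodules of the ring over itself. (The qualifier \<open>Modules\<close> selects the
  type-class based module theory; HOL-Algebra also has a locale called \<open>module\<close>.)
\<close>

definition is_ideal :: "'r::comm_ring_1 set \<Rightarrow> bool" where
  "is_ideal I \<longleftrightarrow> Modules.module.subspace ((*) :: 'r \<Rightarrow> 'r \<Rightarrow> 'r) I"

definition ideal_gen :: "'r::comm_ring_1 set \<Rightarrow> 'r set" where
  "ideal_gen F = Modules.module.span ((*) :: 'r \<Rightarrow> 'r \<Rightarrow> 'r) F"

definition homogeneous_ideal :: "('v, 'a::comm_ring_1) mpoly set \<Rightarrow> bool" where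
  "homogeneous_ideal I \<longleftrightarrow> is_ideal I \<and> (\<exists>F. (\<forall>f\<in>F. homogeneous f) \<and> I = ideal_gen F)"


subsection \<open>Monomial orders and initial ideals\<close>

text \<open>A monomial order \<open>\<tau>\<close> is given by its strict relation: \<open>\<tau> a b\<close> means \<open>a >\<^sub>\<tau> b\<close>.\<close>

definition monomial_order ::
    "('n::{finite,linorder} monomial \<Rightarrow> 'n monomial \<Rightarrow> bool) \<Rightarrow> bool" where
  "monomial_order \<tau> \<longleftrightarrow>
     irreflp \<tau> \<and> transp \<tau> \<and> totalp \<tau> \<and>
     (\<forall>i j. i < j \<longrightarrow> \<tau> (Poly_Mapping.single i 1) (Poly_Mapping.single j 1)) \<and>
     (\<forall>a b. mdeg a > mdeg b \<longrightarrow> \<tau> a b) \<and>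
     (\<forall>a b c. \<tau> a b \<longrightarrow> \<tau> (a + c) (b + c))"

definition rlex :: "'n::{finite,linorder} monomial \<Rightarrow> 'n monomial \<Rightarrow> bool" where
  "rlex a b \<longleftrightarrow>
     mdeg a > mdeg b \<or>
     mdeg a = mdeg b \<and> a \<noteq> b \<and>
       (let k = Max {i. Poly_Mapping.lookup a i \<noteq> Poly_Mapping.lookup b i}
        in Poly_Mapping.lookup a k < Poly_Mapping.lookup b k)"

definition lead_monomial ::
    "('v monomial \<Rightarrow> 'v monomial \<Rightarrow> bool) \<Rightarrow> ('v, 'a::zero) mpoly \<Rightarrow> 'v monomial" where
  "lead_monomial \<tau> f =
     (THE m. m \<in> Poly_Mapping.keys f \<and> (\<forall>m'\<in>Poly_Mapping.keys f. m' \<noteq> m \<longrightarrow> \<tau> m m'))"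

definition initial_ideal ::
    "('v monomial \<Rightarrow> 'v monomial \<Rightarrow> bool) \<Rightarrow> ('v, 'a::comm_ring_1) mpoly set \<Rightarrow> ('v, 'a) mpoly set" where
  "initial_ideal \<tau> I = ideal_gen {Poly_Mapping.single (lead_monomial \<tau> f) 1 |f. f \<in> I \<and> f \<noteq> 0}"


subsection \<open>Generic initial ideals\<close>

text \<open>The matrix \<open>g\<close> sends the variable \<open>x\<^sub>j\<close> to the linear form \<open>\<Sum>\<^sub>i g\<^sub>i\<^sub>j x\<^sub>i\<close>.\<close>

definition gl_act :: "'a::comm_ring_1^'n^'n \<Rightarrow> ('n::finite, 'a) mpoly \<Rightarrow> ('n, 'a) mpoly" where
  "gl_act g = mpoly_subst (Poly_Mapping.single 0)
     (\<lambda>j. \<Sum>i\<in>UNIV. Poly_Mapping.single (Poly_Mapping.single i 1) (g $ i $ j))"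

text \<open>
  Zariski open subsets of \<open>GL\<^sub>n(K)\<close>, with the subspace topology from the affine space of matrices:
  complements of common zero loci of sets of polynomials in the \<open>n\<^sup>2\<close> matrix entries.
\<close>

definition zariski_open_GL :: "('a::comm_ring_1^'n^'n) set \<Rightarrow> bool" where
  "zariski_open_GL U \<longleftrightarrow>
     (\<exists>P :: ('n \<times> 'n, 'a) mpoly set.
        U = {g. invertible g \<and> (\<exists>p\<in>P. mpoly_subst (\<lambda>c. c) (\<lambda>(i, j). g $ i $ j) p \<noteq> 0)})"

definition gin ::
    "('n monomial \<Rightarrow> 'n monomial \<Rightarrow> bool) \<Rightarrow> ('n::finite, 'a::comm_ring_1) mpoly set \<Rightarrow> ('n, 'a) mpoly set" where
  "gin \<tau> I = (THE J. \<exists>U. zariski_open_GL U \<and> U \<noteq> {} \<and>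
                      (\<forall>g\<in>U. initial_ideal \<tau> (gl_act g ` I) = J))"


subsection \<open>Minimal graded free resolutions and regularity\<close>

text \<open>
  A list \<open>a = [a\<^sub>0, \<dots>, a\<^sub>r\<^sub>-\<^sub>1]\<close> stands for the graded free module \<open>\<Oplus>\<^sub>j S(-a\<^sub>j)\<close>, whose elements are the
  vectors of dimension \<open>r\<close> over \<open>S\<close>. A degree-preserving homomorphism from the module of \<open>a\<close> to
  that of \<open>b\<close> is a matrix whose entry at \<open>(j, k)\<close> is homogeneous of degree \<open>a\<^sub>k - b\<^sub>j\<close>
  (zero if this is negative).
\<close>

definition graded_hom :: "nat list \<Rightarrow> nat list \<Rightarrow> ('v, 'a::comm_ring_1) mpoly mat \<Rightarrow> bool" where
  "graded_hom a b M \<longleftrightarrow>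
     M \<in> carrier_mat (length b) (length a) \<and>
     (\<forall>j<length b. \<forall>k<length a. \<forall>m\<in>Poly_Mapping.keys (M $$ (j, k)). mdeg m + b ! j = a ! k)"

definition hom_image :: "'r::comm_ring_1 mat \<Rightarrow> 'r Matrix.vec set" where
  "hom_image M = {M *\<^sub>v v |v. v \<in> carrier_vec (dim_col M)}"

definition hom_kernel :: "'r::comm_ring_1 mat \<Rightarrow> 'r Matrix.vec set" where
  "hom_kernel M = {v \<in> carrier_vec (dim_col M). M *\<^sub>v v = 0\<^sub>v (dim_row M)}"

text \<open>
  The modules \<open>F\<^sub>i = \<Oplus>\<^sub>j S(-a\<^sub>i\<^sub>j)\<close> are given by the lists \<open>a i\<close>, all but finitely many of them empty. The matrix \<open>d 0\<close> is
  the augmentation \<open>F\<^sub>0 \<rightarrow> S\<close>, with image \<open>I\<close>, and \<open>d (i + 1)\<close> is the differential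
  \<open>F\<^sub>i\<^sub>+\<^sub>1 \<rightarrow> F\<^sub>i\<close>; exactness at the last nonzero module is injectivity. Minimality means that
  the differentials have no nonzero constant terms. Shifts are natural numbers, since every
  degree occurring in a minimal resolution of an ideal of \<open>S\<close> is nonnegative.
\<close>

definition minimal_graded_free_resolution ::
    "('v, 'a::comm_ring_1) mpoly set \<Rightarrow> (nat \<Rightarrow> nat list) \<Rightarrow> (nat \<Rightarrow> ('v, 'a) mpoly mat) \<Rightarrow> bool" where
  "minimal_graded_free_resolution I a d \<longleftrightarrow>
     (\<exists>l. \<forall>i>l. a i = []) \<and>
     graded_hom (a 0) [0] (d 0) \<and>
     (\<forall>i. graded_hom (a (Suc i)) (a i) (d (Suc i))) \<and>
     (\<lambda>v. vec_index v 0) ` hom_image (d 0) = I \<and>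
     (\<forall>i. hom_image (d (Suc i)) = hom_kernel (d i)) \<and>
     (\<forall>i. \<forall>j<length (a i). \<forall>k<length (a (Suc i)). Poly_Mapping.lookup (d (Suc i) $$ (j, k)) 0 = 0)"

text \<open>
  Minimal graded free resolutions over a field exist and are unique up to isomorphism, so the choice
  of the resolution is immaterial. With this natural-number valued definition the zero ideal has
  regularity \<open>0\<close>.
\<close>

definition regularity :: "('v, 'a::comm_ring_1) mpoly set \<Rightarrow> nat" where
  "regularity I = (LEAST r. \<exists>a d. minimal_graded_free_resolution I a d \<and>
                                  (\<forall>i. \<forall>x\<in>set (a i). x \<le> r + i))"

end

theory Submission
  imports Defs "HOL-Analysis.Determinants"
begin

text \<open>
  If \<open>\<tau>\<close> differs from rlex, cancelling common factors from two monomials that are ordered differently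
  gives adjacent variables \<open>x\<^sub>q > x\<^sub>r\<close> and a degree \<open>d\<close> with \<open>x\<^sub>1^(d-1) x\<^sub>r >\<^sub>\<tau> x\<^sub>q^d\<close>, where \<open>x\<^sub>1 > x\<^sub>q\<close>
  and \<open>d \<ge> 2\<close>. Let \<open>I\<close> be generated by the monomials of degree \<open>d\<close> in \<open>x\<^sub>1, \<dots>, x\<^sub>q\<close> other than
  \<open>x\<^sub>q^d\<close>, together with \<open>f = x\<^sub>1^(d-1) x\<^sub>r + x\<^sub>q^d\<close>. Upper unitriangular changes of coordinates preserve \<open>I\<close>
  and lower triangular ones preserve leading monomials, so every \<open>g = L U\<close> in the big cell yields the
  initial ideal read off from \<open>I\<close> itself; no appeal to Galligo's theorem is needed. Under rlex \<open>f\<close> has leading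
  monomial \<open>x\<^sub>q^d\<close> and the initial ideal is \<open>(x\<^sub>1, \<dots>, x\<^sub>q)^d\<close>, of regularity at most \<open>d\<close>. Under \<open>\<tau>\<close> it
  has leading monomial \<open>x\<^sub>1^(d-1) x\<^sub>r\<close>, and the initial ideal acquires the generator \<open>x\<^sub>q^(d+1)\<close>, so its
  regularity exceeds \<open>d\<close>. Both initial ideals have linear quotients, which provides their minimal resolutions by
  iterated horseshoes over Koszul complexes.
\<close>

text \<open>Two demands dictate the ideal. It must be stable under upper unitriangular
  substitutions, which add larger variables to each variable. Hence the extreme choice of the two
  terms of f: enlarging variables in x_1^(d-1) x_r, with x_r right after x_q, or in x_q^d always
  gives a monomial of degree d in x_1, ..., x_q other than x_q^d, which is already a generator. And
  exchanging the leading term of f must change the regularity: x_q f equals x_q^(d+1) plus a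
  multiple of a generator, so x_q^(d+1) lies in I, but it loses its divisor x_q^d in the initial
  ideal once x_1^(d-1) x_r leads.

  The form of the definitions matters too. \<open>gin\<close> is a definite description, so every
  competing nonempty open set must be shown to meet the big cell; this uses that the field is
  infinite. \<open>regularity\<close> is a least number taken over actual resolutions, so even the
  existence of the minimum requires constructing one; the lower bound then looks only at degrees of
  generators. Initial ideals are read off from a vector space basis of I whose images have distinct
  leading monomials.\<close>

no_notation vec_index (infixl "$" 100)
hide_const (open) Matrix.mat

abbreviation "lookup \<equiv> Poly_Mapping.lookup"
abbreviation "keys \<equiv> Poly_Mapping.keys"
abbreviation "single \<equiv> Poly_Mapping.single"

section \<open>Polynomials as finitely supported functions\<close>

lemma mpoly_sum_single: "(\<Sum>m\<in>keys p. single m (lookup p m)) = (p :: ('v, 'a::comm_ring_1) mpoly)"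
  by (rule poly_mapping_eqI) (auto simp: lookup_sum lookup_single when_def in_keys_iff)

lemma mpoly_induct [case_names zero single add]:
  fixes p :: "('v, 'a::comm_ring_1) mpoly"
  assumes "P 0" "\<And>m c. P (single m c)" "\<And>p q. P p \<Longrightarrow> P q \<Longrightarrow> P (p + q)"
  shows "P p"
proof -
  have "P (\<Sum>m\<in>F. single m (lookup p m))" if "finite F" for F
    using that by induction (auto intro: assms)
  from this[of "keys p"] show ?thesis by (simp add: mpoly_sum_single)
qed

lemma mdeg_sum: "mdeg (m :: 'v::finite monomial) = (\<Sum>v\<in>UNIV. lookup m v)"
  unfolding mdeg_def by (rule sum.mono_neutral_left) (auto simp: in_keys_iff)

lemma mdeg_add: "mdeg (a + b :: 'v::finite monomial) = mdeg a + mdeg b"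
  by (simp add: mdeg_sum lookup_add sum.distrib)

lemma mdeg_single [simp]: "mdeg (single i e) = e"
  by (auto simp: mdeg_def)

lemma mdeg_zero [simp]: "mdeg 0 = 0"
  by (simp add: mdeg_def)

lemma keys_times_subset:
  assumes "\<And>a b. a \<in> keys p \<Longrightarrow> b \<in> keys q \<Longrightarrow> a + b \<in> M"
  shows "keys (p * q) \<subseteq> M"
  using keys_mult[of p q] assms by blast

lemma keys_plus_subset: "keys p \<subseteq> M \<Longrightarrow> keys q \<subseteq> M \<Longrightarrow> keys (p + q) \<subseteq> M"
  using keys_add[of p q] by blast

lemma lookup_single_times:
  fixes p :: "('v, 'a::comm_ring_1) mpoly"
  shows "lookup (single t c * p) (t + m) = c * lookup p m"
proof (induction p rule: mpoly_induct)
  case (single m' c')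
  then show ?case by (auto simp: mult_single lookup_single when_def)
qed (auto simp: lookup_add algebra_simps)

lemma mpoly_subst_add:
  assumes "c 0 = 0" "\<And>x y. c (x + y) = c x + c y"
  shows "mpoly_subst c f (p + q) = mpoly_subst c f p + mpoly_subst c f (q :: ('v, 'a::comm_ring_1) mpoly)"
  unfolding mpoly_subst_def
  by (rule setsum_keys_plus_distrib) (auto simp: assms algebra_simps)

lemma mpoly_subst_single:
  fixes f :: "'v::finite \<Rightarrow> 'b::comm_semiring_1"
  assumes "c 0 = 0"
  shows "mpoly_subst c f (single m a) = c a * (\<Prod>v\<in>UNIV. f v ^ lookup m v)"
proof -
  have "(\<Prod>v\<in>keys m. f v ^ lookup m v) = (\<Prod>v\<in>UNIV. f v ^ lookup m v)"
    by (rule prod.mono_neutral_left) (auto simp: in_keys_iff)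
  then show ?thesis by (simp add: mpoly_subst_def assms)
qed

lemma mpoly_subst_mult:
  fixes f :: "'v::finite \<Rightarrow> 'b::comm_semiring_1" and p q :: "('v, 'a::comm_ring_1) mpoly"
  assumes c: "c 0 = 0" "\<And>x y. c (x + y) = c x + c y" "\<And>x y. c (x * y) = c x * c y"
  shows "mpoly_subst c f (p * q) = mpoly_subst c f p * mpoly_subst c f q"
proof (induction p rule: mpoly_induct)
  case zero
  then show ?case by (simp add: mpoly_subst_def)
next
  case p: (single m a)
  show ?case
  proof (induction q rule: mpoly_induct)
    case zero
    then show ?case by (simp add: mpoly_subst_def)
  next
    case (single m' a')
    then show ?case
      by (simp add: mult_single mpoly_subst_single c lookup_add power_add prod.distrib ac_simps)
  qed (simp add: algebra_simps mpoly_subst_add c)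
qed (simp add: algebra_simps mpoly_subst_add c)

lemma prod_var: "(\<Prod>v\<in>UNIV. f v ^ lookup (single j 1) v) = (f (j :: 'v::finite) :: 'b::comm_monoid_mult)"
proof -
  have "(\<Prod>v\<in>UNIV. f v ^ lookup (single j 1) v) = (\<Prod>v\<in>UNIV. if v = j then f v else 1)"
    by (rule prod.cong) (auto simp: lookup_single when_def)
  then show ?thesis by (simp)
qed

section \<open>Monomial ideals as sets of monomials\<close>

text \<open>A monomial ideal is recorded by all its monomials instead of by generators. Membership
  becomes a condition on supports, and adding a monomial or forming a colon ideal becomes an
  operation on sets.\<close>

definition monomials_ideal :: "'v monomial set \<Rightarrow> ('v, 'a::comm_ring_1) mpoly set" where
  "monomials_ideal M = {h. keys h \<subseteq> M}"

definition up_closed :: "'v monomial set \<Rightarrow> bool" where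
  "up_closed M \<longleftrightarrow> (\<forall>m\<in>M. \<forall>t. m + t \<in> M)"

lemma module_times: "Modules.module ((*) :: 'r \<Rightarrow> 'r \<Rightarrow> 'r::comm_ring_1)"
  by standard (simp_all add: algebra_simps)

lemma is_ideal_iff: "is_ideal I \<longleftrightarrow> 0 \<in> I \<and> (\<forall>x\<in>I. \<forall>y\<in>I. x + y \<in> I) \<and> (\<forall>c. \<forall>x\<in>I. c * x \<in> I)"
  unfolding is_ideal_def Modules.module.subspace_def[OF module_times] by blast

lemma ideal_gen_superset: "F \<subseteq> ideal_gen F"
  unfolding ideal_gen_def by (rule Modules.module.span_superset[OF module_times])

lemma ideal_gen_minimal: "F \<subseteq> I \<Longrightarrow> is_ideal I \<Longrightarrow> ideal_gen F \<subseteq> I"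
  unfolding ideal_gen_def is_ideal_def by (rule Modules.module.span_minimal[OF module_times])

lemma is_ideal_ideal_gen: "is_ideal (ideal_gen F)"
  unfolding ideal_gen_def is_ideal_def by (rule Modules.module.subspace_span[OF module_times])

lemma is_ideal_sum: "is_ideal I \<Longrightarrow> (\<And>x. x \<in> A \<Longrightarrow> f x \<in> I) \<Longrightarrow> sum f A \<in> I"
  by (induction A rule: infinite_finite_induct) (auto simp: is_ideal_iff)

lemma is_ideal_monomials_ideal:
  assumes M: "up_closed M"
  shows "is_ideal (monomials_ideal M :: ('v, 'a::comm_ring_1) mpoly set)"
  unfolding is_ideal_iff
proof (intro conjI ballI allI)
  show "0 \<in> (monomials_ideal M :: ('v, 'a) mpoly set)" by (simp add: monomials_ideal_def)
next
  fix x y :: "('v, 'a) mpoly"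
  assume "x \<in> monomials_ideal M" "y \<in> monomials_ideal M"
  then show "x + y \<in> monomials_ideal M" by (simp add: keys_plus_subset monomials_ideal_def)
next
  fix c x :: "('v, 'a) mpoly"
  assume x: "x \<in> monomials_ideal M"
  have "a + b \<in> M" if "b \<in> keys x" for a b
  proof -
    have "b + a \<in> M" using x that M unfolding monomials_ideal_def up_closed_def by blast
    then show ?thesis by (simp add: add.commute)
  qed
  then show "c * x \<in> monomials_ideal M"
    unfolding monomials_ideal_def using keys_times_subset[of c x M] by blast
qed

lemma is_ideal_mult: "is_ideal I \<Longrightarrow> x \<in> I \<Longrightarrow> c * x \<in> I"
  by (simp add: is_ideal_iff)

lemma monomials_ideal_eq:
  fixes M :: "'v monomial set"
  assumes "up_closed M"
  shows "ideal_gen {single m (1::'a::comm_ring_1) | m. m \<in> M} = monomials_ideal M" (is "ideal_gen ?G = _")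
proof
  show "ideal_gen ?G \<subseteq> monomials_ideal M"
    by (rule ideal_gen_minimal[OF _ is_ideal_monomials_ideal[OF assms]]) (auto simp: monomials_ideal_def)
  show "monomials_ideal M \<subseteq> ideal_gen ?G"
  proof
    fix h :: "('v, 'a) mpoly" assume h: "h \<in> monomials_ideal M"
    have "(\<Sum>m\<in>keys h. single m (lookup h m)) \<in> ideal_gen ?G"
    proof (rule is_ideal_sum[OF is_ideal_ideal_gen])
      fix m assume "m \<in> keys h"
      with h have "single m 1 \<in> ?G" unfolding monomials_ideal_def by blast
      then have "single m 1 \<in> ideal_gen ?G" by (rule subsetD[OF ideal_gen_superset])
      then have "single 0 (lookup h m) * single m 1 \<in> ideal_gen ?G"
        by (rule is_ideal_mult[OF is_ideal_ideal_gen])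
      then show "single m (lookup h m) \<in> ideal_gen ?G" by (simp add: mult_single)
    qed
    then show "h \<in> ideal_gen ?G" by (simp add: mpoly_sum_single)
  qed
qed

section \<open>Leading terms\<close>

definition compatible_rel :: "('v monomial \<Rightarrow> 'v monomial \<Rightarrow> bool) \<Rightarrow> bool" where
  "compatible_rel R \<longleftrightarrow> irreflp R \<and> transp R \<and> (\<forall>a b c. R a b \<longrightarrow> R (a + c) (b + c))"

text \<open>The coefficient \<open>c\<close> is allowed to vanish.\<close>

definition leads :: "('v monomial \<Rightarrow> 'v monomial \<Rightarrow> bool) \<Rightarrow> ('v, 'a::comm_ring_1) mpoly \<Rightarrow> 'v monomial \<Rightarrow> 'a \<Rightarrow> bool" where
  "leads R p m c \<longleftrightarrow> (\<exists>p'. p = single m c + p' \<and> (\<forall>k\<in>keys p'. R m k))"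

lemma leads_mult:
  assumes R: "compatible_rel R" and p: "leads R p m c" and q: "leads R q m' c'"
  shows "leads R (p * q) (m + m') (c * c')"
proof -
  have R1: "R (a + t) (b + t)" if "R a b" for a b t
    using R that unfolding compatible_rel_def by blast
  have R2: "R (t + a) (t + b)" if "R a b" for a b t
    using R1[OF that, of t] by (simp add: add.commute)
  have trans: "R a b \<Longrightarrow> R b d \<Longrightarrow> R a d" for a b d
    using R unfolding compatible_rel_def transp_def by blast
  obtain p' q' where p': "p = single m c + p'" "\<forall>k\<in>keys p'. R m k"
    and q': "q = single m' c' + q'" "\<forall>k\<in>keys q'. R m' k"
    using p q unfolding leads_def by blast
  have 1: "keys (single m c * q') \<subseteq> {k. R (m + m') k}"
    by (rule keys_times_subset) (use q'(2) R2[of m'] in \<open>simp split: if_splits\<close>)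
  have 2: "keys (p' * single m' c') \<subseteq> {k. R (m + m') k}"
    by (rule keys_times_subset) (use p'(2) R1[of m] in \<open>simp split: if_splits\<close>)
  have 3: "keys (p' * q') \<subseteq> {k. R (m + m') k}"
  proof (rule keys_times_subset)
    fix a b assume "a \<in> keys p'" "b \<in> keys q'"
    then have "R (m + m') (a + m')" "R (a + m') (a + b)" by (simp_all add: p'(2) q'(2) R1 R2)
    then show "a + b \<in> {k. R (m + m') k}" using trans[of "m + m'" "a + m'" "a + b"] by simp
  qed
  have "p * q = single (m + m') (c * c') + (single m c * q' + (p' * single m' c' + p' * q'))"
    by (simp add: p'(1) q'(1) algebra_simps mult_single)
  moreover have "keys (single m c * q' + (p' * single m' c' + p' * q')) \<subseteq> {k. R (m + m') k}"
    by (intro keys_plus_subset 1 2 3)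
  ultimately show ?thesis
    unfolding leads_def by (intro exI[of _ "single m c * q' + (p' * single m' c' + p' * q')"]) (simp add: subset_iff)
qed

lemma leads_one: "leads R 1 0 1"
  unfolding leads_def by (rule exI[of _ 0]) simp

lemma leads_power:
  assumes "compatible_rel R" "leads R p (single j 1) c"
  shows "leads R (p ^ e) (single j e) (c ^ e)"
proof (induction e)
  case 0
  then show ?case by (simp add: leads_one)
next
  case (Suc e)
  have "leads R (p * p ^ e) (single j 1 + single j e) (c * c ^ e)"
    by (rule leads_mult[OF assms Suc])
  then show ?case by (simp flip: single_add)
qed

lemma leads_prod:
  assumes "compatible_rel R" "finite A" "\<And>v. v \<in> A \<Longrightarrow> leads R (p v) (m v) (c v)"
  shows "leads R (prod p A) (sum m A) (prod c A)"
  using assms(2,3)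
proof (induction A rule: finite_induct)
  case (insert x A)
  then have "leads R (p x * prod p A) (m x + sum m A) (c x * prod c A)"
    by (intro leads_mult[OF assms(1)]) simp_all
  with insert show ?case by simp
qed (simp add: leads_one)

lemma leads_lookup:
  assumes "compatible_rel R" "leads R p m c"
  shows "lookup p m = c"
proof -
  obtain p' where p': "p = single m c + p'" "\<forall>k\<in>keys p'. R m k"
    using assms(2) unfolding leads_def by blast
  have "\<not> R m m" using assms(1) unfolding compatible_rel_def by (meson irreflpD)
  with p' show ?thesis by (auto simp: lookup_add in_keys_iff)
qed

lemma leads_keys: "leads R p m c \<Longrightarrow> k \<in> keys p \<Longrightarrow> k = m \<or> R m k"
  unfolding leads_def
proof (elim exE conjE)
  fix p' assume *: "k \<in> keys p" "p = single m c + p'" "\<forall>k\<in>keys p'. R m k"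
  then have "k \<in> keys (single m c) \<union> keys p'" using keys_add[of "single m c" p'] by (simp add: subset_iff)
  then show "k = m \<or> R m k" using *(3) by (simp split: if_splits) metis
qed

lemma leads_add:
  assumes "leads R p m c" "\<And>k. k \<in> keys q \<Longrightarrow> R m k"
  shows "leads R (p + q) m c"
proof -
  obtain p' where p': "p = single m c + p'" "\<forall>k\<in>keys p'. R m k"
    using assms unfolding leads_def by blast
  have "keys (p' + q) \<subseteq> {k. R m k}"
    by (rule keys_plus_subset) (use p' assms in auto)
  then show ?thesis
    unfolding leads_def p' by (intro exI[of _ "p' + q"]) (simp add: add.assoc subset_iff)
qed

lemma lead_monomial_eq:
  assumes "compatible_rel R" "leads R p m c" "c \<noteq> 0"
  shows "lead_monomial R p = m"
  unfolding lead_monomial_def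
proof (rule the_equality)
  have "m \<in> keys p" using leads_lookup[OF assms(1,2)] assms(3) by (simp add: in_keys_iff)
  then show *: "m \<in> keys p \<and> (\<forall>m'\<in>keys p. m' \<noteq> m \<longrightarrow> R m m')"
    using leads_keys[OF assms(2)] by blast
  fix m' assume "m' \<in> keys p \<and> (\<forall>m''\<in>keys p. m'' \<noteq> m' \<longrightarrow> R m' m'')"
  with * have "m' \<noteq> m \<Longrightarrow> R m m' \<and> R m' m" by metis
  with assms(1) show "m' = m" unfolding compatible_rel_def by (meson irreflpD transpD)
qed

section \<open>Linear changes of coordinates\<close>

lemma gl_act_add: "gl_act g (p + q) = gl_act g p + gl_act g q"
  unfolding gl_act_def by (rule mpoly_subst_add) (auto simp: single_add)

lemma gl_act_mult: "gl_act g (p * q) = gl_act g p * gl_act g q"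
  unfolding gl_act_def by (rule mpoly_subst_mult) (auto simp: single_add mult_single)

lemma gl_act_single: "gl_act g (single m a) =
  single 0 a * (\<Prod>v\<in>UNIV. gl_act g (single (single v 1) 1) ^ lookup m v)"
  unfolding gl_act_def by (simp only: mpoly_subst_single single_zero prod_var single_one mult_1_left)

lemma gl_act_var: "gl_act (g :: 'a::comm_ring_1^'n^'n) (single (single j 1) 1) = (\<Sum>i\<in>UNIV. single (single i 1) (g $ i $ j))"
  unfolding gl_act_def by (simp only: mpoly_subst_single single_zero prod_var single_one mult_1_left)

lemma gl_act_const [simp]: "gl_act g (single 0 a) = single 0 a"
  by (subst gl_act_single) simp

lemma gl_act_zero [simp]: "gl_act g 0 = 0"
  by (simp add: gl_act_def mpoly_subst_def)

lemma gl_act_one [simp]: "gl_act g 1 = 1"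
  using gl_act_const[of g 1] by simp

lemma gl_act_sum: "gl_act g (sum f A) = (\<Sum>x\<in>A. gl_act g (f x))"
  by (induction A rule: infinite_finite_induct) (auto simp: gl_act_add)

lemma gl_act_power: "gl_act g (p ^ e) = gl_act g p ^ e"
  by (induction e) (auto simp: gl_act_mult)

lemma gl_act_prod: "gl_act g (prod f A) = (\<Prod>x\<in>A. gl_act g (f x))"
  by (induction A rule: infinite_finite_induct) (auto simp: gl_act_mult)

text \<open>Both sides are ring homomorphisms fixing the constants, so only the images of the
  variables have to be compared.\<close>

lemma gl_act_matrix_mult:
  fixes A B :: "'a::comm_ring_1^'n^'n"
  shows "gl_act (A ** B) p = gl_act A (gl_act B p)"
proof (induction p rule: mpoly_induct)
  case (single m a)
  have var: "gl_act (A ** B) (single (single j 1) 1) = gl_act A (gl_act B (single (single j 1) 1))" for j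
  proof -
    have "gl_act A (gl_act B (single (single j 1) 1)) =
      (\<Sum>i\<in>UNIV. gl_act A (single 0 (B $ i $ j)) * gl_act A (single (single i 1) 1))"
      by (simp only: gl_act_var[of B] gl_act_sum mult_single gl_act_mult[symmetric] add_0 mult_1_right)
    also have "\<dots> = (\<Sum>i\<in>UNIV. \<Sum>l\<in>UNIV. single (single l 1) (B $ i $ j * A $ l $ i))"
      by (simp only: gl_act_var gl_act_const sum_distrib_left mult_single add_0)
    also have "\<dots> = (\<Sum>l\<in>UNIV. \<Sum>i\<in>UNIV. single (single l 1) (B $ i $ j * A $ l $ i))"
      by (rule sum.swap)
    also have "\<dots> = (\<Sum>l\<in>UNIV. single (single l 1) (\<Sum>i\<in>UNIV. A $ l $ i * B $ i $ j))"
    proof (rule sum.cong)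
      fix l :: 'n
      show "(\<Sum>i\<in>UNIV. single (single l 1) (B $ i $ j * A $ l $ i)) = single (single l 1) (\<Sum>i\<in>UNIV. A $ l $ i * B $ i $ j)"
        by (rule poly_mapping_eqI) (auto simp: lookup_sum lookup_single when_def mult.commute)
    qed simp
    also have "\<dots> = gl_act (A ** B) (single (single j 1) 1)"
      by (simp only: gl_act_var[of "A ** B"]) (simp add: matrix_matrix_mult_def)
    finally show ?thesis by simp
  qed
  show ?case
    by (simp only: gl_act_single[of B m a] gl_act_single[of "A ** B" m a] gl_act_mult gl_act_prod gl_act_power var gl_act_const)
qed (auto simp: gl_act_add)

lemma sum_single_lookup: "(\<Sum>v\<in>UNIV. single v (lookup m v)) = (m :: 'v::finite monomial)"
  by (rule poly_mapping_eqI) (auto simp: lookup_sum lookup_single when_def)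

lemma leads_gl_act:
  fixes g :: "'a::comm_ring_1^'n^'n"
  assumes R: "compatible_rel R"
    and var: "\<And>j. leads R (gl_act g (single (single j 1) 1)) (single j 1) (c j)"
  shows "leads R (gl_act g (single m 1)) m (\<Prod>v\<in>UNIV. c v ^ lookup m v)"
proof -
  have "leads R (\<Prod>v\<in>UNIV. gl_act g (single (single v 1) 1) ^ lookup m v) (\<Sum>v\<in>UNIV. single v (lookup m v)) (\<Prod>v\<in>UNIV. c v ^ lookup m v)"
    by (intro leads_prod leads_power R var) auto
  then show ?thesis by (simp add: gl_act_single[of g m] sum_single_lookup)
qed

lemma leads_gl_act_var:
  fixes g :: "'a::comm_ring_1^'n^'n"
  assumes "\<And>i. i \<noteq> j \<Longrightarrow> g $ i $ j \<noteq> 0 \<Longrightarrow> R (single j 1) (single i 1)"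
  shows "leads R (gl_act g (single (single j 1) 1)) (single j 1) (g $ j $ j)"
  unfolding leads_def
proof (intro exI conjI ballI)
  let ?p = "\<Sum>i\<in>UNIV - {j}. single (single i (1::nat)) (g $ i $ j)"
  show "gl_act g (single (single j 1) 1) = single (single j 1) (g $ j $ j) + ?p"
    by (subst gl_act_var, subst sum.remove[of _ j]) auto
  fix k assume "k \<in> keys ?p"
  then obtain i where "i \<noteq> j" "k \<in> keys (single (single i (1::nat)) (g $ i $ j))"
    using keys_sum[of "\<lambda>i. single (single i (1::nat)) (g $ i $ j)" "UNIV - {j}"] by blast
  with assms[of i] show "R (single j 1) k" by (auto split: if_splits)
qed

section \<open>Graded submodules of free modules\<close>

text \<open>The part of degree \<open>x\<close> of \<open>p\<close>, seen in \<open>S(-b)\<close>.\<close>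

definition hpart :: "nat \<Rightarrow> nat \<Rightarrow> ('v, 'a::comm_ring_1) mpoly \<Rightarrow> ('v, 'a) mpoly" where
  "hpart b x p = Poly_Mapping.mapp (\<lambda>m c. c when mdeg m + b = x) p"

lemma lookup_hpart: "lookup (hpart b x p) m = (lookup p m when mdeg m + b = x)"
  by (auto simp: hpart_def lookup_mapp when_def in_keys_iff)

lemma hpart_add: "hpart b x (p + q) = hpart b x p + hpart b x q"
  by (rule poly_mapping_eqI) (auto simp: lookup_hpart lookup_add when_def)

lemma hpart_zero [simp]: "hpart b x 0 = 0"
  by (rule poly_mapping_eqI) (auto simp: lookup_hpart when_def)

lemma hpart_sum: "hpart b x (sum f A) = (\<Sum>i\<in>A. hpart b x (f i))"
  by (induction A rule: infinite_finite_induct) (auto simp: hpart_add)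

lemma hpart_ident: "(\<And>m. m \<in> keys p \<Longrightarrow> mdeg m + b = x) \<Longrightarrow> hpart b x p = p"
  by (rule poly_mapping_eqI) (auto simp: lookup_hpart when_def in_keys_iff)

lemma hpart_eq_0: "(\<And>m. m \<in> keys p \<Longrightarrow> mdeg m + b \<noteq> x) \<Longrightarrow> hpart b x p = 0"
  by (rule poly_mapping_eqI) (auto simp: lookup_hpart when_def in_keys_iff)

lemma keys_hpart: "keys (hpart b x p) = {m \<in> keys p. mdeg m + b = x}"
  by (auto simp: in_keys_iff lookup_hpart)

text \<open>Multiplication by such an \<open>f\<close> is a degree-preserving map from S(-a) to
  S(-b), so it commutes with taking the part of degree \<open>x\<close>.\<close>

lemma hpart_mult:
  fixes f p :: "('v::finite, 'a::comm_ring_1) mpoly"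
  assumes f: "\<And>m. m \<in> keys f \<Longrightarrow> mdeg m + b = a"
  shows "hpart b x (f * p) = f * hpart a x p"
proof -
  define r where "r = p - hpart a x p"
  have p: "p = hpart a x p + r" by (simp add: r_def)
  have r: "mdeg m + a \<noteq> x" if "m \<in> keys r" for m
    using that by (auto simp: r_def in_keys_iff lookup_minus lookup_hpart when_def split: if_splits)
  have "hpart b x (f * r) = 0"
  proof (rule hpart_eq_0)
    fix k assume "k \<in> keys (f * r)"
    moreover have "keys (f * r) \<subseteq> {k. mdeg k + b \<noteq> x}"
      by (rule keys_times_subset) (use f r in \<open>fastforce simp: mdeg_add\<close>)
    ultimately show "mdeg k + b \<noteq> x" by blast
  qed
  moreover have "hpart b x (f * hpart a x p) = f * hpart a x p"
  proof (rule hpart_ident)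
    fix k assume "k \<in> keys (f * hpart a x p)"
    moreover have "keys (f * hpart a x p) \<subseteq> {k. mdeg k + b = x}"
      by (rule keys_times_subset) (use f in \<open>fastforce simp: mdeg_add keys_hpart\<close>)
    ultimately show "mdeg k + b = x" by blast
  qed
  moreover have "hpart b x (f * p) = hpart b x (f * hpart a x p) + hpart b x (f * r)"
    by (metis p distrib_left hpart_add)
  ultimately show ?thesis by simp
qed

definition hcomp :: "nat list \<Rightarrow> nat \<Rightarrow> ('v, 'a::comm_ring_1) mpoly Matrix.vec \<Rightarrow> ('v, 'a) mpoly Matrix.vec" where
  "hcomp b x v = Matrix.vec (length b) (\<lambda>j. hpart (b ! j) x (vec_index v j))"

lemma hcomp_carrier [simp]: "hcomp b x v \<in> carrier_vec (length b)"
  by (simp add: hcomp_def)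

lemma hcomp_zero [simp]: "hcomp b x (0\<^sub>v (length b)) = 0\<^sub>v (length b)"
  by (rule eq_vecI) (auto simp: hcomp_def)

lemma hcomp_append:
  assumes "v \<in> carrier_vec (length b)" "w \<in> carrier_vec (length c)"
  shows "hcomp (b @ c) x (v @\<^sub>v w) = hcomp b x v @\<^sub>v hcomp c x w"
  using assms by (intro eq_vecI) (auto simp: hcomp_def nth_append)

lemma hcomp_mult_mat_vec:
  fixes M :: "('v::finite, 'a::comm_ring_1) mpoly mat"
  assumes M: "graded_hom a b M" and v: "v \<in> carrier_vec (length a)"
  shows "hcomp b x (M *\<^sub>v v) = M *\<^sub>v hcomp a x v"
proof (rule eq_vecI)
  have dim: "dim_row M = length b" "dim_col M = length a" "dim_vec v = length a"
    using M v by (auto simp: graded_hom_def)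
  show "dim_vec (hcomp b x (M *\<^sub>v v)) = dim_vec (M *\<^sub>v hcomp a x v)"
    by (simp add: hcomp_def dim)
  fix i assume "i < dim_vec (M *\<^sub>v hcomp a x v)"
  then have i: "i < length b" by (simp add: dim)
  have "vec_index (hcomp b x (M *\<^sub>v v)) i = (\<Sum>k = 0..<length a. hpart (b ! i) x (M $$ (i, k) * vec_index v k))"
    using i by (simp add: hcomp_def dim scalar_prod_def hpart_sum)
  also have "\<dots> = (\<Sum>k = 0..<length a. M $$ (i, k) * hpart (a ! k) x (vec_index v k))"
    by (intro sum.cong refl hpart_mult) (use M i in \<open>auto simp: graded_hom_def\<close>)
  also have "\<dots> = vec_index (M *\<^sub>v hcomp a x v) i"
    using i by (simp add: hcomp_def dim scalar_prod_def)
  finally show "vec_index (hcomp b x (M *\<^sub>v v)) i = vec_index (M *\<^sub>v hcomp a x v) i" .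
qed

text \<open>Closure under homogeneous components expresses gradedness without generators; it is what
  allows lifts to be chosen homogeneous in \<open>resolvable_append\<close>.\<close>

definition graded_submodule :: "nat list \<Rightarrow> ('v, 'a::comm_ring_1) mpoly Matrix.vec set \<Rightarrow> bool" where
  "graded_submodule b N \<longleftrightarrow> N \<subseteq> carrier_vec (length b) \<and> 0\<^sub>v (length b) \<in> N \<and>
     (\<forall>v\<in>N. \<forall>w\<in>N. v + w \<in> N) \<and> (\<forall>s. \<forall>v\<in>N. s \<cdot>\<^sub>v v \<in> N) \<and> (\<forall>x. \<forall>v\<in>N. hcomp b x v \<in> N)"

lemma graded_submodule_kernel:
  fixes M :: "('v::finite, 'a::comm_ring_1) mpoly mat"
  assumes M: "graded_hom a b M"
  shows "graded_submodule a (hom_kernel M)"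
proof -
  have dim: "M \<in> carrier_mat (length b) (length a)" "dim_row M = length b" "dim_col M = length a"
    using M by (auto simp: graded_hom_def)
  have "M *\<^sub>v (v + w) = 0\<^sub>v (length b)" if "M *\<^sub>v v = 0\<^sub>v (length b)" "M *\<^sub>v w = 0\<^sub>v (length b)"
    "v \<in> carrier_vec (length a)" "w \<in> carrier_vec (length a)" for v w
    using mult_add_distrib_mat_vec[OF dim(1) that(3,4)] that by simp
  moreover have "M *\<^sub>v (s \<cdot>\<^sub>v v) = 0\<^sub>v (length b)" if "M *\<^sub>v v = 0\<^sub>v (length b)" "v \<in> carrier_vec (length a)" for s v
  proof -
    have "M *\<^sub>v (s \<cdot>\<^sub>v v) = s \<cdot>\<^sub>v (M *\<^sub>v v)"
      using dim that(2) by (intro eq_vecI) (auto simp: scalar_prod_def sum_distrib_left ac_simps)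
    then show ?thesis using that by auto
  qed
  moreover have "M *\<^sub>v hcomp a x v = 0\<^sub>v (length b)" if "M *\<^sub>v v = 0\<^sub>v (length b)" "v \<in> carrier_vec (length a)" for x v
    using hcomp_mult_mat_vec[OF M that(2), of x] that by simp
  moreover have "M *\<^sub>v 0\<^sub>v (length a) = 0\<^sub>v (length b)"
    using dim by (intro eq_vecI) auto
  ultimately show ?thesis
    unfolding graded_submodule_def hom_kernel_def dim by auto
qed

section \<open>Existence of minimal resolutions\<close>

text \<open>
  \<open>resolvable C l t b N\<close>: the submodule \<open>N\<close> of the free module of \<open>b\<close> has a minimal resolution of length
  at most \<open>l\<close> whose shifts \<open>x\<close> in homological degree \<open>i\<close> satisfy \<open>C x (t + i)\<close>.
\<close>

fun resolvable :: "(nat \<Rightarrow> nat \<Rightarrow> bool) \<Rightarrow> nat \<Rightarrow> nat \<Rightarrow> nat list \<Rightarrow> ('v, 'a::comm_ring_1) mpoly Matrix.vec set \<Rightarrow> bool" where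
  "resolvable C 0 t b N \<longleftrightarrow> N = {0\<^sub>v (length b)}"
| "resolvable C (Suc l) t b N \<longleftrightarrow> (\<exists>a M. (\<forall>x\<in>set a. C x t) \<and> graded_hom a b M \<and> hom_image M = N \<and>
     (\<forall>j<length b. \<forall>k<length a. lookup (M $$ (j, k)) 0 = 0) \<and> resolvable C l (Suc t) a (hom_kernel M))"

lemma carrier_vec_0: "carrier_vec 0 = {0\<^sub>v 0 :: 'b::zero Matrix.vec}"
  by (auto intro: eq_vecI)

lemma hom_image_no_cols: "hom_image (0\<^sub>m n 0 :: 'r::comm_ring_1 mat) = {0\<^sub>v n}"
  by (auto simp: hom_image_def carrier_vec_0 intro!: eq_vecI)

lemma hom_kernel_no_cols: "hom_kernel (0\<^sub>m n 0 :: 'r::comm_ring_1 mat) = {0\<^sub>v 0}"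
  by (auto simp: hom_kernel_def carrier_vec_0 intro!: eq_vecI)

text \<open>A matrix without columns appends a zero module at the far end. Padding is needed because
  the horseshoe construction runs through two resolutions of the same length.\<close>

lemma resolvable_Suc:
  fixes N :: "('v, 'a::comm_ring_1) mpoly Matrix.vec set"
  shows "resolvable C l t b N \<Longrightarrow> resolvable C (Suc l) t b N"
proof (induction l arbitrary: t b N)
  case 0
  have "graded_hom [] b (0\<^sub>m (length b) 0   :: ('v, 'a) mpoly mat)"
    by (simp add: graded_hom_def)
  with 0 show ?case
    unfolding resolvable.simps
    by (intro exI[of _ "[]"] exI[of _ "0\<^sub>m (length b) 0"]) (simp add: hom_image_no_cols hom_kernel_no_cols)
next
  case (Suc l)
  from Suc.prems obtain a M where "\<forall>x\<in>set a. C x t" "graded_hom a b M" "hom_image M = N"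
    "\<forall>j<length b. \<forall>k<length a. lookup (M $$ (j, k)) 0 = 0" "resolvable C l (Suc t) a (hom_kernel M)"
    by auto
  with Suc.IH show ?case
    by (subst resolvable.simps) blast
qed

lemma resolvable_mono:
  assumes "l \<le> l'" "resolvable C l t b N"
  shows "resolvable C l' t b N"
  using assms by (induction l' rule: dec_induct) (simp_all only: resolvable_Suc)

lemma resolvable_le_mono: "resolvable (\<le>) l t b N \<Longrightarrow> t \<le> t' \<Longrightarrow> resolvable (\<le>) l t' b N"
proof (induction l arbitrary: t t' b N)
  case (Suc l)
  from Suc.prems obtain a M where *: "\<forall>x\<in>set a. x \<le> t" "graded_hom a b M" "hom_image M = N"
    "\<forall>j<length b. \<forall>k<length a. lookup (M $$ (j, k)) 0 = 0" "resolvable (\<le>) l (Suc t) a (hom_kernel M)"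
    by auto
  have "resolvable (\<le>) l (Suc t') a (hom_kernel M)" using Suc.IH[OF *(5), of "Suc t'"] Suc.prems(2) by simp
  moreover have "\<forall>x\<in>set a. x \<le> t'" using *(1) Suc.prems(2) by force
  ultimately show ?case using *(2-4) by auto
qed simp

lemma vec_split: "v \<in> carrier_vec (n + m) \<Longrightarrow> \<exists>x\<in>carrier_vec n. \<exists>y\<in>carrier_vec m. v = x @\<^sub>v y"
  by (metis vec_first_last_append vec_first_carrier vec_last_carrier)

lemma append_zero_zero: "0\<^sub>v n @\<^sub>v 0\<^sub>v m = (0\<^sub>v (n + m) :: 'b::zero Matrix.vec)"
  by (rule eq_vecI) auto

text \<open>The horseshoe lemma; the degree condition makes the connecting block free of constants.\<close>

lemma resolvable_append:
  fixes L :: "('v::finite, 'a::comm_ring_1) mpoly Matrix.vec set"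
  assumes C: "\<And>t. C t t" "\<And>x t. C x t \<Longrightarrow> x \<le> t"
  shows "graded_submodule (b @ c) L \<Longrightarrow>
    resolvable C l t b {v \<in> carrier_vec (length b). v @\<^sub>v 0\<^sub>v (length c) \<in> L} \<Longrightarrow>
    resolvable (=) l t c {w \<in> carrier_vec (length c). \<exists>v\<in>carrier_vec (length b). v @\<^sub>v w \<in> L} \<Longrightarrow>
    \<forall>x\<in>set b. x < t \<Longrightarrow> resolvable C l t (b @ c) L"
proof (induction l arbitrary: t b c L)
  case 0
  let ?n = "length b" and ?m = "length c"
  have L: "L \<subseteq> carrier_vec (?n + ?m)" "0\<^sub>v (?n + ?m) \<in> L"
    using 0(1) by (auto simp: graded_submodule_def)
  have "v = 0\<^sub>v (?n + ?m)" if "v \<in> L" for v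
  proof -
    have "v \<in> carrier_vec (?n + ?m)" using that L by auto
    then obtain x y where xy: "x \<in> carrier_vec ?n" "y \<in> carrier_vec ?m" "v = x @\<^sub>v y"
      using vec_split by blast
    then have "y \<in> {w \<in> carrier_vec ?m. \<exists>v\<in>carrier_vec ?n. v @\<^sub>v w \<in> L}" using that by auto
    then have y: "y = 0\<^sub>v ?m" using 0(3) unfolding resolvable.simps by (metis singletonD)
    then have "x \<in> {v \<in> carrier_vec ?n. v @\<^sub>v 0\<^sub>v ?m \<in> L}" using xy that by auto
    then have x: "x = 0\<^sub>v ?n" using 0(2) unfolding resolvable.simps by (metis singletonD)
    show ?thesis by (simp add: x y xy(3) append_zero_zero)
  qed
  with L(2) have "L = {0\<^sub>v (?n + ?m)}" by blast
  then show ?case by simp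
next
  case (Suc l)
  let ?n = "length b" and ?m = "length c"
  let ?N = "{v \<in> carrier_vec ?n. v @\<^sub>v 0\<^sub>v ?m \<in> L}"
  let ?P = "{w \<in> carrier_vec ?m. \<exists>v\<in>carrier_vec ?n. v @\<^sub>v w \<in> L}"
  have L: "L \<subseteq> carrier_vec (?n + ?m)" "0\<^sub>v (?n + ?m) \<in> L" "\<And>v w. v \<in> L \<Longrightarrow> w \<in> L \<Longrightarrow> v + w \<in> L"
    "\<And>s v. v \<in> L \<Longrightarrow> s \<cdot>\<^sub>v v \<in> L" "\<And>x v. v \<in> L \<Longrightarrow> hcomp (b @ c) x v \<in> L"
    using Suc.prems(1) by (auto simp: graded_submodule_def)
  obtain aN MN where N: "\<forall>x\<in>set aN. C x t" "graded_hom aN b MN" "hom_image MN = ?N"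
    "\<forall>j<length b. \<forall>k<length aN. lookup (MN $$ (j, k)) 0 = 0" "resolvable C l (Suc t) aN (hom_kernel MN)"
    using Suc.prems(2) by auto
  obtain aP MP where P: "\<forall>x\<in>set aP. x = t" "graded_hom aP c MP" "hom_image MP = ?P"
    "\<forall>j<length c. \<forall>k<length aP. lookup (MP $$ (j, k)) 0 = 0" "resolvable (=) l (Suc t) aP (hom_kernel MP)"
    using Suc.prems(3) by auto
  let ?p = "length aN" and ?q = "length aP"
  have MN: "MN \<in> carrier_mat ?n ?p" and MP: "MP \<in> carrier_mat ?m ?q"
    using N(2) P(2) by (auto simp: graded_hom_def)
  \<comment> \<open>A generator of the quotient \<open>?P\<close> lifts to \<open>L\<close>. Passing
    to the component of degree \<open>t\<close> makes the lift homogeneous and leaves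
    \<open>col MP k\<close> unchanged, since that column already has degree
    \<open>t\<close>.\<close>
  have "\<exists>v. v \<in> carrier_vec ?n \<and> v @\<^sub>v col MP k \<in> L \<and> (\<forall>j<?n. \<forall>m\<in>keys (vec_index v j). mdeg m + b ! j = t)"
    if k: "k < ?q" for k
  proof -
    have "col MP k = MP *\<^sub>v unit_vec ?q k"
      using MP k by (intro eq_vecI) auto
    then have "col MP k \<in> ?P" unfolding P(3)[symmetric] hom_image_def using MP by auto
    then obtain v where v: "v \<in> carrier_vec ?n" "v @\<^sub>v col MP k \<in> L" "col MP k \<in> carrier_vec ?m" by auto
    have "hcomp c t (col MP k) = col MP k"
      using MP k P(1,2) by (intro eq_vecI) (auto simp: hcomp_def graded_hom_def intro!: hpart_ident)
    then have "hcomp b t v @\<^sub>v col MP k \<in> L"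
      using L(5)[OF v(2), of t] hcomp_append[OF v(1,3), of t] by simp
    moreover have "\<forall>j<?n. \<forall>m\<in>keys (vec_index (hcomp b t v) j). mdeg m + b ! j = t"
      by (auto simp: hcomp_def keys_hpart)
    ultimately show ?thesis by (intro exI[of _ "hcomp b t v"]) auto
  qed
  then obtain th where th: "\<And>k. k < ?q \<Longrightarrow> th k \<in> carrier_vec ?n" "\<And>k. k < ?q \<Longrightarrow> th k @\<^sub>v col MP k \<in> L"
    "\<And>k j m. k < ?q \<Longrightarrow> j < ?n \<Longrightarrow> m \<in> keys (vec_index (th k) j) \<Longrightarrow> mdeg m + b ! j = t"
    by metis
  define T where "T = Matrix.mat ?n ?q (\<lambda>(j, k). vec_index (th k) j)"
  have T: "T \<in> carrier_mat ?n ?q" by (simp add: T_def)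
  define M where "M = four_block_mat MN T (0\<^sub>m ?m ?p) MP"
  have M: "M \<in> carrier_mat (?n + ?m) (?p + ?q)"
    using four_block_carrier_mat[OF MN MP] by (simp add: M_def)
  have Mv: "M *\<^sub>v (x @\<^sub>v y) = (MN *\<^sub>v x + T *\<^sub>v y) @\<^sub>v (MP *\<^sub>v y)"
    if "x \<in> carrier_vec ?p" "y \<in> carrier_vec ?q" for x y
  proof -
    have "0\<^sub>m ?m ?p *\<^sub>v x + MP *\<^sub>v y = MP *\<^sub>v y"
      using that MP by (intro eq_vecI) auto
    then show ?thesis
      unfolding M_def using four_block_mat_mult_vec[OF MN T _ MP that] by simp
  qed
  have M_idx: "M $$ (j, k) = (if j < ?n then if k < ?p then MN $$ (j, k) else T $$ (j, k - ?p)
      else if k < ?p then 0 else MP $$ (j - ?n, k - ?p))" if "j < ?n + ?m" "k < ?p + ?q" for j k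
    using that MN MP T by (simp add: M_def)
  have Tkeys: "mdeg m + b ! j = t" if "j < ?n" "k < ?q" "m \<in> keys (T $$ (j, k))" for j k m
    using that th(3) by (simp add: T_def)
  have gM: "graded_hom (aN @ aP) (b @ c) M"
    unfolding graded_hom_def
  proof (intro conjI allI impI ballI)
    show "M \<in> carrier_mat (length (b @ c)) (length (aN @ aP))" using M by simp
    fix j k m assume jk: "j < length (b @ c)" "k < length (aN @ aP)" and m: "m \<in> keys (M $$ (j, k))"
    have t: "aP ! (k - ?p) = t" if "\<not> k < ?p" using P(1) jk(2) that by simp
    show "mdeg m + (b @ c) ! j = (aN @ aP) ! k"
    proof (cases "j < ?n"; cases "k < ?p")
      assume "j < ?n" "k < ?p"
      then show ?thesis using m jk N(2) by (simp add: M_idx graded_hom_def nth_append)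
    next
      assume "j < ?n" "\<not> k < ?p"
      then show ?thesis using m jk Tkeys[of j "k - ?p" m] t by (simp add: M_idx nth_append)
    next
      assume "\<not> j < ?n" "k < ?p"
      then show ?thesis using m jk by (simp add: M_idx)
    next
      assume "\<not> j < ?n" "\<not> k < ?p"
      then show ?thesis using m jk P(2) by (simp add: M_idx graded_hom_def nth_append)
    qed
  qed
  have const: "lookup (M $$ (j, k)) 0 = 0" if jk: "j < length (b @ c)" "k < length (aN @ aP)" for j k
  proof (cases "j < ?n \<and> \<not> k < ?p")
    case True
    then have "b ! j < t" using Suc.prems(4) by simp
    then have "0 \<notin> keys (T $$ (j, k - ?p))"
      using Tkeys[of j "k - ?p" 0] True jk(2) by (auto simp: less_diff_conv2)
    with True jk show ?thesis by (simp add: M_idx in_keys_iff)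
  next
    case False
    with jk N(4) P(4) show ?thesis by (auto simp: M_idx)
  qed
  have TP: "T *\<^sub>v y @\<^sub>v MP *\<^sub>v y \<in> L" if y: "y \<in> carrier_vec ?q" for y
  proof -
    \<comment> \<open>The combination of the lifted columns with index in \<open>K\<close> and
      coefficients from \<open>y\<close>; closure of \<open>L\<close> under sums is applied one
      column at a time.\<close>
    let ?s = "\<lambda>K. Matrix.vec (?n + ?m) (\<lambda>i. \<Sum>k\<in>K. vec_index y k * vec_index (th k @\<^sub>v col MP k) i)"
    have "?s K \<in> L" if "finite K" "K \<subseteq> {0..<?q}" for K
      using that
    proof (induction K rule: finite_induct)
      case empty
      have "?s {} = 0\<^sub>v (?n + ?m)" by (rule eq_vecI) auto
      then show ?case using L(2) by simp
    next
      case (insert k K)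
      have "th k @\<^sub>v col MP k \<in> carrier_vec (?n + ?m)" using th(2)[of k] insert L(1) by auto
      then have "?s (insert k K) = vec_index y k \<cdot>\<^sub>v (th k @\<^sub>v col MP k) + ?s K"
        using insert(1,2) by (intro eq_vecI) (simp_all add: carrier_vecD del: index_append_vec)
      then show ?case using insert th(2) L(3,4) by simp
    qed
    then have "?s {0..<?q} \<in> L" by simp
    moreover have "?s {0..<?q} = T *\<^sub>v y @\<^sub>v MP *\<^sub>v y"
    proof (rule eq_vecI)
      fix i assume "i < dim_vec (T *\<^sub>v y @\<^sub>v MP *\<^sub>v y)"
      then have i: "i < ?n + ?m" using T MP by simp
      have "dim_vec (th k) = ?n" if "k < ?q" for k using th(1)[OF that] by simp
      with i show "vec_index (?s {0..<?q}) i = vec_index (T *\<^sub>v y @\<^sub>v MP *\<^sub>v y) i"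
        using y T MP by (auto simp: scalar_prod_def T_def mult.commute intro!: sum.cong)
    qed (use T MP in simp)
    ultimately show ?thesis by simp
  qed
  have imN: "MN *\<^sub>v x @\<^sub>v 0\<^sub>v ?m \<in> L" if "x \<in> carrier_vec ?p" for x
  proof -
    have "MN *\<^sub>v x \<in> ?N" unfolding N(3)[symmetric] hom_image_def using MN that by auto
    then show ?thesis by simp
  qed
  have im: "hom_image M = L"
  proof
    show "hom_image M \<subseteq> L"
    proof
      fix v assume "v \<in> hom_image M"
      then obtain u where u: "u \<in> carrier_vec (?p + ?q)" "v = M *\<^sub>v u" using M by (auto simp: hom_image_def)
      then obtain x y where xy: "x \<in> carrier_vec ?p" "y \<in> carrier_vec ?q" "u = x @\<^sub>v y" using vec_split by blast
      have "(MN *\<^sub>v x @\<^sub>v 0\<^sub>v ?m) + (T *\<^sub>v y @\<^sub>v MP *\<^sub>v y) = (MN *\<^sub>v x + T *\<^sub>v y) @\<^sub>v (0\<^sub>v ?m + MP *\<^sub>v y)"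
        by (rule append_vec_add[of _ ?n _ _ ?m]) (use MN T MP xy in auto)
      also have "0\<^sub>v ?m + MP *\<^sub>v y = MP *\<^sub>v y" using MP xy by auto
      finally have "v = (MN *\<^sub>v x @\<^sub>v 0\<^sub>v ?m) + (T *\<^sub>v y @\<^sub>v MP *\<^sub>v y)"
        using u xy Mv by simp
      then show "v \<in> L" using L(3) imN TP xy by simp
    qed
    show "L \<subseteq> hom_image M"
    proof
      fix v assume v: "v \<in> L"
      with L(1) have "v \<in> carrier_vec (?n + ?m)" by auto
      then obtain x y where xy: "x \<in> carrier_vec ?n" "y \<in> carrier_vec ?m" "v = x @\<^sub>v y"
        using vec_split by blast
      with v have "y \<in> hom_image MP" unfolding P(3) by auto
      then obtain z where z: "z \<in> carrier_vec ?q" "y = MP *\<^sub>v z" using MP by (auto simp: hom_image_def)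
      have cT: "T *\<^sub>v z \<in> carrier_vec ?n" using T z by simp
      \<comment> \<open>Subtracting the lift of the quotient part leaves an element of
        \<open>?N\<close>.\<close>
      have "v + (-1) \<cdot>\<^sub>v (T *\<^sub>v z @\<^sub>v MP *\<^sub>v z) \<in> L" using v TP[OF z(1)] L(3,4) by simp
      also have "v + (-1) \<cdot>\<^sub>v (T *\<^sub>v z @\<^sub>v MP *\<^sub>v z) = (x - T *\<^sub>v z) @\<^sub>v 0\<^sub>v ?m"
        unfolding xy(3) z(2) using xy(1) cT z(1) MP T by (intro eq_vecI) auto
      finally have "x - T *\<^sub>v z \<in> hom_image MN" unfolding N(3) using xy cT by auto
      then obtain u where u: "u \<in> carrier_vec ?p" "x - T *\<^sub>v z = MN *\<^sub>v u" using MN by (auto simp: hom_image_def)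
      have "MN *\<^sub>v u + T *\<^sub>v z = x" unfolding u(2)[symmetric] using xy(1) cT T by (intro eq_vecI) auto
      then have "M *\<^sub>v (u @\<^sub>v z) = v" using Mv[OF u(1) z(1)] xy z by simp
      then show "v \<in> hom_image M" unfolding hom_image_def using M u(1) z(1) by auto
    qed
  qed
  have dimM: "dim_row M = ?n + ?m" "dim_col M = ?p + ?q" using M by auto
  have ker: "x @\<^sub>v y \<in> hom_kernel M \<longleftrightarrow> MN *\<^sub>v x + T *\<^sub>v y = 0\<^sub>v ?n \<and> MP *\<^sub>v y = 0\<^sub>v ?m"
    if "x \<in> carrier_vec ?p" "y \<in> carrier_vec ?q" for x y
  proof -
    have "MN *\<^sub>v x + T *\<^sub>v y \<in> carrier_vec ?n" using MN T that by simp
    then show ?thesis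
      using that append_vec_eq[of "MN *\<^sub>v x + T *\<^sub>v y" ?n "0\<^sub>v ?n" "MP *\<^sub>v y" "0\<^sub>v ?m"]
      by (simp add: hom_kernel_def dimM Mv append_zero_zero)
  qed
  \<comment> \<open>The kernel of the block matrix is again an extension, of
    \<open>hom_kernel MP\<close> by \<open>hom_kernel MN\<close>, so the induction hypothesis
    applies one degree higher.\<close>
  have "{v \<in> carrier_vec ?p. v @\<^sub>v 0\<^sub>v ?q \<in> hom_kernel M} = hom_kernel MN"
  proof -
    have "v @\<^sub>v 0\<^sub>v ?q \<in> hom_kernel M \<longleftrightarrow> MN *\<^sub>v v = 0\<^sub>v ?n" if "v \<in> carrier_vec ?p" for v
    proof -
      have "T *\<^sub>v 0\<^sub>v ?q = 0\<^sub>v ?n" "MP *\<^sub>v 0\<^sub>v ?q = 0\<^sub>v ?m" using T MP by (auto intro!: eq_vecI)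
      then show ?thesis using ker[OF that, of "0\<^sub>v ?q"] MN that by simp
    qed
    then show ?thesis using MN by (auto simp: hom_kernel_def)
  qed
  moreover have "{w \<in> carrier_vec ?q. \<exists>v\<in>carrier_vec ?p. v @\<^sub>v w \<in> hom_kernel M} = hom_kernel MP"
  proof -
    have "(\<exists>v\<in>carrier_vec ?p. v @\<^sub>v w \<in> hom_kernel M) \<longleftrightarrow> MP *\<^sub>v w = 0\<^sub>v ?m" if w: "w \<in> carrier_vec ?q" for w
    proof
      assume "\<exists>v\<in>carrier_vec ?p. v @\<^sub>v w \<in> hom_kernel M"
      then show "MP *\<^sub>v w = 0\<^sub>v ?m" using ker w by blast
    next
      assume 0: "MP *\<^sub>v w = 0\<^sub>v ?m"
      have cT: "T *\<^sub>v w \<in> carrier_vec ?n" using T w by simp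
      have "(-1) \<cdot>\<^sub>v (T *\<^sub>v w @\<^sub>v MP *\<^sub>v w) \<in> L" using TP[OF w] L(4) by simp
      also have "(-1) \<cdot>\<^sub>v (T *\<^sub>v w @\<^sub>v MP *\<^sub>v w) = (- (T *\<^sub>v w)) @\<^sub>v 0\<^sub>v ?m"
        unfolding 0 using cT by (intro eq_vecI) auto
      finally have "- (T *\<^sub>v w) \<in> hom_image MN" unfolding N(3) using cT by auto
      then obtain u where u: "u \<in> carrier_vec ?p" "- (T *\<^sub>v w) = MN *\<^sub>v u" using MN by (auto simp: hom_image_def)
      have "MN *\<^sub>v u + T *\<^sub>v w = 0\<^sub>v ?n" unfolding u(2)[symmetric] using cT T by (intro eq_vecI) auto
      then show "\<exists>v\<in>carrier_vec ?p. v @\<^sub>v w \<in> hom_kernel M" using ker[OF u(1) w] 0 u by auto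
    qed
    then show ?thesis using MP by (auto simp: hom_kernel_def)
  qed
  ultimately have "resolvable C l (Suc t) (aN @ aP) (hom_kernel M)"
    using Suc.IH[of aN aP "hom_kernel M" "Suc t"] graded_submodule_kernel[OF gM] N(1,5) P(5) C(2)
    by (simp add: less_Suc_eq_le)
  moreover have "\<forall>x\<in>set (aN @ aP). C x t" using N(1) P(1) C(1) by auto
  ultimately show ?case
    unfolding resolvable.simps using gM im const by blast
qed

section \<open>Adding one generator to an ideal\<close>

text \<open>Ideals enter \<open>resolvable\<close> as submodules of the free module of rank
  one.\<close>

definition vec1 :: "'b \<Rightarrow> 'b Matrix.vec" where
  "vec1 p = Matrix.vec 1 (\<lambda>_. p)"

lemma vec1_simps [simp]: "vec_index (vec1 p) 0 = p" "dim_vec (vec1 p) = 1"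
  "vec1 p \<in> carrier_vec 1" "vec1 p \<in> carrier_vec (Suc 0)"
  by (simp_all add: vec1_def)

lemma vec1_index: "v \<in> carrier_vec 1 \<Longrightarrow> vec1 (vec_index v 0) = v"
  by (intro eq_vecI) (auto simp: vec1_def)

lemma vec1_eq_iff [simp]: "vec1 p = vec1 q \<longleftrightarrow> p = q"
  by (metis vec1_simps(1))

lemma zero_vec1: "0\<^sub>v 1 = vec1 0"
  by (rule eq_vecI) (auto simp: vec1_def)

lemma is_ideal_add_multiples:
  assumes "is_ideal I"
  shows "is_ideal {p + h * f | p h. p \<in> I}"
  unfolding is_ideal_iff
proof (intro conjI ballI allI)
  show "0 \<in> {p + h * f | p h. p \<in> I}"
    using assms unfolding is_ideal_iff by (intro CollectI exI[of _ 0]) simp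
next
  fix x y assume "x \<in> {p + h * f | p h. p \<in> I}" "y \<in> {p + h * f | p h. p \<in> I}"
  then obtain p h q k where "x = p + h * f" "p \<in> I" "y = q + k * f" "q \<in> I" by blast
  then show "x + y \<in> {p + h * f | p h. p \<in> I}"
    using assms unfolding is_ideal_iff
    by (intro CollectI exI[of _ "p + q"] exI[of _ "h + k"]) (simp add: algebra_simps)
next
  fix c x assume "x \<in> {p + h * f | p h. p \<in> I}"
  then obtain p h where "x = p + h * f" "p \<in> I" by blast
  then show "c * x \<in> {p + h * f | p h. p \<in> I}"
    using assms unfolding is_ideal_iff
    by (intro CollectI exI[of _ "c * p"] exI[of _ "c * h"]) (simp add: algebra_simps)
qed

text \<open>With the column \<open>f\<close> appended to a matrix of generators of \<open>I\<close>,
  projecting the syzygies to the last coordinate has image the colon ideal (I : f) and kernel the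
  syzygies of \<open>I\<close>. The horseshoe lemma applies to this extension: (I : f) has a linear
  resolution starting in degree t + 1, while the shifts of the generators are at most
  \<open>t\<close>.\<close>

lemma resolvable_add_generator:
  fixes f :: "('v::finite, 'a::comm_ring_1) mpoly"
  assumes C: "\<And>t. C t t" "\<And>x t. C x t \<Longrightarrow> x \<le> t"
    and I: "is_ideal I" "resolvable C l t [s] (vec1 ` I)"
    and f: "\<And>m. m \<in> keys f \<Longrightarrow> mdeg m + s = t" "s < t"
    and colon: "resolvable (=) l' (Suc t) [t] (vec1 ` {h. h * f \<in> I})"
  shows "\<exists>l. resolvable C l t [s] (vec1 ` {p + h * f | p h. p \<in> I})"
proof -
  define k where "k = max l l'"
  \<comment> \<open>Length \<open>Suc k\<close> makes a first matrix available and leaves length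
    \<open>k\<close> for its syzygies, the same as for the colon ideal.\<close>
  have "resolvable C (Suc k) t [s] (vec1 ` I)"
    by (rule resolvable_mono[OF _ I(2)]) (simp add: k_def)
  then obtain a M where M: "\<forall>x\<in>set a. C x t" "graded_hom a [s] M" "hom_image M = vec1 ` I"
    "\<forall>k<length a. lookup (M $$ (0, k)) 0 = 0" "resolvable C k (Suc t) a (hom_kernel M)"
    by auto
  let ?p = "length a"
  have Mc: "M \<in> carrier_mat 1 ?p" using M(2) by (simp add: graded_hom_def)
  define M' where "M' = Matrix.mat 1 (?p + 1) (\<lambda>(i, j). if j < ?p then M $$ (0, j) else f)"
  have M'c: "M' \<in> carrier_mat 1 (?p + 1)" "dim_row M' = 1" "dim_col M' = ?p + 1" by (simp_all add: M'_def)
  have row: "row M' 0 = row M 0 @\<^sub>v vec1 f"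
    using Mc by (intro eq_vecI) (auto simp: M'_def vec1_def)
  have M'v: "M' *\<^sub>v (x @\<^sub>v y) = vec1 (vec_index (M *\<^sub>v x) 0 + vec_index y 0 * f)"
    if "x \<in> carrier_vec ?p" "y \<in> carrier_vec 1" for x y
  proof (rule eq_vecI)
    fix i assume "i < dim_vec (vec1 (vec_index (M *\<^sub>v x) 0 + vec_index y 0 * f))"
    then have i: "i = 0" by simp
    have "(row M 0 @\<^sub>v vec1 f) \<bullet> (x @\<^sub>v y) = row M 0 \<bullet> x + vec1 f \<bullet> y"
      by (rule scalar_prod_append[of _ ?p _ 1]) (use that Mc row_carrier_vec[OF _ Mc, of 0] in auto)
    also have "vec1 f \<bullet> y = vec_index y 0 * f"
      using that(2) by (simp add: scalar_prod_def mult.commute)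
    finally show "vec_index (M' *\<^sub>v (x @\<^sub>v y)) i = vec_index (vec1 (vec_index (M *\<^sub>v x) 0 + vec_index y 0 * f)) i"
      using i Mc M'c row by simp
  qed (simp add: M'c)
  have Mx: "M *\<^sub>v x = vec1 (vec_index (M *\<^sub>v x) 0)" for x
    using Mc by (intro eq_vecI) (auto simp: vec1_def)
  have MI: "vec_index (M *\<^sub>v x) 0 \<in> I" if "x \<in> carrier_vec ?p" for x
  proof -
    have "M *\<^sub>v x \<in> vec1 ` I" unfolding M(3)[symmetric] hom_image_def using Mc that by auto
    then show ?thesis by (auto simp: image_iff)
  qed
  have IM: "\<exists>x\<in>carrier_vec ?p. M *\<^sub>v x = vec1 p" if "p \<in> I" for p
  proof -
    have "vec1 p \<in> hom_image M" using M(3) that by simp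
    then obtain x where "vec1 p = M *\<^sub>v x" "x \<in> carrier_vec ?p" unfolding hom_image_def using Mc by auto
    then show ?thesis by metis
  qed
  have im: "hom_image M' = vec1 ` {p + h * f | p h. p \<in> I}"
  proof
    show "hom_image M' \<subseteq> vec1 ` {p + h * f | p h. p \<in> I}"
    proof
      fix v assume "v \<in> hom_image M'"
      then obtain u where u: "u \<in> carrier_vec (?p + 1)" "v = M' *\<^sub>v u" by (auto simp: hom_image_def M'c)
      then obtain x y where "x \<in> carrier_vec ?p" "y \<in> carrier_vec 1" "u = x @\<^sub>v y" using vec_split by blast
      then show "v \<in> vec1 ` {p + h * f | p h. p \<in> I}" using u(2) M'v MI by blast
    qed
    show "vec1 ` {p + h * f | p h. p \<in> I} \<subseteq> hom_image M'"
    proof (clarify)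
      fix p h assume "p \<in> I"
      then obtain x where x: "x \<in> carrier_vec ?p" "M *\<^sub>v x = vec1 p" using IM by blast
      have "M' *\<^sub>v (x @\<^sub>v vec1 h) = vec1 (p + h * f)" using M'v[OF x(1), of "vec1 h"] x(2) by simp
      moreover have "x @\<^sub>v vec1 h \<in> carrier_vec (?p + 1)"
        by (rule append_carrier_vec[OF x(1)]) simp
      ultimately show "vec1 (p + h * f) \<in> hom_image M'" unfolding hom_image_def M'c
        by (intro CollectI exI[of _ "x @\<^sub>v vec1 h"]) simp
    qed
  qed
  have gM': "graded_hom (a @ [t]) [s] M'"
    unfolding graded_hom_def
  proof (intro conjI allI impI ballI)
    show "M' \<in> carrier_mat (length [s]) (length (a @ [t]))" using M'c(1) by simp
    fix j k m assume jk: "j < length [s]" "k < length (a @ [t])" and m: "m \<in> keys (M' $$ (j, k))"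
    show "mdeg m + [s] ! j = (a @ [t]) ! k"
    proof (cases "k < ?p")
      case True
      then show ?thesis using m jk M(2) by (simp add: M'_def graded_hom_def nth_append)
    next
      case False
      then have "k = ?p" using jk by simp
      then show ?thesis using m jk f(1) by (simp add: M'_def nth_append)
    qed
  qed
  have const: "lookup (M' $$ (j, k)) 0 = 0" if "j < length [s]" "k < length (a @ [t])" for j k
  proof (cases "k < ?p")
    case True
    then show ?thesis using that M(4) by (simp add: M'_def)
  next
    case False
    have "0 \<notin> keys f" using f(1)[of 0] f(2) by auto
    with False show ?thesis using that by (simp add: M'_def in_keys_iff)
  qed
  have ker: "x @\<^sub>v y \<in> hom_kernel M' \<longleftrightarrow> vec_index (M *\<^sub>v x) 0 + vec_index y 0 * f = 0"
    if "x \<in> carrier_vec ?p" "y \<in> carrier_vec 1" for x y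
  proof -
    have "vec1 q = 0\<^sub>v 1 \<longleftrightarrow> q = 0" for q :: "('v, 'a) mpoly"
      by (simp only: zero_vec1 vec1_eq_iff)
    then show ?thesis using that append_carrier_vec[OF that] by (simp add: hom_kernel_def M'c M'v)
  qed
  have "{v \<in> carrier_vec ?p. v @\<^sub>v 0\<^sub>v 1 \<in> hom_kernel M'} = hom_kernel M"
  proof -
    have "v @\<^sub>v 0\<^sub>v 1 \<in> hom_kernel M' \<longleftrightarrow> M *\<^sub>v v = 0\<^sub>v 1" if "v \<in> carrier_vec ?p" for v
    proof -
      have "M *\<^sub>v v = 0\<^sub>v 1 \<longleftrightarrow> vec_index (M *\<^sub>v v) 0 = 0"
        by (subst Mx) (simp only: zero_vec1 vec1_eq_iff)
      then show ?thesis using ker[OF that, of "0\<^sub>v 1"] by simp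
    qed
    then show ?thesis using Mc by (auto simp: hom_kernel_def)
  qed
  moreover have "{w \<in> carrier_vec 1. \<exists>v\<in>carrier_vec ?p. v @\<^sub>v w \<in> hom_kernel M'} = vec1 ` {h. h * f \<in> I}"
  proof (intro equalityI subsetI)
    fix w assume w: "w \<in> {w \<in> carrier_vec 1. \<exists>v\<in>carrier_vec ?p. v @\<^sub>v w \<in> hom_kernel M'}"
    then obtain v where v: "v \<in> carrier_vec ?p" "v @\<^sub>v w \<in> hom_kernel M'" by blast
    then have "vec_index w 0 * f = (-1) * vec_index (M *\<^sub>v v) 0"
      using ker[OF v(1), of w] w by (simp add: eq_neg_iff_add_eq_0 add.commute)
    then have "vec_index w 0 * f \<in> I" using MI[OF v(1)] is_ideal_mult[OF I(1)] by metis
    moreover have "w = vec1 (vec_index w 0)" using vec1_index[of w] w by simp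
    ultimately show "w \<in> vec1 ` {h. h * f \<in> I}" by blast
  next
    fix w assume "w \<in> vec1 ` {h. h * f \<in> I}"
    then obtain h where h: "w = vec1 h" "h * f \<in> I" by blast
    then have "(-1) * (h * f) \<in> I" using is_ideal_mult[OF I(1)] by metis
    then obtain x where x: "x \<in> carrier_vec ?p" "M *\<^sub>v x = vec1 ((-1) * (h * f))" using IM by blast
    have "x @\<^sub>v w \<in> hom_kernel M'" using ker[OF x(1), of w] x(2) h(1) by simp
    then show "w \<in> {w \<in> carrier_vec 1. \<exists>v\<in>carrier_vec ?p. v @\<^sub>v w \<in> hom_kernel M'}"
      using x(1) h(1) by auto
  qed
  ultimately have "resolvable C k (Suc t) (a @ [t]) (hom_kernel M')"
    using resolvable_append[of C a "[t]" "hom_kernel M'" k "Suc t"] C graded_submodule_kernel[OF gM'] M(1,5)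
      resolvable_mono[OF _ colon, of k]
    by (simp add: less_Suc_eq_le k_def)
  then have "resolvable C (Suc k) t [s] (vec1 ` {p + h * f | p h. p \<in> I})"
    unfolding resolvable.simps using gM' im const M(1) C(1)
    by (intro exI[of _ "a @ [t]"] exI[of _ M']) auto
  then show ?thesis by blast
qed

lemma keys_times_single:
  fixes h :: "('v, 'a::comm_ring_1) mpoly"
  shows "keys (h * single u 1) = (\<lambda>m. m + u) ` keys h"
proof
  show "keys (h * single u 1) \<subseteq> (\<lambda>m. m + u) ` keys h"
    by (rule keys_times_subset) (auto split: if_splits)
  show "(\<lambda>m. m + u) ` keys h \<subseteq> keys (h * single u 1)"
    using lookup_single_times[of u 1 h] by (auto simp: in_keys_iff mult.commute add.commute)
qed

text \<open>Multiplication by a monomial translates the support injectively, so no terms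
  cancel.\<close>

lemma monomials_ideal_colon:
  "{h :: ('v, 'a::comm_ring_1) mpoly. h * single u 1 \<in> monomials_ideal M} = monomials_ideal {m. m + u \<in> M}"
  by (auto simp: monomials_ideal_def keys_times_single)

lemma monomials_ideal_add_monomial:
  assumes "up_closed M"
  shows "{p + h * single u 1 | p h. p \<in> monomials_ideal M} =
    (monomials_ideal (M \<union> {m + u | m. True}) :: ('v, 'a::comm_ring_1) mpoly set)" (is "?S = _")
proof
  have "keys (p + h * single u 1) \<subseteq> M \<union> {m + u | m. True}" if "keys p \<subseteq> M" for p h :: "('v, 'a) mpoly"
    by (rule keys_plus_subset) (use that in \<open>auto simp: keys_times_single\<close>)
  then show "?S \<subseteq> monomials_ideal (M \<union> {m + u | m. True})"
    unfolding monomials_ideal_def by blast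
  show "monomials_ideal (M \<union> {m + u | m. True}) \<subseteq> ?S"
  proof
    fix q :: "('v, 'a) mpoly" assume q: "q \<in> monomials_ideal (M \<union> {m + u | m. True})"
    have "(\<Sum>k\<in>keys q. single k (lookup q k)) \<in> ?S"
    proof (rule is_ideal_sum[OF is_ideal_add_multiples[OF is_ideal_monomials_ideal[OF assms]]])
      fix k assume "k \<in> keys q"
      with q have "k \<in> M \<or> (\<exists>m. k = m + u)" unfolding monomials_ideal_def by blast
      then show "single k (lookup q k) \<in> ?S"
      proof
        assume "k \<in> M"
        then have "single k (lookup q k) + 0 * single u 1 \<in> ?S"
          unfolding monomials_ideal_def
          by (intro CollectI exI[of _ "single k (lookup q k)"] exI[of _ 0]) (auto split: if_splits)
        then show ?thesis by simp
      next
        assume "\<exists>m. k = m + u"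
        then obtain m where k: "k = m + u" by blast
        have "0 + single m (lookup q k) * single u 1 \<in> ?S"
          unfolding monomials_ideal_def
          by (intro CollectI exI[of _ "single m (lookup q k)"] exI[of _ 0]) auto
        then show ?thesis by (simp add: mult_single k)
      qed
    qed
    then show "q \<in> ?S" by (simp add: mpoly_sum_single)
  qed
qed

lemma resolvable_add_monomial:
  fixes M :: "'v::finite monomial set"
  assumes "\<And>t. C t t" "\<And>x t. C x t \<Longrightarrow> x \<le> t"
    and M: "up_closed M" "resolvable C l t [s] (vec1 ` (monomials_ideal M :: ('v, 'a::comm_ring_1) mpoly set))"
    and u: "mdeg u + s = t" "s < t"
    and colon: "resolvable (=) l' (Suc t) [t] (vec1 ` (monomials_ideal {m. m + u \<in> M} :: ('v, 'a) mpoly set))"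
  shows "\<exists>l. resolvable C l t [s] (vec1 ` (monomials_ideal (M \<union> {m + u | m. True}) :: ('v, 'a) mpoly set))"
proof -
  have "\<exists>l. resolvable C l t [s] (vec1 ` {p + h * single u 1 | p h. p \<in> (monomials_ideal M :: ('v, 'a) mpoly set)})"
  proof (rule resolvable_add_generator[of C "monomials_ideal M" l t s "single u 1" l'])
    show "resolvable (=) l' (Suc t) [t] (vec1 ` {h :: ('v, 'a) mpoly. h * single u 1 \<in> monomials_ideal M})"
      unfolding monomials_ideal_colon by (rule colon)
  qed (use assms is_ideal_monomials_ideal[OF M(1), where ?'a = 'a] in \<open>auto split: if_splits\<close>)
  then show ?thesis unfolding monomials_ideal_add_monomial[OF M(1)] .
qed

section \<open>Ideals generated by variables\<close>

definition divisible_by_var :: "'v set \<Rightarrow> 'v monomial set" where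
  "divisible_by_var A = {m. \<exists>i\<in>A. lookup m i > 0}"

lemma up_closed_divisible_by_var: "up_closed (divisible_by_var A)"
  by (fastforce simp: up_closed_def divisible_by_var_def lookup_add)

lemma minus_single_plus: "lookup m i > 0 \<Longrightarrow> m - single i 1 + single i 1 = (m :: 'v monomial)"
  by (rule poly_mapping_eqI) (auto simp: lookup_add lookup_minus lookup_single when_def)

text \<open>This is the Koszul resolution. A new variable is a nonzerodivisor modulo the previous
  ones, so the colon ideal is the ideal of the previous step, now inside S(-(s+1)); hence
  \<open>s\<close> is arbitrary in the induction.\<close>

lemma resolvable_variables:
  fixes A :: "'v::finite set"
  shows "\<exists>l. resolvable (=) l (Suc s) [s] (vec1 ` (monomials_ideal (divisible_by_var A) :: ('v, 'a::comm_ring_1) mpoly set))"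
proof (induction A arbitrary: s rule: finite_induct[OF finite])
  case 1
  have "vec1 ` (monomials_ideal (divisible_by_var {}) :: ('v, 'a) mpoly set) = {0\<^sub>v 1}"
    by (auto simp: monomials_ideal_def divisible_by_var_def vec1_def intro!: eq_vecI)
  then have "resolvable (=) 0 (Suc s) [s] (vec1 ` (monomials_ideal (divisible_by_var {}) :: ('v, 'a) mpoly set))"
    by simp
  then show ?case by blast
next
  case (2 x A)
  let ?M = "divisible_by_var A :: 'v monomial set"
  have "{m. m + single x 1 \<in> ?M} = ?M"
    using 2(2) by (auto simp: divisible_by_var_def lookup_add lookup_single when_def split: if_splits)
  moreover have "?M \<union> {m + single x 1 | m. True} = divisible_by_var (insert x A)"
  proof -
    have "\<exists>m'. m = m' + single x 1" if "lookup m x > 0" for m :: "'v monomial"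
      using minus_single_plus[OF that] by metis
    then show ?thesis by (auto simp: divisible_by_var_def lookup_add)
  qed
  moreover obtain l where "resolvable (=) l (Suc s) [s] (vec1 ` (monomials_ideal ?M :: ('v, 'a) mpoly set))"
    using 2(3) by blast
  moreover obtain l' where "resolvable (=) l' (Suc (Suc s)) [Suc s] (vec1 ` (monomials_ideal ?M :: ('v, 'a) mpoly set))"
    using 2(3) by blast
  ultimately show ?case
    using resolvable_add_monomial[of "(=)" ?M l "Suc s" s "single x 1" l', where ?'a = 'a] up_closed_divisible_by_var[of A]
    by simp
qed


section \<open>Monomial orders and strongly stable sets\<close>

lemma monomial_order_compatible: "monomial_order \<tau> \<Longrightarrow> compatible_rel \<tau>"
  by (simp add: monomial_order_def compatible_rel_def)

lemma monomial_order_trans: "monomial_order \<tau> \<Longrightarrow> \<tau> a b \<Longrightarrow> \<tau> b c \<Longrightarrow> \<tau> a c"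
  unfolding monomial_order_def by (meson transpD)

lemma monomial_order_irrefl: "monomial_order \<tau> \<Longrightarrow> \<not> \<tau> a a"
  unfolding monomial_order_def by (meson irreflpD)

lemma monomial_order_total:
  assumes "monomial_order \<tau>" "a \<noteq> b"
  shows "\<tau> a b \<or> \<tau> b a"
proof -
  have "totalp \<tau>" using assms(1) by (simp add: monomial_order_def)
  then show ?thesis using assms(2) by (simp add: totalp_on_def)
qed

lemma monomial_order_add: "monomial_order \<tau> \<Longrightarrow> \<tau> a b \<Longrightarrow> \<tau> (a + c) (b + c)"
  unfolding monomial_order_def by blast

lemma monomial_order_add': "monomial_order \<tau> \<Longrightarrow> \<tau> a b \<Longrightarrow> \<tau> (c + a) (c + b)"
  using monomial_order_add[of \<tau> a b c] by (simp add: add.commute)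

lemma monomial_order_var: "monomial_order \<tau> \<Longrightarrow> i < j \<Longrightarrow> \<tau> (single i 1) (single j 1)"
  unfolding monomial_order_def by blast

lemma monomial_order_add_weak:
  assumes "monomial_order \<tau>" "a = b \<or> \<tau> a b" "c = d \<or> \<tau> c d"
  shows "a + c = b + d \<or> \<tau> (a + c) (b + d)"
  by (metis assms monomial_order_add monomial_order_add' monomial_order_trans)

lemma mdeg_eq_0: "mdeg m = 0 \<longleftrightarrow> (m :: 'v::finite monomial) = 0"
  by (auto simp: mdeg_sum intro!: poly_mapping_eqI)

text \<open>The factors of \<open>m\<close> are replaced by x_j one at a time. Variables with larger
  index are smaller, so each replacement moves in the same direction.\<close>

lemma monomial_between:
  assumes \<tau>: "monomial_order \<tau>"
  shows "(\<forall>i\<in>keys m. j \<le> i) \<longrightarrow> single j (mdeg m) = m \<or> \<tau> (single j (mdeg m)) m"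
    and "(\<forall>i\<in>keys m. i \<le> j) \<longrightarrow> m = single j (mdeg m) \<or> \<tau> m (single j (mdeg m))"
proof -
  have "((\<forall>i\<in>keys m. j \<le> i) \<longrightarrow> single j (mdeg m) = m \<or> \<tau> (single j (mdeg m)) m) \<and>
    ((\<forall>i\<in>keys m. i \<le> j) \<longrightarrow> m = single j (mdeg m) \<or> \<tau> m (single j (mdeg m)))"
  proof (induction "mdeg m" arbitrary: m)
    case 0
    then show ?case by (simp add: mdeg_eq_0)
  next
    case (Suc e)
    then have "m \<noteq> 0" by auto
    then obtain i where i: "i \<in> keys m" by (metis all_not_in_conv keys_eq_empty)
    define m' where "m' = m - single i 1"
    have m: "m = single i 1 + m'"
      using minus_single_plus[of m i] i by (simp add: m'_def in_keys_iff add.commute)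
    have deg: "mdeg m = Suc (mdeg m')" by (subst m) (simp add: mdeg_add)
    have keys: "keys m' \<subseteq> keys m" by (auto simp: m'_def in_keys_iff lookup_minus)
    have s: "single j (mdeg m) = single j 1 + single j (mdeg m')"
      by (simp add: deg flip: single_add)
    have IH: "(\<forall>i\<in>keys m'. j \<le> i) \<longrightarrow> single j (mdeg m') = m' \<or> \<tau> (single j (mdeg m')) m'"
      "(\<forall>i\<in>keys m'. i \<le> j) \<longrightarrow> m' = single j (mdeg m') \<or> \<tau> m' (single j (mdeg m'))"
      using Suc.hyps(1)[of m'] Suc.hyps(2) deg by auto
    show ?case
    proof (intro conjI impI)
      assume *: "\<forall>i\<in>keys m. j \<le> i"
      then have "single j 1 = single i (1::nat) \<or> \<tau> (single j 1) (single i 1)"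
        using bspec[OF * i] monomial_order_var[OF \<tau>, of j i] by (cases "i = j") simp_all
      moreover have "single j (mdeg m') = m' \<or> \<tau> (single j (mdeg m')) m'" using IH(1) * keys by blast
      ultimately show "single j (mdeg m) = m \<or> \<tau> (single j (mdeg m)) m"
        unfolding s by (subst (1 2) m) (rule monomial_order_add_weak[OF \<tau>])
    next
      assume *: "\<forall>i\<in>keys m. i \<le> j"
      then have "single i (1::nat) = single j 1 \<or> \<tau> (single i 1) (single j 1)"
        using bspec[OF * i] monomial_order_var[OF \<tau>, of i j] by (cases "i = j") simp_all
      moreover have "m' = single j (mdeg m') \<or> \<tau> m' (single j (mdeg m'))" using IH(2) * keys by blast
      ultimately show "m = single j (mdeg m) \<or> \<tau> m (single j (mdeg m))"
        unfolding s by (subst (1 2) m) (rule monomial_order_add_weak[OF \<tau>])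
    qed
  qed
  then show "(\<forall>i\<in>keys m. j \<le> i) \<longrightarrow> single j (mdeg m) = m \<or> \<tau> (single j (mdeg m)) m"
    "(\<forall>i\<in>keys m. i \<le> j) \<longrightarrow> m = single j (mdeg m) \<or> \<tau> m (single j (mdeg m))" by auto
qed

text \<open>Applied to a monomial order this selects the least generator; applied to the converse
  relation, the largest leading monomial in \<open>leads_span\<close>.\<close>

lemma ex_least:
  assumes "\<And>a b c. R a b \<Longrightarrow> R b c \<Longrightarrow> R a c" "\<And>a b. a \<noteq> b \<Longrightarrow> R a b \<or> R b a"
    and "finite G" "G \<noteq> {}"
  shows "\<exists>u\<in>G. \<forall>v\<in>G. v \<noteq> u \<longrightarrow> R v u"
  using assms(3,4)
proof (induction G rule: finite_ne_induct)
  case (insert x F)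
  then obtain u where u: "u \<in> F" "\<forall>v\<in>F. v \<noteq> u \<longrightarrow> R v u" by blast
  have "x \<noteq> u" using u insert by blast
  then consider "R x u" | "R u x" using assms(2) by blast
  then show ?case
  proof cases
    case 1
    with u show ?thesis by blast
  next
    case 2
    have "R v x" if "v \<in> F" for v
      using u(2) that 2 assms(1)[OF _ 2] by (cases "v = u") auto
    then show ?thesis by blast
  qed
qed auto

section \<open>Strongly stable sets of generators\<close>

definition multiples_of :: "'v monomial set \<Rightarrow> 'v monomial set" where
  "multiples_of G = {m + g | m g. g \<in> G}"

lemma up_closed_multiples_of: "up_closed (multiples_of G)"
  unfolding up_closed_def multiples_of_def
proof safe
  fix t m g assume "g \<in> G"
  then show "\<exists>m' g'. m + g + t = m' + g' \<and> g' \<in> G"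
    by (intro exI[of _ "m + t"] exI[of _ g]) (simp add: ac_simps)
qed

definition strongly_stable :: "'v::linorder monomial set \<Rightarrow> bool" where
  "strongly_stable G \<longleftrightarrow> (\<forall>w i j. w + single j 1 \<in> G \<longrightarrow> i < j \<longrightarrow> w + single i 1 \<in> G)"

text \<open>
  The generators are added in decreasing order: by stability, the multipliers carrying a new
  generator \<open>u\<close> into the previous ideal are those divisible by a variable larger than the
  smallest variable of \<open>u\<close>.
\<close>

lemma strongly_stable_colon:
  fixes u :: "'v::{finite,linorder} monomial"
  assumes \<tau>: "monomial_order \<tau>" and G: "strongly_stable G" "\<And>v. v \<in> G \<Longrightarrow> mdeg v = d"
    and u: "u \<in> G" "\<And>v. v \<in> G \<Longrightarrow> v \<noteq> u \<Longrightarrow> \<tau> v u"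
  shows "{m. m + u \<in> multiples_of (G - {u})} = divisible_by_var {i. \<exists>j\<in>keys u. i < j}" (is "?L = ?R")
proof
  show "?R \<subseteq> ?L"
  proof
    fix m assume "m \<in> ?R"
    then obtain i j where ij: "j \<in> keys u" "i < j" "lookup m i > 0" by (auto simp: divisible_by_var_def)
    define w where "w = u - single j 1"
    have w: "w + single j 1 = u" using minus_single_plus[of u j] ij(1) by (simp add: w_def in_keys_iff)
    have "w + single i 1 \<in> G" using G(1) ij(2) u(1) w unfolding strongly_stable_def by metis
    moreover have "w + single i 1 \<noteq> u"
      using monomial_order_add'[OF \<tau> monomial_order_var[OF \<tau> ij(2)], of w] w monomial_order_irrefl[OF \<tau>] by metis
    moreover have "m + u = (m - single i 1 + single j 1) + (w + single i 1)"
    proof -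
      have "m + u = (m - single i 1 + single i 1) + (w + single j 1)"
        using minus_single_plus[OF ij(3)] w by simp
      then show ?thesis by (simp add: ac_simps)
    qed
    ultimately show "m \<in> ?L" unfolding multiples_of_def by blast
  qed
  show "?L \<subseteq> ?R"
  proof
    fix m assume "m \<in> ?L"
    then obtain n v where v: "v \<in> G" "v \<noteq> u" "m + u = n + v" by (auto simp: multiples_of_def)
    show "m \<in> ?R"
    proof (rule ccontr)
      assume m: "m \<notin> ?R"
      \<comment> \<open>\<open>v'\<close> and \<open>u'\<close> are \<open>v\<close> and
        \<open>u\<close> divided by their gcd. As \<open>m\<close> avoids all variables larger than
        the smallest variable x_j of \<open>u\<close>, only x_j and larger variables occur in
        \<open>u'\<close>, and only x_j and smaller ones in \<open>v'\<close>. So u' >= x_j^e >= v'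
        for the common degree e, contradicting v > u.\<close>
      define v' where "v' = v - u"
      define u' where "u' = u - v"
      have sum: "v + u' = u + v'"
        by (rule poly_mapping_eqI) (auto simp: u'_def v'_def lookup_add lookup_minus)
      have deg: "mdeg u' = mdeg v'"
        using arg_cong[OF sum, of mdeg] G(2)[OF v(1)] G(2)[OF u(1)] by (simp add: mdeg_add)
      have "v' \<noteq> 0"
      proof
        assume "v' = 0"
        then have "u' = 0" using deg by (simp add: mdeg_eq_0)
        then show False using sum \<open>v' = 0\<close> v(2) by simp
      qed
      then have "u' \<noteq> 0" using deg by (metis mdeg_eq_0)
      have ku: "keys u' \<subseteq> keys u" by (auto simp: u'_def in_keys_iff lookup_minus)
      with \<open>u' \<noteq> 0\<close> have ne: "keys u \<noteq> {}" by (metis keys_eq_empty subset_empty)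
      define j where "j = Max (keys u)"
      have j: "j \<in> keys u" "\<And>i. i \<in> keys u \<Longrightarrow> i \<le> j" using ne by (auto simp: j_def)
      have kv: "j \<le> i" if "i \<in> keys v'" for i
      proof (rule ccontr)
        assume "\<not> j \<le> i"
        then have "i \<in> {i. \<exists>j\<in>keys u. i < j}" using j(1) by (auto simp: not_le)
        then have "lookup m i = 0" using m by (auto simp: divisible_by_var_def)
        moreover have "lookup m i + lookup u i = lookup n i + lookup v i"
          using arg_cong[OF v(3), of "\<lambda>x. lookup x i"] by (simp add: lookup_add)
        ultimately show False using that by (simp add: v'_def in_keys_iff lookup_minus)
      qed
      have "u' = single j (mdeg u') \<or> \<tau> u' (single j (mdeg u'))"
        using monomial_between(2)[OF \<tau>] ku j(2) by blast
      moreover have "single j (mdeg u') = v' \<or> \<tau> (single j (mdeg u')) v'"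
        using monomial_between(1)[OF \<tau>] kv unfolding deg by blast
      ultimately have le: "u' = v' \<or> \<tau> u' v'" using monomial_order_trans[OF \<tau>] by metis
      have "\<tau> (v + u') (u + u')" using u(2)[OF v(1,2)] monomial_order_add[OF \<tau>] by blast
      then have "\<tau> (u + v') (u + u')" by (simp add: sum)
      with le show False
        using monomial_order_add'[OF \<tau>] monomial_order_trans[OF \<tau>] monomial_order_irrefl[OF \<tau>] by metis
    qed
  qed
qed

text \<open>The least generator \<open>u\<close> is removed: replacing variables by larger ones
  increases a monomial, so no other generator is moved to \<open>u\<close> and the rest stays
  strongly stable. Adding \<open>u\<close> back involves a colon ideal generated by variables, whose
  resolution is linear.\<close>

lemma resolvable_strongly_stable:
  fixes G :: "'v::{finite,linorder} monomial set"
  assumes \<tau>: "monomial_order (\<tau> :: 'v monomial \<Rightarrow> 'v monomial \<Rightarrow> bool)" and "finite G" "strongly_stable G"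
    and deg: "\<And>v. v \<in> G \<Longrightarrow> mdeg v = d" "0 < d"
  shows "\<exists>l. resolvable (\<le>) l d [0] (vec1 ` (monomials_ideal (multiples_of G) :: ('v, 'a::comm_ring_1) mpoly set))"
  using assms(2,3) deg(1)
proof (induction "card G" arbitrary: G)
  case 0
  then have "multiples_of G = {}" by (simp add: multiples_of_def)
  then have "vec1 ` (monomials_ideal (multiples_of G) :: ('v, 'a) mpoly set) = {0\<^sub>v 1}"
    by (auto simp: monomials_ideal_def vec1_def intro!: eq_vecI)
  then have "resolvable (\<le>) 0 d [0] (vec1 ` (monomials_ideal (multiples_of G) :: ('v, 'a) mpoly set))"
    by simp
  then show ?case by blast
next
  case (Suc k)
  then have "G \<noteq> {}" by auto
  have "\<exists>u\<in>G. \<forall>v\<in>G. v \<noteq> u \<longrightarrow> \<tau> v u"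
  proof (rule ex_least[of \<tau> G])
    show "\<tau> a c" if "\<tau> a b" "\<tau> b c" for a b c using that by (rule monomial_order_trans[OF \<tau>])
    show "\<tau> a b \<or> \<tau> b a" if "a \<noteq> b" for a b using that by (rule monomial_order_total[OF \<tau>])
  qed (use Suc.prems(1) \<open>G \<noteq> {}\<close> in simp_all)
  then obtain u where u: "u \<in> G" "\<And>v. v \<in> G \<Longrightarrow> v \<noteq> u \<Longrightarrow> \<tau> v u" by blast
  let ?G = "G - {u}"
  have "strongly_stable ?G"
    unfolding strongly_stable_def
  proof (intro allI impI)
    fix w i j assume *: "w + single j 1 \<in> ?G" "i < (j :: 'v)"
    then have "w + single i 1 \<in> G" using Suc.prems(2) unfolding strongly_stable_def by blast
    moreover have "\<tau> (w + single i 1) u"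
      using monomial_order_trans[OF \<tau> monomial_order_add'[OF \<tau> monomial_order_var[OF \<tau> *(2)], of w] u(2)] *(1) by blast
    ultimately show "w + single i 1 \<in> ?G" using monomial_order_irrefl[OF \<tau>] by blast
  qed
  moreover have "k = card ?G" using Suc.hyps(2) Suc.prems(1) u(1) by simp
  ultimately obtain l where l: "resolvable (\<le>) l d [0] (vec1 ` (monomials_ideal (multiples_of ?G) :: ('v, 'a) mpoly set))"
    using Suc.hyps(1)[of ?G] Suc.prems by blast
  have "{m. m + u \<in> multiples_of ?G} = divisible_by_var {i. \<exists>j\<in>keys u. i < j}"
    by (rule strongly_stable_colon[OF \<tau> Suc.prems(2,3) u])
  with resolvable_variables[of d "{i. \<exists>j\<in>keys u. i < j}", where ?'a = 'a]
  obtain l' where l': "resolvable (=) l' (Suc d) [d]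
      (vec1 ` (monomials_ideal {m. m + u \<in> multiples_of ?G} :: ('v, 'a) mpoly set))"
    by auto
  have "multiples_of ?G \<union> {m + u | m. True} = multiples_of G"
    using u(1) by (auto simp: multiples_of_def)
  moreover have "\<exists>l. resolvable (\<le>) l d [0] (vec1 ` (monomials_ideal (multiples_of ?G \<union> {m + u | m. True}) :: ('v, 'a) mpoly set))"
    by (rule resolvable_add_monomial[OF _ _ up_closed_multiples_of l _ deg(2) l']) (use Suc.prems(3) u(1) in auto)
  ultimately show ?case by simp
qed

text \<open>Unrolls the recursion into sequences: the resolution of the first syzygies, shifted by
  one position, is prefixed by the first matrix.\<close>

lemma resolvable_resolution:
  fixes N :: "('v, 'a::comm_ring_1) mpoly Matrix.vec set"
  shows "resolvable C l t b N \<Longrightarrow>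
    \<exists>a d. (\<forall>i\<ge>l. a i = []) \<and> graded_hom (a 0) b (d 0) \<and> (\<forall>i. graded_hom (a (Suc i)) (a i) (d (Suc i))) \<and>
      (\<forall>j<length b. \<forall>k<length (a 0). lookup (d 0 $$ (j, k)) 0 = 0) \<and>
      hom_image (d 0) = N \<and> (\<forall>i. hom_image (d (Suc i)) = hom_kernel (d i)) \<and>
      (\<forall>i. \<forall>j<length (a i). \<forall>k<length (a (Suc i)). lookup (d (Suc i) $$ (j, k)) 0 = 0) \<and>
      (\<forall>i. \<forall>x\<in>set (a i). C x (t + i))"
proof (induction l arbitrary: t b N)
  case 0
  \<comment> \<open>All modules are zero; only the first matrix keeps the \<open>length b\<close>
    rows of its target.\<close>
  then show ?case
    by (intro exI[of _ "\<lambda>_. []"] exI[of _ "case_nat (0\<^sub>m (length b) 0) (\<lambda>_. 0\<^sub>m 0 0)"])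
      (auto simp: graded_hom_def hom_image_no_cols hom_kernel_no_cols split: nat.splits)
next
  case (Suc l)
  from Suc.prems obtain a0 M where M: "\<forall>x\<in>set a0. C x t" "graded_hom a0 b M" "hom_image M = N"
    "\<forall>j<length b. \<forall>k<length a0. lookup (M $$ (j, k)) 0 = 0" "resolvable C l (Suc t) a0 (hom_kernel M)"
    by auto
  from Suc.IH[OF M(5)] obtain a d where ad: "\<forall>i\<ge>l. a i = []" "graded_hom (a 0) a0 (d 0)"
    "\<forall>i. graded_hom (a (Suc i)) (a i) (d (Suc i))"
    "hom_image (d 0) = hom_kernel M" "\<forall>i. hom_image (d (Suc i)) = hom_kernel (d i)"
    "\<forall>i. \<forall>j<length (a i). \<forall>k<length (a (Suc i)). lookup (d (Suc i) $$ (j, k)) 0 = 0"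
    "\<forall>i. \<forall>x\<in>set (a i). C x (Suc t + i)"
    "\<forall>j<length a0. \<forall>k<length (a 0). lookup (d 0 $$ (j, k)) 0 = 0" by blast
  let ?a = "case_nat a0 a" and ?d = "case_nat M d"
  have "?a i = []" if "Suc l \<le> i" for i
    using that ad(1) by (cases i) simp_all
  moreover have "graded_hom (?a 0) b (?d 0)" "hom_image (?d 0) = N" using M(2,3) by simp_all
  moreover have "graded_hom (?a (Suc i)) (?a i) (?d (Suc i))" "hom_image (?d (Suc i)) = hom_kernel (?d i)" for i
    using ad(2-5) by (cases i; simp)+
  moreover have "\<forall>j<length (?a i). \<forall>k<length (?a (Suc i)). lookup (?d (Suc i) $$ (j, k)) 0 = 0" for i
    using ad(6,8) by (cases i) simp_all
  moreover have "\<forall>j<length b. \<forall>k<length (?a 0). lookup (?d 0 $$ (j, k)) 0 = 0" using M(4) by simp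
  moreover have "\<forall>x\<in>set (?a i). C x (t + i)" for i
    using M(1) ad(7) by (cases i) simp_all
  ultimately show ?case by (intro exI[of _ ?a] exI[of _ ?d]) blast
qed

section \<open>Zariski open sets of matrices\<close>

text \<open>Restricts a polynomial in several variables to a parametrized curve, where it becomes a
  univariate polynomial in the parameter.\<close>

lemma poly_mpoly_subst:
  "poly (mpoly_subst (\<lambda>c. [:c:]) F p) t = mpoly_subst (\<lambda>c. c) (\<lambda>v. poly (F v) t) (p :: ('v, 'a::field) mpoly)"
  by (simp add: mpoly_subst_def poly_sum poly_prod)

lemma poly_det:
  fixes M :: "'a::field poly^'n^'n"
  shows "poly (det M) t = det (\<chi> i j. poly (M $ i $ j) t)"
  by (simp add: det_def poly_sum poly_prod)

text \<open>Two points of the open sets are joined by a line, along which the nonvanishing conditions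
  exclude only finitely many parameters.\<close>

lemma zariski_open_GL_inter:
  fixes U V :: "('a::field_char_0^'n^'n) set"
  assumes "zariski_open_GL U" "U \<noteq> {}" "zariski_open_GL V" "V \<noteq> {}"
  shows "U \<inter> V \<noteq> {}"
proof -
  obtain P where P: "U = {g. invertible g \<and> (\<exists>p\<in>P. mpoly_subst (\<lambda>c. c) (\<lambda>(i, j). g $ i $ j) p \<noteq> 0)}"
    using assms(1) unfolding zariski_open_GL_def by blast
  obtain Q where Q: "V = {g. invertible g \<and> (\<exists>p\<in>Q. mpoly_subst (\<lambda>c. c) (\<lambda>(i, j). g $ i $ j) p \<noteq> 0)}"
    using assms(3) unfolding zariski_open_GL_def by blast
  obtain g p where g: "invertible g" "p \<in> P" "mpoly_subst (\<lambda>c. c) (\<lambda>(i, j). g $ i $ j) p \<noteq> 0"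
    using assms(2) unfolding P by blast
  obtain h q where h: "invertible h" "q \<in> Q" "mpoly_subst (\<lambda>c. c) (\<lambda>(i, j). h $ i $ j) q \<noteq> 0"
    using assms(4) unfolding Q by blast
  \<comment> \<open>The entries are g + t (h - g) as polynomials in t, so the line passes through
    \<open>g\<close> at 0 and \<open>h\<close> at 1.\<close>
  define L where "L = (\<chi> i j. [:g $ i $ j, h $ i $ j - g $ i $ j:])"
  define l where "l t = (\<chi> i j. poly (L $ i $ j) t)" for t
  let ?F = "\<lambda>p. mpoly_subst (\<lambda>c. [:c:]) (\<lambda>(i, j). L $ i $ j) p"
  have F: "poly (?F p) t = mpoly_subst (\<lambda>c. c) (\<lambda>(i, j). l t $ i $ j) p" for p t
    by (simp add: poly_mpoly_subst l_def case_prod_unfold)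
  have D: "poly (det L) t = det (l t)" for t by (simp add: poly_det l_def)
  have l0: "l 0 = g" and l1: "l 1 = h" by (simp_all add: l_def L_def Finite_Cartesian_Product.vec_eq_iff)
  have "poly (?F p) 0 \<noteq> 0" "poly (?F q) 1 \<noteq> 0" "poly (det L) 0 \<noteq> 0"
    using g h by (simp_all only: F D l0 l1 invertible_det_nz not_False_eq_True)
  then have "?F p \<noteq> 0" "?F q \<noteq> 0" "det L \<noteq> 0" by (metis poly_0)+
  then have "?F p * ?F q * det L \<noteq> 0" by simp
  then have "finite {t. poly (?F p * ?F q * det L) t = 0}" by (rule poly_roots_finite)
  then have "{t. poly (?F p * ?F q * det L) t = 0} \<noteq> UNIV"
    using infinite_UNIV_char_0[where 'a = 'a] by metis
  then obtain t where t: "poly (?F p * ?F q * det L) t \<noteq> 0" by blast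
  then have "poly (?F p) t \<noteq> 0" "poly (?F q) t \<noteq> 0" "poly (det L) t \<noteq> 0" by simp_all
  then have "l t \<in> U" "l t \<in> V"
    unfolding P Q F D using g(2) h(2) by (simp_all only: mem_Collect_eq invertible_det_nz) blast+
  then show ?thesis by blast
qed

section \<open>The big cell and its triangular factorization\<close>

text \<open>The submatrix on \<open>S\<close>, padded with the identity so that its determinant is
  the principal minor without a change of matrix type.\<close>

definition principal_block :: "'n::finite set \<Rightarrow> 'a::comm_ring_1^'n^'n \<Rightarrow> 'a^'n^'n" where
  "principal_block S g = (\<chi> i j. if i \<in> S \<and> j \<in> S then g $ i $ j else if i = j then 1 else 0)"

text \<open>All leading principal minors are nonzero. Listing the minor before \<open>j\<close> next
  to the one up to \<open>j\<close> avoids naming the predecessor of an index.\<close>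

definition big_cell :: "('a::field^('n::{finite,linorder})^('n::{finite,linorder})) set" where
  "big_cell = {g. invertible g \<and> (\<forall>j. det (principal_block {..<j} g) \<noteq> 0 \<and> det (principal_block {..j} g) \<noteq> 0)}"

text \<open>Evaluation at the entries of a matrix is a ring homomorphism and commutes with
  determinants, so the product of the minors of the generic matrix \<open>X\<close> is a single
  polynomial that defines the set inside GL.\<close>

lemma zariski_open_big_cell: "zariski_open_GL (big_cell :: ('a::field^('n::{finite,linorder})^('n::{finite,linorder})) set)"
proof -
  define X :: "('n \<times> 'n, 'a) mpoly^('n::_)^('n::_)" where "X = (\<chi> i j. single (single (i, j) 1) 1)"
  define p where "p = (\<Prod>j\<in>UNIV. det (principal_block {..<j} X) * det (principal_block {..j} X))"
  have "mpoly_subst (\<lambda>c. c) (\<lambda>(i, j). g $ i $ j) p =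
      (\<Prod>j\<in>UNIV. det (principal_block {..<j} g) * det (principal_block {..j} g))" for g :: "'a^('n::_)^('n::_)"
  proof -
    let ?e = "mpoly_subst (\<lambda>c. c) (\<lambda>(i, j). g $ i $ j)"
    have single: "?e (single m a) = a * (\<Prod>v\<in>UNIV. (case v of (i, j) \<Rightarrow> g $ i $ j) ^ lookup m v)" for m a
      by (rule mpoly_subst_single) simp
    have add: "?e (a + b) = ?e a + ?e b" for a b by (rule mpoly_subst_add) simp_all
    have mult: "?e (a * b) = ?e a * ?e b" for a b by (rule mpoly_subst_mult) simp_all
    have zero: "?e 0 = 0" by (simp add: mpoly_subst_def)
    have of_int: "?e (of_int k) = of_int k" for k
      using single[of 0 "of_int k"] by simp
    have one: "?e 1 = 1" using of_int[of 1] by simp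
    have sum: "?e (sum f A) = (\<Sum>x\<in>A. ?e (f x))" for f and A :: "('n \<Rightarrow> 'n) set"
      by (induction A rule: infinite_finite_induct) (simp_all add: zero add)
    have prod: "?e (prod f A) = (\<Prod>x\<in>A. ?e (f x))" for f and A :: "'n set"
      by (induction A rule: infinite_finite_induct) (simp_all add: one mult)
    have var: "?e (X $ i $ j) = g $ i $ j" for i j
      unfolding X_def by (simp add: single prod_var[unfolded One_nat_def])
    have det: "?e (det M) = det (\<chi> i j. ?e (M $ i $ j))" for M :: "('n \<times> 'n, 'a) mpoly^('n::_)^('n::_)"
      by (simp add: det_def sum mult of_int prod)
    have "?e (det (principal_block S X)) = det (principal_block S g)" for S
      unfolding det by (rule arg_cong[of _ _ det]) (simp add: principal_block_def Finite_Cartesian_Product.vec_eq_iff var zero one)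
    then show ?thesis by (simp add: p_def prod mult)
  qed
  then have "big_cell = {g :: 'a^('n::_)^('n::_). invertible g \<and> (\<exists>p\<in>{p}. mpoly_subst (\<lambda>c. c) (\<lambda>(i, j). g $ i $ j) p \<noteq> 0)}"
    by (simp add: big_cell_def)
  then show ?thesis unfolding zariski_open_GL_def by blast
qed

lemma big_cell_nonempty: "big_cell \<noteq> ({} :: ('a::field^('n::{finite,linorder})^('n::{finite,linorder})) set)"
proof -
  have "principal_block S (mat 1 :: 'a^('n::_)^('n::_)) = mat 1" for S
    by (simp add: principal_block_def Finite_Cartesian_Product.mat_def Finite_Cartesian_Product.vec_eq_iff)
  then have "(mat 1 :: 'a^('n::_)^('n::_)) \<in> big_cell" by (simp add: big_cell_def invertible_det_nz)
  then show ?thesis by blast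
qed

definition upper_unitriangular :: "'a::field^('n::{finite,linorder})^('n::{finite,linorder}) \<Rightarrow> bool" where
  "upper_unitriangular V \<longleftrightarrow> (\<forall>i j. j < i \<longrightarrow> V $ i $ j = 0) \<and> (\<forall>j. V $ j $ j = 1)"

text \<open>Applied at the last nonzero entry of a vector: \<open>V\<close> leaves this entry
  unchanged.\<close>

lemma upper_unitriangular_mult_last:
  fixes V :: "'a::field^('n::{finite,linorder})^('n::{finite,linorder})"
  assumes "upper_unitriangular V" "\<And>l. i < l \<Longrightarrow> x l = 0"
  shows "(\<Sum>l\<in>UNIV. V $ i $ l * x l) = x i"
proof -
  have "(\<Sum>l\<in>UNIV. V $ i $ l * x l) = (\<Sum>l\<in>UNIV. if l = i then x l else 0)"
  proof (rule sum.cong)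
    fix l
    show "V $ i $ l * x l = (if l = i then x l else 0)"
      using assms by (cases l i rule: linorder_cases) (auto simp: upper_unitriangular_def)
  qed simp
  then show ?thesis by simp
qed

text \<open>Survival of the last nonzero entry shows that the kernel is zero; applied to column j of
  the inverse, it shows that this column ends with a 1 in row j.\<close>

lemma upper_unitriangular_inverse:
  fixes V :: "'a::field^('n::{finite,linorder})^('n::{finite,linorder})"
  assumes V: "upper_unitriangular V"
  shows "\<exists>X. V ** X = mat 1 \<and> X ** V = mat 1 \<and> upper_unitriangular X"
proof -
  have "x = 0" if "V *v x = 0" for x
  proof (rule ccontr)
    assume "x \<noteq> 0"
    then have ne: "{i. x $ i \<noteq> 0} \<noteq> {}" by (auto simp: Finite_Cartesian_Product.vec_eq_iff)
    define i where "i = Max {i. x $ i \<noteq> 0}"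
    have i: "x $ i \<noteq> 0" using Max_in[OF _ ne] by (simp add: i_def)
    have "x $ l = 0" if "i < l" for l
      using that Max_ge[of "{i. x $ i \<noteq> 0}" l] unfolding i_def by (metis finite leD mem_Collect_eq)
    then have "(V *v x) $ i = x $ i"
      using upper_unitriangular_mult_last[OF V, of i "\<lambda>l. x $ l"] by (simp add: matrix_vector_mult_def)
    with that i show False by simp
  qed
  then have "\<exists>B. B ** V = mat 1" by (simp add: matrix_left_invertible_ker)
  then obtain X where X: "X ** V = mat 1" "V ** X = mat 1" using matrix_left_right_inverse by blast
  have VX: "(\<Sum>l\<in>UNIV. V $ i $ l * X $ l $ j) = (if i = j then 1 else 0)" for i j
  proof -
    have "(V ** X) $ i $ j = (mat 1 :: 'a^('n::_)^('n::_)) $ i $ j" by (simp add: X)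
    then show ?thesis by (simp add: matrix_matrix_mult_def Finite_Cartesian_Product.mat_def)
  qed
  have low: "X $ i $ j = 0" if "j < i" for i j
  proof (rule ccontr)
    assume "X $ i $ j \<noteq> 0"
    let ?S = "{i. j < i \<and> X $ i $ j \<noteq> 0}"
    have ne: "?S \<noteq> {}" using that \<open>X $ i $ j \<noteq> 0\<close> by blast
    define k where "k = Max ?S"
    have k: "j < k" "X $ k $ j \<noteq> 0" using Max_in[OF _ ne] by (simp_all add: k_def)
    have "X $ l $ j = 0" if "k < l" for l
      using that k(1) Max_ge[of ?S l] unfolding k_def by (metis (mono_tags, lifting) finite leD mem_Collect_eq order.strict_trans)
    then have "X $ k $ j = 0"
      using upper_unitriangular_mult_last[OF V, of k "\<lambda>l. X $ l $ j"] VX[of k j] k(1)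
      by (cases "k = j") simp_all
    with k show False by simp
  qed
  have "X $ j $ j = 1" for j
    using upper_unitriangular_mult_last[OF V, of j "\<lambda>l. X $ l $ j"] VX[of j j] low by simp
  with low X show ?thesis unfolding upper_unitriangular_def by blast
qed

text \<open>One step of column elimination: \<open>w\<close> is the column of a unitriangular right
  factor that clears column \<open>j\<close> above the diagonal. The block before \<open>j\<close>
  determines \<open>w\<close>; the block up to \<open>j\<close> excludes a zero on the
  diagonal.\<close>

lemma big_cell_column:
  fixes g :: "'a::field^('n::{finite,linorder})^('n::{finite,linorder})"
  assumes g: "g \<in> big_cell"
  shows "\<exists>w. (\<forall>i. j < i \<longrightarrow> w $ i = 0) \<and> w $ j = 1 \<and>
    (\<forall>i. i < j \<longrightarrow> (\<Sum>l\<in>UNIV. g $ i $ l * w $ l) = 0) \<and> (\<Sum>l\<in>UNIV. g $ j $ l * w $ l) \<noteq> 0"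
proof -
  let ?A = "principal_block {..<j} g" and ?C = "principal_block {..j} g"
  have "invertible ?A" "invertible ?C" using g by (auto simp: big_cell_def invertible_det_nz)
  then obtain A' C' where A': "?A ** A' = mat 1" and C': "C' ** ?C = mat 1"
    unfolding invertible_def by blast
  \<comment> \<open>From row \<open>j\<close> on, \<open>?A\<close> has unit rows, so solving
    \<open>?A *v w = b\<close> copies these entries of \<open>b\<close> into \<open>w\<close>; the
    earlier entries of \<open>b\<close> cancel the contribution of column \<open>j\<close> of
    \<open>g\<close>.\<close>
  define b :: "'a^('n::_)" where "b = (\<chi> i. if i < j then - g $ i $ j else if i = j then 1 else 0)"
  define w where "w = A' *v b"
  have Aw: "(\<Sum>l\<in>UNIV. ?A $ i $ l * w $ l) = b $ i" for i
  proof -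
    have "?A *v w = b" by (simp add: w_def matrix_vector_mul_assoc A')
    then show ?thesis by (simp add: matrix_vector_mult_def Finite_Cartesian_Product.vec_eq_iff)
  qed
  have row: "(\<Sum>l\<in>UNIV. principal_block S g $ i $ l * x l) = x i" if "i \<notin> S" for S i and x :: "'n \<Rightarrow> 'a"
  proof -
    have "(\<Sum>l\<in>UNIV. principal_block S g $ i $ l * x l) = (\<Sum>l\<in>UNIV. if l = i then x l else 0)"
      using that by (intro sum.cong) (auto simp: principal_block_def)
    then show ?thesis by simp
  qed
  have w_ge: "w $ i = b $ i" if "j \<le> i" for i
    using Aw[of i] row[of i "{..<j}" "\<lambda>l. w $ l"] that by simp
  have w0: "w $ i = 0" if "j < i" for i using w_ge[of i] that by (auto simp: b_def)
  have wj: "w $ j = 1" using w_ge[of j] by (simp add: b_def)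
  have gw: "(\<Sum>l\<in>UNIV. g $ i $ l * w $ l) = 0" if "i < j" for i
  proof -
    have "(\<Sum>l\<in>UNIV. g $ i $ l * w $ l) = (\<Sum>l\<in>UNIV. ?A $ i $ l * w $ l + (if l = j then g $ i $ j else 0))"
    proof (rule sum.cong)
      fix l
      show "g $ i $ l * w $ l = ?A $ i $ l * w $ l + (if l = j then g $ i $ j else 0)"
        using that w0[of l] wj by (cases l j rule: linorder_cases) (auto simp: principal_block_def)
    qed simp
    then show ?thesis using Aw[of i] that by (simp add: sum.distrib b_def)
  qed
  have "(\<Sum>l\<in>UNIV. g $ j $ l * w $ l) \<noteq> 0"
  proof
    assume 0: "(\<Sum>l\<in>UNIV. g $ j $ l * w $ l) = 0"
    have "(\<Sum>l\<in>UNIV. ?C $ i $ l * w $ l) = 0" for i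
    proof (cases "i \<le> j")
      case True
      have "(\<Sum>l\<in>UNIV. ?C $ i $ l * w $ l) = (\<Sum>l\<in>UNIV. g $ i $ l * w $ l)"
        using w0 True by (intro sum.cong) (auto simp: principal_block_def)
      then show ?thesis using True 0 gw[of i] by (cases "i = j") auto
    next
      case False
      then show ?thesis using row[of i "{..j}" "\<lambda>l. w $ l"] w0[of i] by simp
    qed
    then have "?C *v w = 0" by (simp add: matrix_vector_mult_def Finite_Cartesian_Product.vec_eq_iff)
    then have "C' *v (?C *v w) = 0" by simp
    then have "w = 0" by (simp add: matrix_vector_mul_assoc C')
    with wj show False by simp
  qed
  with w0 wj gw show ?thesis by blast
qed

text \<open>The columns just found form \<open>V\<close>; then L = g V, and \<open>X\<close> is the
  inverse of \<open>V\<close>. Both are returned because equality of an ideal with its image under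
  \<open>X\<close> also needs stability under the inverse.\<close>

lemma big_cell_LU:
  fixes g :: "'a::field^('n::{finite,linorder})^('n::{finite,linorder})"
  assumes g: "g \<in> big_cell"
  shows "\<exists>L X V. g = L ** X \<and> (\<forall>i j. i < j \<longrightarrow> L $ i $ j = 0) \<and> (\<forall>j. L $ j $ j \<noteq> 0) \<and>
    upper_unitriangular X \<and> upper_unitriangular V \<and> X ** V = mat 1"
proof -
  obtain w where w: "\<And>i j. j < i \<Longrightarrow> w j $ i = 0" "\<And>j. w j $ j = 1"
    "\<And>i j. i < j \<Longrightarrow> (\<Sum>l\<in>UNIV. g $ i $ l * w j $ l) = 0" "\<And>j. (\<Sum>l\<in>UNIV. g $ j $ l * w j $ l) \<noteq> 0"
    using big_cell_column[OF g] by metis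
  define V where "V = (\<chi> i j. w j $ i)"
  have V: "upper_unitriangular V" using w(1,2) by (simp add: upper_unitriangular_def V_def)
  obtain X where X: "V ** X = mat 1" "X ** V = mat 1" "upper_unitriangular X"
    using upper_unitriangular_inverse[OF V] by blast
  have "g = (g ** V) ** X" using X(1) by (simp flip: matrix_mul_assoc)
  moreover have "\<forall>i j. i < j \<longrightarrow> (g ** V) $ i $ j = 0" "\<forall>j. (g ** V) $ j $ j \<noteq> 0"
    using w(3,4) by (simp_all add: matrix_matrix_mult_def V_def)
  ultimately show ?thesis using X V by blast
qed

section \<open>Leading monomials on linear spans\<close>

interpretation mpoly_vs: vector_space "\<lambda>(c::'k::field) (p::('v, 'k) mpoly). single 0 c * p"
  by standard (simp_all add: algebra_simps single_add mult_single)

text \<open>Pairwise distinct leading monomials cannot cancel: the largest one that occurs survives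
  in every linear combination. This takes the place of a Groebner basis criterion.\<close>

lemma leads_span:
  fixes A :: "('v::{finite,linorder}, 'k::field) mpoly \<Rightarrow> ('v, 'k) mpoly"
  assumes \<sigma>: "monomial_order \<sigma>"
    and A: "\<And>x y. A (x + y) = A x + A y" "\<And>c x. A (single 0 c * x) = single 0 c * A x"
    and E: "\<And>x. x \<in> E \<Longrightarrow> leads \<sigma> (A x) (l x) (c x)" "\<And>x. x \<in> E \<Longrightarrow> c x \<noteq> 0" "inj_on l E"
    and h: "h \<in> mpoly_vs.span E" "A h \<noteq> 0"
  shows "\<exists>x\<in>E. \<exists>c. c \<noteq> 0 \<and> leads \<sigma> (A h) (l x) c"
proof -
  note R = monomial_order_compatible[OF \<sigma>]
  have A0: "A 0 = 0" using A(2)[of 0 0] by simp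
  have Asum: "A (sum g T) = (\<Sum>x\<in>T. A (g x))" for g T
    by (induction T rule: infinite_finite_induct) (simp_all add: A0 A(1))
  obtain T0 s where T0: "finite T0" "T0 \<subseteq> E" "h = (\<Sum>x\<in>T0. single 0 (s x) * x)"
    using h(1) unfolding mpoly_vs.span_explicit by blast
  \<comment> \<open>Vanishing coefficients are dropped, so that the largest remaining leading
    monomial has a nonzero coefficient.\<close>
  define T where "T = {x \<in> T0. s x \<noteq> 0}"
  have T: "finite T" "T \<subseteq> E" "\<And>x. x \<in> T \<Longrightarrow> s x \<noteq> 0" using T0 by (auto simp: T_def)
  have "h = (\<Sum>x\<in>T. single 0 (s x) * x)"
    unfolding T0(3) by (rule sum.mono_neutral_right) (use T0(1) in \<open>auto simp: T_def\<close>)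
  then have Ah: "A h = (\<Sum>x\<in>T. single 0 (s x) * A x)" by (simp only: Asum A(2))
  then have "T \<noteq> {}" using h(2) by auto
  then have "\<exists>u\<in>l ` T. \<forall>v\<in>l ` T. v \<noteq> u \<longrightarrow> \<sigma>\<inverse>\<inverse> v u"
    by (intro ex_least) (use T(1) monomial_order_trans[OF \<sigma>] monomial_order_total[OF \<sigma>] in auto)
  then obtain x where x: "x \<in> T" "\<And>y. y \<in> T \<Longrightarrow> l y \<noteq> l x \<Longrightarrow> \<sigma> (l x) (l y)" by auto
  have lead: "leads \<sigma> (single 0 (s y) * A y) (l y) (s y * c y)" if "y \<in> T" for y
  proof -
    have "leads \<sigma> (single 0 (s y)) 0 (s y)" unfolding leads_def by (rule exI[of _ 0]) simp
    from leads_mult[OF R this E(1)] show ?thesis using that T(2) by auto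
  qed
  let ?rest = "\<Sum>y\<in>T - {x}. single 0 (s y) * A y"
  have "\<sigma> (l x) k" if "k \<in> keys ?rest" for k
  proof -
    have "k \<in> (\<Union>y\<in>T - {x}. keys (single 0 (s y) * A y))"
      using that keys_sum[of "\<lambda>y. single 0 (s y) * A y" "T - {x}"] by (rule subsetD[rotated])
    then obtain y where y: "y \<in> T" "y \<noteq> x" "k \<in> keys (single 0 (s y) * A y)" by blast
    have "l y \<noteq> l x" using inj_onD[OF E(3)] y(1,2) x(1) T(2) by blast
    then have "\<sigma> (l x) (l y)" using x(2) y(1) by blast
    moreover have "k = l y \<or> \<sigma> (l y) k" using leads_keys[OF lead[OF y(1)] y(3)] .
    ultimately show ?thesis using monomial_order_trans[OF \<sigma>] by metis
  qed
  then have "leads \<sigma> (single 0 (s x) * A x + ?rest) (l x) (s x * c x)"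
    by (rule leads_add[OF lead[OF x(1)]])
  then have "leads \<sigma> (A h) (l x) (s x * c x)"
    unfolding Ah sum.remove[OF T(1) x(1), of "\<lambda>x. single 0 (s x) * A x"] .
  moreover have "x \<in> E" using T(2) x(1) by (rule subsetD)
  moreover have "s x * c x \<noteq> 0" using T(3)[OF x(1)] E(2)[OF \<open>x \<in> E\<close>] by simp
  ultimately show ?thesis by (intro bexI[of _ x] exI[of _ "s x * c x"] conjI)
qed

lemma gl_act_scale: "gl_act g (single 0 c * x) = single 0 c * gl_act g x"
  by (simp add: gl_act_mult)

lemma prod_single_power: "(\<Prod>v\<in>UNIV. single (single v 1) 1 ^ lookup m v) = (single m 1 :: ('v::finite, 'a::comm_ring_1) mpoly)"
proof -
  have pow: "single (single v 1) (1::'a) ^ e = single (single v e) 1" for v :: 'v and e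
    by (induction e) (simp_all add: mult_single flip: single_add)
  have "(\<Prod>v\<in>T. single (single v (lookup m v)) (1::'a)) = single (\<Sum>v\<in>T. single v (lookup m v)) 1" if "finite T" for T
    using that by induction (simp_all add: mult_single)
  then show ?thesis unfolding pow by (simp add: sum_single_lookup)
qed

lemma gl_act_mat_1: "gl_act (mat 1 :: 'a::comm_ring_1^'n^'n) p = p"
proof (induction p rule: mpoly_induct)
  case (single m c)
  have "gl_act (mat 1 :: 'a^'n^'n) (single (single j 1) 1) = single (single j 1) 1" for j
  proof -
    have "(\<Sum>i\<in>UNIV. single (single i 1) ((mat 1 :: 'a^'n^'n) $ i $ j)) = (\<Sum>i\<in>UNIV. if i = j then single (single i (1::nat)) 1 else 0)"
      by (rule sum.cong) (auto simp: Finite_Cartesian_Product.mat_def)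
    then show ?thesis by (simp only: gl_act_var) simp
  qed
  then show ?case
    by (simp only: gl_act_single[of _ m c] prod_single_power mult_single) simp
qed (simp_all add: gl_act_add)

section \<open>The reverse lexicographic order\<close>

text \<open>With a witness \<open>k\<close> in place of a maximum, transitivity and invariance under
  multiplication become direct.\<close>

lemma rlex_iff: "rlex a b \<longleftrightarrow> mdeg a > mdeg b \<or>
  mdeg a = mdeg b \<and> (\<exists>k. lookup a k < lookup b k \<and> (\<forall>i>k. lookup a i = lookup b i))"
proof -
  let ?S = "{i. lookup a i \<noteq> lookup b i}"
  have "a \<noteq> b \<and> lookup a (Max ?S) < lookup b (Max ?S) \<longleftrightarrow>
    (\<exists>k. lookup a k < lookup b k \<and> (\<forall>i>k. lookup a i = lookup b i))" (is "?l \<longleftrightarrow> ?r")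
  proof
    assume l: ?l
    have "lookup a i = lookup b i" if "i > Max ?S" for i
      using that Max_ge[of ?S i] by (metis (mono_tags, lifting) finite leD mem_Collect_eq)
    with l show ?r by blast
  next
    assume ?r
    then obtain k where k: "lookup a k < lookup b k" "\<forall>i>k. lookup a i = lookup b i" by blast
    have "Max ?S = k"
      using k by (intro Max_eqI) (auto simp: not_less[symmetric])
    with k show ?l by auto
  qed
  then show ?thesis unfolding rlex_def Let_def by blast
qed

lemma monomial_order_rlex: "monomial_order (rlex :: 'n::{finite,linorder} monomial \<Rightarrow> 'n monomial \<Rightarrow> bool)"
  unfolding monomial_order_def
proof (intro conjI allI impI)
  show "irreflp (rlex :: 'n monomial \<Rightarrow> 'n monomial \<Rightarrow> bool)"
    by (rule irreflpI) (auto simp: rlex_iff)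
  show "transp (rlex :: 'n monomial \<Rightarrow> 'n monomial \<Rightarrow> bool)"
  proof (rule transpI)
    fix a b c :: "'n monomial" assume ab: "rlex a b" and bc: "rlex b c"
    show "rlex a c"
    proof (cases "mdeg a > mdeg b \<or> mdeg b > mdeg c")
      case True
      with ab bc show ?thesis by (auto simp: rlex_iff)
    next
      case False
      then obtain k l where k: "lookup a k < lookup b k" "\<forall>i>k. lookup a i = lookup b i"
        and l: "lookup b l < lookup c l" "\<forall>i>l. lookup b i = lookup c i" and deg: "mdeg a = mdeg b" "mdeg b = mdeg c"
        using ab bc unfolding rlex_iff by blast
      \<comment> \<open>The later of the two positions is the last one where \<open>a\<close> and
        \<open>c\<close> differ.\<close>
      have "lookup a (max k l) < lookup c (max k l) \<and> (\<forall>i>max k l. lookup a i = lookup c i)"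
        using k l by (cases k l rule: linorder_cases) (auto simp: max_def)
      then show ?thesis unfolding rlex_iff deg by blast
    qed
  qed
  show "totalp (rlex :: 'n monomial \<Rightarrow> 'n monomial \<Rightarrow> bool)"
  proof (rule totalpI)
    fix a b :: "'n monomial" assume "a \<noteq> b"
    let ?S = "{i. lookup a i \<noteq> lookup b i}"
    have "?S \<noteq> {}" using \<open>a \<noteq> b\<close> by (auto intro!: poly_mapping_eqI)
    then have "lookup a (Max ?S) \<noteq> lookup b (Max ?S)" using Max_in[of ?S] by simp
    moreover have "lookup a i = lookup b i" if "i > Max ?S" for i
      using that Max_ge[of ?S i] by (metis (mono_tags, lifting) finite leD mem_Collect_eq)
    ultimately obtain k where k: "lookup a k \<noteq> lookup b k" "\<forall>i>k. lookup a i = lookup b i" by blast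
    then have "lookup a k < lookup b k \<or> lookup b k < lookup a k" by linarith
    moreover have "\<forall>i>k. lookup b i = lookup a i" using k(2) by simp
    ultimately show "rlex a b \<or> rlex b a"
      unfolding rlex_iff using k(2) by (meson linorder_neqE_nat)
  qed
next
  fix i j :: 'n assume "i < j"
  then show "rlex (single i 1) (single j 1)"
    unfolding rlex_iff by (intro disjI2 conjI exI[of _ j]) (auto simp: lookup_single)
next
  fix a b :: "'n monomial" assume "mdeg b < mdeg a"
  then show "rlex a b" by (simp add: rlex_iff)
next
  fix a b c :: "'n monomial" assume "rlex a b"
  then show "rlex (a + c) (b + c)" by (simp add: rlex_iff mdeg_add lookup_add)
qed

section \<open>The ideal separating the two orders\<close>

text \<open>Comparing all these partial sums is the dominance order: replacing a variable by a
  larger one raises some of them and lowers none.\<close>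

definition psum :: "'n::{finite,linorder} \<Rightarrow> 'n monomial \<Rightarrow> nat" where
  "psum j m = (\<Sum>i\<in>{..j}. lookup m i)"

lemma psum_add: "psum j (a + b) = psum j a + psum j b"
  by (simp add: psum_def lookup_add sum.distrib)

lemma psum_single: "psum j (single i e) = (if i \<le> j then e else 0)"
proof -
  have "psum j (single i e) = (\<Sum>l\<in>{..j}. if l = i then e else 0)"
    unfolding psum_def by (rule sum.cong) (auto simp: lookup_single when_def)
  then show ?thesis by simp
qed

lemma psum_le_mdeg: "psum j m \<le> mdeg m"
  unfolding psum_def mdeg_sum by (rule sum_mono2) auto

lemma psum_mono: "i \<le> j \<Longrightarrow> psum i m \<le> psum j m"
  unfolding psum_def by (rule sum_mono2) auto

lemma psum_eq_0: "psum j m = 0 \<longleftrightarrow> (\<forall>i\<le>j. lookup m i = 0)"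
  by (auto simp: psum_def)

text \<open>The monomials that upper triangular coordinate changes produce from \<open>m\<close>.\<close>

definition borel_less :: "'n::{finite,linorder} monomial \<Rightarrow> 'n monomial \<Rightarrow> bool" where
  "borel_less m m' \<longleftrightarrow> mdeg m = mdeg m' \<and> (\<forall>j. psum j m \<le> psum j m') \<and> (\<exists>j. psum j m < psum j m')"

lemma compatible_borel_less: "compatible_rel (borel_less :: 'n::{finite,linorder} monomial \<Rightarrow> 'n monomial \<Rightarrow> bool)"
  unfolding compatible_rel_def
proof (intro conjI allI impI)
  show "irreflp (borel_less :: 'n monomial \<Rightarrow> 'n monomial \<Rightarrow> bool)"
    by (rule irreflpI) (simp add: borel_less_def)
  show "transp (borel_less :: 'n monomial \<Rightarrow> 'n monomial \<Rightarrow> bool)"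
  proof (rule transpI)
    fix x y z :: "'n monomial" assume xy: "borel_less x y" and yz: "borel_less y z"
    from xy obtain j where "psum j x < psum j y" unfolding borel_less_def by blast
    also have "psum j y \<le> psum j z" using yz by (simp add: borel_less_def)
    finally have "\<exists>j. psum j x < psum j z" by blast
    moreover have "psum j x \<le> psum j z" for j
      using xy yz unfolding borel_less_def by (meson order_trans)
    ultimately show "borel_less x z" using xy yz by (simp add: borel_less_def)
  qed
qed (simp add: borel_less_def psum_add mdeg_add)

text \<open>The order is read upside down here: \<open>m\<close> is the least term. Each x_j goes to
  itself plus larger variables x_i with i < j, and such exchanges move up in the dominance
  order.\<close>

lemma leads_upper_unitriangular:
  fixes X :: "'a::field^('n::{finite,linorder})^('n::{finite,linorder})"
  assumes "upper_unitriangular X"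
  shows "leads borel_less (gl_act X (single m 1)) m 1"
proof -
  have "leads borel_less (gl_act X (single (single j 1) 1)) (single j 1) (X $ j $ j)" for j
  proof (rule leads_gl_act_var)
    fix i assume "i \<noteq> j" "X $ i $ j \<noteq> 0"
    then have "i < j" using assms unfolding upper_unitriangular_def by (metis linorder_neqE)
    then show "borel_less (single j 1) (single i 1)"
      unfolding borel_less_def psum_single mdeg_single by (auto intro!: exI[of _ i])
  qed
  then have "leads borel_less (gl_act X (single m 1)) m (\<Prod>v\<in>UNIV. X $ v $ v ^ lookup m v)"
    by (rule leads_gl_act[OF compatible_borel_less])
  then show ?thesis using assms by (simp add: upper_unitriangular_def)
qed

text \<open>Each variable goes to a multiple of itself plus smaller variables, for every monomial
  order alike, so all other terms of the image lie below \<open>m\<close>.\<close>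

lemma leads_lower_triangular:
  fixes L :: "'a::field^('n::{finite,linorder})^('n::{finite,linorder})"
  assumes \<sigma>: "monomial_order \<sigma>" and L: "\<And>i j. i < j \<Longrightarrow> L $ i $ j = 0"
  shows "leads \<sigma> (gl_act L (single m 1)) m (\<Prod>v\<in>UNIV. L $ v $ v ^ lookup m v)"
proof (rule leads_gl_act[OF monomial_order_compatible[OF \<sigma>]], rule leads_gl_act_var)
  fix i j assume "i \<noteq> j" "L $ i $ j \<noteq> 0"
  then have "j < i" using L by (metis linorder_neqE)
  then show "\<sigma> (single j 1) (single i 1)" by (rule monomial_order_var[OF \<sigma>])
qed

text \<open>\<open>lo\<close> is x_1 and \<open>r\<close> comes right after \<open>q\<close>: with
  no variable in between, enlarging x_r in \<open>amon\<close> always lands in x_1, ...,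
  x_q.\<close>

locale order_gap =
  fixes lo q r :: "'n::{finite,linorder}" and d :: nat
  assumes lo_le: "\<And>i. lo \<le> i" and lo_q: "lo < q" and q_r: "q < r" and r_le: "\<And>i. q < i \<Longrightarrow> r \<le> i"
    and d2: "2 \<le> d"
begin

definition amon :: "'n monomial" where "amon = single lo (d - 1) + single r 1"
definition bmon :: "'n monomial" where "bmon = single q d"

text \<open>The monomials lying in the ideal; \<open>x\<^sub>q^(d+1)\<close> is among them because \<open>x\<^sub>q\<close> times the other
  term of the binomial is.\<close>

definition core :: "'n monomial set" where
  "core = {m. d \<le> psum q m \<and> ((\<exists>j<q. 1 \<le> psum j m) \<or> d + 1 \<le> psum q m)}"

text \<open>A multiplier from this set carries neither term of the binomial into
  \<open>core\<close>, any other multiplier carries both; so only these multiples are listed in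
  \<open>basis\<close>.\<close>

definition tails :: "'n monomial set" where
  "tails = {n. keys n \<subseteq> {q<..}}"

definition binomial :: "('n, 'k::field_char_0) mpoly" where
  "binomial = single amon 1 + single bmon 1"

definition basis :: "('n, 'k::field_char_0) mpoly set" where
  "basis = {single m 1 | m. m \<in> core} \<union> {single n 1 * binomial | n. n \<in> tails}"

text \<open>A linear span, so that \<open>leads_span\<close> applies; closure under multiplication
  is proved in \<open>is_ideal_gap_ideal\<close>.\<close>

definition gap_ideal :: "('n, 'k::field_char_0) mpoly set" where
  "gap_ideal = mpoly_vs.span basis"

text \<open>\<open>u\<close> stands for whichever term of the binomial leads.\<close>

definition initials :: "'n monomial \<Rightarrow> 'n monomial set" where
  "initials u = core \<union> {n + u | n. n \<in> tails}"

lemma tails_psum: "n \<in> tails \<Longrightarrow> j \<le> q \<Longrightarrow> psum j n = 0"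
  by (auto simp: tails_def psum_eq_0 in_keys_iff)

lemma tailsI: "psum q n = 0 \<Longrightarrow> n \<in> tails"
  unfolding tails_def psum_eq_0 using in_keys_iff[of _ n] by (metis (full_types) greaterThan_iff leI mem_Collect_eq subsetI)

lemma not_tails: "t \<notin> tails \<Longrightarrow> 1 \<le> psum q t"
  using tailsI[of t] by fastforce

lemma psum_amon: "psum j amon = (if r \<le> j then d else d - 1)"
  using d2 lo_le by (auto simp: amon_def psum_add psum_single)

lemma psum_bmon: "psum j bmon = (if q \<le> j then d else 0)"
  by (simp add: bmon_def psum_single)

lemma mdeg_amon: "mdeg amon = d" and mdeg_bmon: "mdeg bmon = d"
  using d2 by (simp_all add: amon_def bmon_def mdeg_add)

lemma psum_q_amon: "psum q amon = d - 1"
  using q_r by (simp add: psum_amon)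

lemma psum_lo_amon: "psum lo amon = d - 1"
  using q_r lo_q by (simp add: psum_amon)

lemma up_closed_core: "up_closed core"
  unfolding up_closed_def
proof (intro ballI allI)
  fix m t assume "m \<in> core"
  then show "m + t \<in> core" unfolding core_def mem_Collect_eq psum_add by (meson trans_le_add1)
qed

lemma core_plus: "m \<in> core \<Longrightarrow> t + m \<in> core"
  using up_closed_core unfolding up_closed_def by (metis add.commute)

lemma tail_bmon_notin_core: "n \<in> tails \<Longrightarrow> n + bmon \<notin> core"
  using tails_psum[of n] by (auto simp: core_def psum_add psum_bmon)

lemma tail_amon_notin_core: "n \<in> tails \<Longrightarrow> n + amon \<notin> core"
  using tails_psum[of n q] d2 by (auto simp: core_def psum_add psum_q_amon)

lemma nontail_bmon_core: "t \<notin> tails \<Longrightarrow> t + bmon \<in> core"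
  using not_tails[of t] by (auto simp: core_def psum_add psum_bmon)

lemma nontail_amon_core: "t \<notin> tails \<Longrightarrow> t + amon \<in> core"
  using not_tails[of t] d2 lo_q by (auto simp: core_def psum_add psum_q_amon psum_lo_amon intro!: exI[of _ lo])

lemma up_closed_initials:
  assumes "u = amon \<or> u = bmon"
  shows "up_closed (initials u)"
  unfolding up_closed_def
proof (intro ballI allI)
  fix m t assume "m \<in> initials u"
  then consider "m \<in> core" | n where "n \<in> tails" "m = n + u" by (auto simp: initials_def)
  then show "m + t \<in> initials u"
  proof cases
    case 1
    then show ?thesis using up_closed_core by (auto simp: initials_def up_closed_def)
  next
    case 2
    have eq: "m + t = (n + t) + u" by (simp add: 2 ac_simps)
    show ?thesis
    proof (cases "n + t \<in> tails")
      case True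
      then show ?thesis unfolding eq initials_def by blast
    next
      case False
      then show ?thesis unfolding eq initials_def using assms nontail_amon_core nontail_bmon_core by blast
    qed
  qed
qed

lemma basis_cases:
  assumes "x \<in> basis"
  obtains (core) m where "m \<in> core" "x = single m 1" | (tail) n where "n \<in> tails" "x = single n 1 * binomial"
  using assms unfolding basis_def by blast

lemma span_monomial:
  "m \<in> core \<Longrightarrow> (single m c :: ('n, 'k::field_char_0) mpoly) \<in> gap_ideal"
proof -
  assume "m \<in> core"
  then have "(single m 1 :: ('n, 'k) mpoly) \<in> basis" unfolding basis_def by blast
  then have "single 0 c * (single m 1 :: ('n, 'k) mpoly) \<in> gap_ideal"
    unfolding gap_ideal_def by (intro mpoly_vs.span_scale mpoly_vs.span_base)
  then show ?thesis by (simp add: mult_single)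
qed

lemma gap_ideal_add: "x \<in> gap_ideal \<Longrightarrow> y \<in> gap_ideal \<Longrightarrow> x + y \<in> gap_ideal"
  unfolding gap_ideal_def by (rule mpoly_vs.span_add)

lemma gap_ideal_zero: "0 \<in> gap_ideal"
  unfolding gap_ideal_def by (rule mpoly_vs.span_zero)

lemma gap_ideal_scale: "x \<in> gap_ideal \<Longrightarrow> single 0 c * x \<in> gap_ideal"
  unfolding gap_ideal_def by (rule mpoly_vs.span_scale)

lemma gap_ideal_induct [consumes 1, case_names zero add]:
  assumes "x \<in> gap_ideal" "P 0" "\<And>c b y. b \<in> basis \<Longrightarrow> P y \<Longrightarrow> P (single 0 c * b + y)"
  shows "P x"
  using assms(1) unfolding gap_ideal_def
  by (rule mpoly_vs.span_induct_alt) (use assms(2,3) in blast)+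

lemma single_basis_mem:
  fixes x :: "('n, 'k::field_char_0) mpoly"
  assumes "x \<in> basis"
  shows "single t c * x \<in> gap_ideal"
  using assms
proof (cases rule: basis_cases)
  case (core m)
  then show ?thesis using span_monomial[OF core_plus] by (simp add: mult_single)
next
  case (tail n)
  have eq: "single t c * x = single 0 c * (single (t + n) 1 * binomial)"
    unfolding tail(2) by (simp add: mult_single flip: mult.assoc)
  show ?thesis
  proof (cases "t + n \<in> tails")
    case True
    then show ?thesis
      unfolding eq gap_ideal_def by (intro mpoly_vs.span_scale mpoly_vs.span_base) (auto simp: basis_def)
  next
    case False
    have sum: "single (t + n) (1::'k) * binomial = single (t + n + amon) 1 + single (t + n + bmon) 1"
      by (simp add: binomial_def distrib_left mult_single)
    then show ?thesis
      unfolding eq sum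
      by (intro gap_ideal_scale gap_ideal_add span_monomial nontail_amon_core nontail_bmon_core False)
  qed
qed

lemma is_ideal_gap_ideal: "is_ideal (gap_ideal :: ('n, 'k::field_char_0) mpoly set)"
  unfolding is_ideal_iff
proof (intro conjI ballI allI)
  show "0 \<in> (gap_ideal :: ('n, 'k) mpoly set)" unfolding gap_ideal_def by (rule mpoly_vs.span_zero)
  fix s x :: "('n, 'k) mpoly" assume x: "x \<in> gap_ideal"
  show "s * x \<in> gap_ideal"
  proof (induction s rule: mpoly_induct)
    case zero
    show ?case by (simp add: gap_ideal_zero)
  next
    case (single t c)
    show ?case using x
    proof (induction rule: gap_ideal_induct)
      case zero
      show ?case by (simp add: gap_ideal_zero)
    next
      case (add e b y)
      have "single t c * (single 0 e * b + y) = single t (c * e) * b + single t c * y"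
        by (simp add: distrib_left mult_single flip: mult.assoc)
      then show ?case using add single_basis_mem gap_ideal_add by metis
    qed
  next
    case (add p p')
    then show ?case by (simp add: distrib_right gap_ideal_add)
  qed
qed (rule gap_ideal_add)

lemma homogeneous_gap_ideal: "homogeneous_ideal (gap_ideal :: ('n, 'k::field_char_0) mpoly set)"
  unfolding homogeneous_ideal_def
proof (intro conjI exI)
  show "is_ideal (gap_ideal :: ('n, 'k) mpoly set)" by (rule is_ideal_gap_ideal)
  show "\<forall>x\<in>(basis :: ('n, 'k) mpoly set). homogeneous x"
  proof
    fix x :: "('n, 'k) mpoly" assume "x \<in> basis"
    then show "homogeneous x"
    proof (cases rule: basis_cases)
      case (core m)
      then show ?thesis by (auto simp: homogeneous_def)
    next
      case (tail n)
      have "x = single (n + amon) 1 + single (n + bmon) 1"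
        by (simp add: tail(2) binomial_def distrib_left mult_single)
      then have "keys x \<subseteq> {n + amon, n + bmon}"
        using keys_plus_subset[of "single (n + amon) (1::'k)" "{n + amon, n + bmon}" "single (n + bmon) 1"] by simp
      then show ?thesis
        unfolding homogeneous_def by (intro exI[of _ "mdeg n + d"]) (auto simp: mdeg_add mdeg_amon mdeg_bmon)
    qed
  qed
  show "(gap_ideal :: ('n, 'k) mpoly set) = ideal_gen basis"
  proof
    have "x \<in> ideal_gen basis" if "x \<in> gap_ideal" for x :: "('n, 'k) mpoly"
      using that
    proof (induction rule: gap_ideal_induct)
      case zero
      show ?case using is_ideal_ideal_gen unfolding is_ideal_iff by blast
    next
      case (add c b y)
      have "b \<in> ideal_gen basis" using add(1) by (rule subsetD[OF ideal_gen_superset])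
      then have "single 0 c * b \<in> ideal_gen basis" by (rule is_ideal_mult[OF is_ideal_ideal_gen])
      then show ?case using add(2) is_ideal_ideal_gen[of basis] unfolding is_ideal_iff by blast
    qed
    then show "gap_ideal \<subseteq> (ideal_gen basis :: ('n, 'k) mpoly set)" by blast
    show "ideal_gen basis \<subseteq> (gap_ideal :: ('n, 'k) mpoly set)"
      by (rule ideal_gen_minimal[OF _ is_ideal_gap_ideal]) (simp add: gap_ideal_def mpoly_vs.span_superset)
  qed
qed

section \<open>Coordinate changes and the generic initial ideal\<close>

lemma core_borel: "m \<in> core \<Longrightarrow> borel_less m k \<Longrightarrow> k \<in> core"
  unfolding core_def borel_less_def mem_Collect_eq by (meson order_trans)

text \<open>Degrees agree, so a partial sum of \<open>k\<close> can exceed that of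
  \<open>amon\<close> only before \<open>r\<close>, hence at \<open>q\<close> or earlier; this lifts
  \<open>psum q k\<close> to \<open>d\<close>. The factor x_1 persists.\<close>

lemma amon_borel: "borel_less amon k \<Longrightarrow> k \<in> core"
proof -
  assume k: "borel_less amon k"
  then obtain j where j: "psum j amon < psum j k" unfolding borel_less_def by blast
  have deg: "mdeg k = d" using k by (simp add: borel_less_def mdeg_amon)
  have "\<not> r \<le> j" using j psum_le_mdeg[of j k] deg by (auto simp: psum_amon)
  then have "j \<le> q" using r_le[of j] by (meson leI)
  then have "d \<le> psum q k" using j psum_mono[of j q k] \<open>\<not> r \<le> j\<close> d2 by (simp add: psum_amon)
  moreover have "1 \<le> psum lo k"
  proof -
    have "psum lo amon \<le> psum lo k" using k unfolding borel_less_def by blast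
    then show ?thesis using d2 by (simp add: psum_lo_amon)
  qed
  ultimately show ?thesis using lo_q by (auto simp: core_def)
qed

text \<open>From \<open>q\<close> on, the partial sums of \<open>bmon\<close> already equal the
  degree, so the increase happens before \<open>q\<close> and brings in a larger variable.\<close>

lemma bmon_borel: "borel_less bmon k \<Longrightarrow> k \<in> core"
proof -
  assume k: "borel_less bmon k"
  then obtain j where j: "psum j bmon < psum j k" unfolding borel_less_def by blast
  have deg: "mdeg k = d" using k by (simp add: borel_less_def mdeg_bmon)
  have "\<not> q \<le> j" using j psum_le_mdeg[of j k] deg by (auto simp: psum_bmon)
  then have "j < q" "1 \<le> psum j k" using j by (auto simp: psum_bmon)
  moreover have "d \<le> psum q k" using k psum_bmon[of q] unfolding borel_less_def by (metis order_refl)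
  ultimately show ?thesis by (auto simp: core_def)
qed

lemma monomials_core_subset: "keys x \<subseteq> core \<Longrightarrow> (x :: ('n, 'k::field_char_0) mpoly) \<in> gap_ideal"
proof -
  assume "keys x \<subseteq> core"
  then have "(\<Sum>m\<in>keys x. single m (lookup x m)) \<in> gap_ideal"
    by (intro is_ideal_sum[OF is_ideal_gap_ideal] span_monomial) blast
  then show ?thesis by (simp add: mpoly_sum_single)
qed

text \<open>The unit diagonal matters: it keeps both terms of the binomial with coefficient 1, while
  all further terms it produces lie in \<open>core\<close>.\<close>

lemma gl_act_upper_gap_ideal:
  fixes X :: "'k::field_char_0^'n::_^'n::_"
  assumes X: "upper_unitriangular X" and x: "x \<in> gap_ideal"
  shows "gl_act X x \<in> gap_ideal"
  using x
proof (induction rule: gap_ideal_induct)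
  case zero
  show ?case by (simp add: gap_ideal_zero)
next
  case (add c b y)
  note lead = leads_upper_unitriangular[OF X]
  have "gl_act X b \<in> gap_ideal"
    using add(1)
  proof (cases rule: basis_cases)
    case (core m)
    then show ?thesis
      using leads_keys[OF lead, of _ m] core_borel[of m] by (intro monomials_core_subset) blast
  next
    case (tail n)
    obtain p where p: "gl_act X (single amon 1) = single amon 1 + p" "\<forall>k\<in>keys p. borel_less amon k"
      using lead[of amon] unfolding leads_def by blast
    obtain p' where p': "gl_act X (single bmon 1) = single bmon 1 + p'" "\<forall>k\<in>keys p'. borel_less bmon k"
      using lead[of bmon] unfolding leads_def by blast
    have "gl_act X binomial = binomial + (p + p')"
      by (simp add: binomial_def gl_act_add p(1) p'(1))
    moreover have "binomial \<in> (gap_ideal :: ('n, 'k) mpoly set)"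
    proof -
      have "(0 :: 'n monomial) \<in> tails" by (simp add: tails_def)
      then have "single 0 1 * binomial \<in> (basis :: ('n, 'k) mpoly set)" unfolding basis_def by blast
      then show ?thesis unfolding gap_ideal_def by (intro mpoly_vs.span_base) simp
    qed
    moreover have "p \<in> gap_ideal" "p' \<in> gap_ideal"
      using p(2) p'(2) amon_borel bmon_borel by (blast intro: monomials_core_subset)+
    ultimately have "gl_act X binomial \<in> gap_ideal" by (simp add: gap_ideal_add)
    then show ?thesis unfolding tail(2) gl_act_mult by (rule is_ideal_mult[OF is_ideal_gap_ideal])
  qed
  then show ?case using add(2) by (simp add: gl_act_add gl_act_mult gap_ideal_add gap_ideal_scale)
qed

lemma initial_ideal_big_cell:
  fixes g :: "'k::field_char_0^'n::_^'n::_"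
  assumes \<sigma>: "monomial_order \<sigma>" and uv: "\<sigma> u v" "{u, v} = {amon, bmon}" and g: "g \<in> big_cell"
  shows "initial_ideal \<sigma> (gl_act g ` gap_ideal) = monomials_ideal (initials u)"
proof -
  obtain L X V where LU: "g = L ** X" "\<And>i j. i < j \<Longrightarrow> L $ i $ j = 0" "\<And>j. L $ j $ j \<noteq> 0"
    "upper_unitriangular X" "upper_unitriangular V" "X ** V = mat 1"
    using big_cell_LU[OF g] by blast
  have XI: "gl_act X ` gap_ideal = (gap_ideal :: ('n, 'k) mpoly set)"
  proof
    show "gl_act X ` gap_ideal \<subseteq> gap_ideal" using gl_act_upper_gap_ideal[OF LU(4)] by blast
    show "gap_ideal \<subseteq> gl_act X ` gap_ideal"
    proof
      fix y :: "('n, 'k) mpoly" assume "y \<in> gap_ideal"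
      then have "gl_act V y \<in> gap_ideal" by (rule gl_act_upper_gap_ideal[OF LU(5)])
      moreover have "y = gl_act X (gl_act V y)"
        by (simp add: gl_act_mat_1 LU(6) flip: gl_act_matrix_mult)
      ultimately show "y \<in> gl_act X ` gap_ideal" by blast
    qed
  qed
  have gI: "gl_act g ` gap_ideal = gl_act L ` gap_ideal"
  proof -
    have "gl_act g ` gap_ideal = gl_act L ` (gl_act X ` gap_ideal)"
      unfolding LU(1) image_image by (simp add: gl_act_matrix_mult)
    then show ?thesis unfolding XI .
  qed
  note R = monomial_order_compatible[OF \<sigma>]
  define c where "c m = (\<Prod>w\<in>UNIV. L $ w $ w ^ lookup m w)" for m
  have c: "c m \<noteq> 0" for m using LU(3) by (simp add: c_def)
  have lead: "leads \<sigma> (gl_act L (single m 1)) m (c m)" for m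
    unfolding c_def by (rule leads_lower_triangular[OF \<sigma> LU(2)])
  have lead_tail: "leads \<sigma> (gl_act L (single n 1 * binomial)) (n + u) (c (n + u))" for n
  proof -
    have "binomial = single u 1 + (single v 1 :: ('n, 'k) mpoly)"
      using uv(2) unfolding binomial_def doubleton_eq_iff by (auto simp: add.commute)
    then have eq: "gl_act L (single n 1 * binomial) = gl_act L (single (n + u) 1) + gl_act L (single (n + v) 1)"
      by (simp add: distrib_left mult_single gl_act_add)
    have "\<sigma> (n + u) k" if "k \<in> keys (gl_act L (single (n + v) 1))" for k
    proof -
      have "k = n + v \<or> \<sigma> (n + v) k" by (rule leads_keys[OF lead that])
      moreover have "\<sigma> (n + u) (n + v)" by (rule monomial_order_add'[OF \<sigma> uv(1)])
      ultimately show ?thesis using monomial_order_trans[OF \<sigma>] by blast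
    qed
    then show ?thesis unfolding eq by (rule leads_add[OF lead])
  qed
  \<comment> \<open>Keeps the leading monomials of the tail multiples of the binomial apart from
    those in \<open>core\<close>; injectivity of \<open>l\<close> rests on it.\<close>
  have u_notin: "n + u \<notin> core" if "n \<in> tails" for n
    using uv(2) tail_amon_notin_core[OF that] tail_bmon_notin_core[OF that] by (auto simp: doubleton_eq_iff)
  define l where "l x = lead_monomial \<sigma> (gl_act L x)" for x
  have l_core: "l (single m 1) = m" for m
    unfolding l_def by (rule lead_monomial_eq[OF R lead c])
  have l_tail: "l (single n 1 * binomial) = n + u" for n
    unfolding l_def by (rule lead_monomial_eq[OF R lead_tail c])
  have lead_basis: "leads \<sigma> (gl_act L x) (l x) (c (l x))" if "x \<in> basis" for x
    using that
  proof (cases rule: basis_cases)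
    case (core m)
    then show ?thesis using lead[of m] l_core[of m] by simp
  next
    case (tail n)
    then show ?thesis using lead_tail[of n] l_tail[of n] by simp
  qed
  have inj: "inj_on l basis"
  proof (rule inj_onI)
    fix x y assume x: "x \<in> basis" and y: "y \<in> basis" and eq: "l x = l y"
    from x show "x = y"
    proof (cases rule: basis_cases)
      case x: (core m)
      from y show ?thesis
      proof (cases rule: basis_cases)
        case (core m')
        then show ?thesis using x eq by (simp only: l_core)
      next
        case (tail n)
        then have "n + u = m" using x(2) eq by (simp only: l_core l_tail)
        then show ?thesis using u_notin[OF tail(1)] x(1) by simp
      qed
    next
      case x: (tail n)
      from y show ?thesis
      proof (cases rule: basis_cases)
        case (core m')
        then have "n + u = m'" using x(2) eq by (simp only: l_core l_tail)
        then show ?thesis using u_notin[OF x(1)] core(1) by simp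
      next
        case (tail n')
        then have "n + u = n' + u" using x eq by (simp only: l_tail)
        then show ?thesis using x(2) tail(2) by simp
      qed
    qed
  qed
  have l_basis: "l ` basis = initials u"
    unfolding basis_def initials_def image_Un by (auto simp: l_core l_tail image_iff) (metis l_core l_tail)+
  have "{lead_monomial \<sigma> h |h. h \<in> gl_act L ` gap_ideal \<and> h \<noteq> 0} = initials u"
  proof (intro equalityI subsetI)
    fix m assume "m \<in> {lead_monomial \<sigma> h |h. h \<in> gl_act L ` gap_ideal \<and> h \<noteq> 0}"
    then obtain x where x: "x \<in> gap_ideal" "gl_act L x \<noteq> 0" "m = lead_monomial \<sigma> (gl_act L x)" by blast
    have "\<exists>b\<in>basis. \<exists>e. e \<noteq> 0 \<and> leads \<sigma> (gl_act L x) (l b) e"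
      by (rule leads_span[OF \<sigma> gl_act_add gl_act_scale lead_basis c inj])
        (use x in \<open>simp_all add: gap_ideal_def\<close>)
    then obtain b e where "b \<in> basis" "e \<noteq> 0" "leads \<sigma> (gl_act L x) (l b) e" by blast
    then have "m = l b" unfolding x(3) by (intro lead_monomial_eq[OF R])
    then show "m \<in> initials u" using \<open>b \<in> basis\<close> l_basis by blast
  next
    fix m assume "m \<in> initials u"
    then obtain b where b: "b \<in> basis" "m = l b" unfolding l_basis[symmetric] by blast
    have "lookup (gl_act L b) (l b) \<noteq> 0" using leads_lookup[OF R lead_basis[OF b(1)]] c by simp
    then have "gl_act L b \<noteq> 0" by auto
    moreover have "b \<in> gap_ideal" unfolding gap_ideal_def using b(1) by (rule mpoly_vs.span_base)
    ultimately show "m \<in> {lead_monomial \<sigma> h |h. h \<in> gl_act L ` gap_ideal \<and> h \<noteq> 0}"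
      unfolding b(2) l_def by blast
  qed
  moreover have "{single (lead_monomial \<sigma> h) (1::'k) |h. h \<in> gl_act L ` gap_ideal \<and> h \<noteq> 0} =
      {single m 1 |m. m \<in> {lead_monomial \<sigma> h |h. h \<in> gl_act L ` gap_ideal \<and> h \<noteq> 0}}"
    by blast
  ultimately have "{single (lead_monomial \<sigma> h) (1::'k) |h. h \<in> gl_act L ` gap_ideal \<and> h \<noteq> 0} = {single m 1 |m. m \<in> initials u}"
    by (simp only:)
  then show ?thesis
    unfolding initial_ideal_def gI using monomials_ideal_eq[OF up_closed_initials, of u] uv(2)
    by (auto simp: doubleton_eq_iff)
qed

text \<open>The big cell is an open set of the required kind, and any competing one meets it, which
  settles uniqueness in the definite description.\<close>

lemma gin_gap_ideal:
  assumes \<sigma>: "monomial_order \<sigma>" and uv: "\<sigma> u v" "{u, v} = {amon, bmon}"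
  shows "gin \<sigma> (gap_ideal :: ('n, 'k::field_char_0) mpoly set) = monomials_ideal (initials u)"
  unfolding gin_def
proof (rule the_equality)
  show "\<exists>U::('k^'n::_^'n::_) set. zariski_open_GL U \<and> U \<noteq> {} \<and>
      (\<forall>g\<in>U. initial_ideal \<sigma> (gl_act g ` gap_ideal) = (monomials_ideal (initials u) :: ('n, 'k) mpoly set))"
    using zariski_open_big_cell big_cell_nonempty initial_ideal_big_cell[OF \<sigma> uv] by blast
next
  fix J :: "('n, 'k) mpoly set"
  assume "\<exists>U::('k^'n::_^'n::_) set. zariski_open_GL U \<and> U \<noteq> {} \<and> (\<forall>g\<in>U. initial_ideal \<sigma> (gl_act g ` gap_ideal) = J)"
  then obtain U :: "('k^'n::_^'n::_) set" where U: "zariski_open_GL U" "U \<noteq> {}"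
    "\<forall>g\<in>U. initial_ideal \<sigma> (gl_act g ` gap_ideal) = J" by blast
  then obtain g where "g \<in> U" "g \<in> big_cell"
    using zariski_open_GL_inter[OF U(1,2) zariski_open_big_cell big_cell_nonempty] by blast
  then show "J = monomials_ideal (initials u)" using U(3) initial_ideal_big_cell[OF \<sigma> uv] by metis
qed

end

section \<open>Regularity of the two initial ideals\<close>

lemma resolvable_minimal_resolution:
  fixes I :: "('v, 'a::comm_ring_1) mpoly set"
  assumes "resolvable (\<le>) l t [0] (vec1 ` I)"
  shows "\<exists>a D. minimal_graded_free_resolution I a D \<and> (\<forall>i. \<forall>x\<in>set (a i). x \<le> t + i)"
proof -
  from resolvable_resolution[OF assms] obtain a D where aD: "\<forall>i\<ge>l. a i = []" "graded_hom (a 0) [0] (D 0)"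
    "\<forall>i. graded_hom (a (Suc i)) (a i) (D (Suc i))" "hom_image (D 0) = vec1 ` I"
    "\<forall>i. hom_image (D (Suc i)) = hom_kernel (D i)"
    "\<forall>i. \<forall>j<length (a i). \<forall>k<length (a (Suc i)). lookup (D (Suc i) $$ (j, k)) 0 = 0"
    "\<forall>i. \<forall>x\<in>set (a i). x \<le> t + i" by blast
  have "(\<lambda>v. vec_index v 0) ` hom_image (D 0) = I"
    unfolding aD(4) image_image by simp
  moreover have "\<exists>l. \<forall>i>l. a i = []" using aD(1) by (meson less_imp_le)
  ultimately have "minimal_graded_free_resolution I a D"
    unfolding minimal_graded_free_resolution_def using aD by blast
  with aD(7) show ?thesis by blast
qed

lemma regularity_le:
  fixes I :: "('v, 'a::comm_ring_1) mpoly set"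
  assumes "resolvable (\<le>) l t [0] (vec1 ` I)"
  shows "regularity I \<le> t"
  unfolding regularity_def by (rule Least_le) (rule resolvable_minimal_resolution[OF assms])

text \<open>The hypothesis supplies a resolution, so the minimum is over a nonempty set of
  bounds.\<close>

lemma regularity_attained:
  fixes I :: "('v, 'a::comm_ring_1) mpoly set"
  assumes "resolvable (\<le>) l t [0] (vec1 ` I)"
  shows "\<exists>a D. minimal_graded_free_resolution I a D \<and> (\<forall>i. \<forall>x\<in>set (a i). x \<le> regularity I + i)"
  unfolding regularity_def by (rule LeastI_ex) (use resolvable_minimal_resolution[OF assms] in blast)

text \<open>The entries of the augmentation generate \<open>I\<close> and are homogeneous of the
  degrees in \<open>a 0\<close>; a monomial of \<open>p\<close> must occur in a multiple of one of
  them. This detects generators of high degree.\<close>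

lemma resolution_generator:
  fixes I :: "('v, 'a::comm_ring_1) mpoly set"
  assumes res: "minimal_graded_free_resolution I a D" and le: "\<forall>x\<in>set (a 0). x \<le> t"
    and p: "p \<in> I" "w \<in> keys p"
  shows "\<exists>f\<in>I. \<exists>m\<in>keys f. \<exists>m'. mdeg m \<le> t \<and> w = m + m'"
proof -
  have D: "D 0 \<in> carrier_mat 1 (length (a 0))"
    "\<And>k m. k < length (a 0) \<Longrightarrow> m \<in> keys (D 0 $$ (0, k)) \<Longrightarrow> mdeg m = a 0 ! k"
    and I: "(\<lambda>v. vec_index v 0) ` hom_image (D 0) = I"
    using res by (auto simp: minimal_graded_free_resolution_def graded_hom_def)
  obtain v where v: "v \<in> carrier_vec (length (a 0))" "p = vec_index (D 0 *\<^sub>v v) 0"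
    using p(1) D(1) unfolding I[symmetric] hom_image_def by auto
  have "p = (\<Sum>k = 0..<length (a 0). D 0 $$ (0, k) * vec_index v k)"
    using v D(1) by (simp add: scalar_prod_def)
  then have "w \<in> (\<Union>k\<in>{0..<length (a 0)}. keys (D 0 $$ (0, k) * vec_index v k))"
    using p(2) keys_sum[of "\<lambda>k. D 0 $$ (0, k) * vec_index v k" "{0..<length (a 0)}"] by auto
  then obtain k where k: "k < length (a 0)" "w \<in> keys (D 0 $$ (0, k) * vec_index v k)" by auto
  then obtain m m' where m: "m \<in> keys (D 0 $$ (0, k))" "w = m + m'"
    using keys_mult[of "D 0 $$ (0, k)" "vec_index v k"] by blast
  have "D 0 *\<^sub>v unit_vec (length (a 0)) k \<in> hom_image (D 0)"
    unfolding hom_image_def using D(1) by auto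
  moreover have "vec_index (D 0 *\<^sub>v unit_vec (length (a 0)) k) 0 = D 0 $$ (0, k)"
    using D(1) k(1) by simp
  ultimately have "D 0 $$ (0, k) \<in> I" unfolding I[symmetric] by force
  moreover have "mdeg m \<le> t" using D(2)[OF k(1) m(1)] le k(1) by simp
  ultimately show ?thesis using m by blast
qed

section \<open>Monomial generators of the two initial ideals\<close>

lemma finite_monomials_of_degree: "finite {m :: 'v::finite monomial. mdeg m = d}"
proof (rule finite_imageD)
  have "lookup ` {m :: 'v monomial. mdeg m = d} \<subseteq> {f. \<forall>x. (x \<in> UNIV \<longrightarrow> f x \<in> {..d}) \<and> (x \<notin> UNIV \<longrightarrow> f x = 0)}"
  proof
    fix f assume "f \<in> lookup ` {m :: 'v monomial. mdeg m = d}"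
    then obtain m :: "'v monomial" where m: "f = lookup m" "mdeg m = d" by blast
    have "lookup m x \<le> mdeg m" for x unfolding mdeg_sum by (rule member_le_sum) auto
    then show "f \<in> {f. \<forall>x. (x \<in> UNIV \<longrightarrow> f x \<in> {..d}) \<and> (x \<notin> UNIV \<longrightarrow> f x = 0)}"
      by (simp add: m)
  qed
  then show "finite (lookup ` {m :: 'v monomial. mdeg m = d})"
    by (rule finite_subset[OF _ finite_set_of_finite_funs[OF finite finite_atMost]])
  show "inj_on lookup {m :: 'v monomial. mdeg m = d}"
    by (rule inj_onI) (simp only: poly_mapping_eq_iff)
qed

lemma psum_eq_mdeg: "keys m \<subseteq> {..j} \<Longrightarrow> psum j m = mdeg m"
  unfolding psum_def mdeg_def by (rule sum.mono_neutral_right) (auto simp: in_keys_iff)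

lemma psum_eq_lookup: "(\<And>j. j < q \<Longrightarrow> psum j m = 0) \<Longrightarrow> psum q m = lookup m q"
proof -
  assume *: "\<And>j. j < q \<Longrightarrow> psum j m = 0"
  have "psum q m = (\<Sum>i\<in>{q}. lookup m i)"
    unfolding psum_def
  proof (rule sum.mono_neutral_right)
    show "\<forall>i\<in>{..q} - {q}. lookup m i = 0"
    proof
      fix i assume "i \<in> {..q} - {q}"
      then have "psum i m = 0" using * by auto
      then show "lookup m i = 0" by (simp add: psum_eq_0)
    qed
  qed auto
  then show ?thesis by simp
qed

lemma minus_single_power_plus: "e \<le> lookup m i \<Longrightarrow> m - single i e + single i e = (m :: 'v monomial)"
  by (rule poly_mapping_eqI) (auto simp: lookup_add lookup_minus lookup_single when_def)

lemma psum_pos: "0 < psum j m \<Longrightarrow> \<exists>i\<le>j. 0 < lookup m i"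
  using psum_eq_0[of j m] by auto

text \<open>While \<open>mdeg w\<close> is below \<open>d\<close>, the bound on
  \<open>psum q\<close> leaves in \<open>t\<close> a variable no later than x_q, which is moved to
  \<open>w\<close>.\<close>

lemma extend_divisor:
  assumes "d \<le> psum q (w + t)" "keys w \<subseteq> {..q}" "mdeg w \<le> d"
  shows "\<exists>w' t'. w + t = (w + w') + t' \<and> keys (w + w') \<subseteq> {..q} \<and> mdeg (w + w') = d"
  using assms
proof (induction "d - mdeg w" arbitrary: w t)
  case 0
  then show ?case by (intro exI[of _ 0] exI[of _ t]) simp
next
  case (Suc e)
  have "0 < psum q t" using Suc.prems Suc.hyps(2) psum_eq_mdeg[of w q] by (simp add: psum_add)
  then obtain i where i: "i \<le> q" "0 < lookup t i" using psum_pos by blast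
  define t1 where "t1 = t - single i 1"
  have t: "t = single i 1 + t1" using minus_single_plus[OF i(2)] by (simp add: t1_def add.commute)
  let ?w = "w + single i 1"
  have deg: "mdeg ?w = Suc (mdeg w)" by (simp add: mdeg_add)
  have "keys ?w \<subseteq> {..q}"
    using keys_plus_subset[OF Suc.prems(2), of "single i 1"] i(1) by simp
  moreover have "w + t = ?w + t1" by (simp add: t ac_simps)
  ultimately have "\<exists>w' t'. ?w + t1 = (?w + w') + t' \<and> keys (?w + w') \<subseteq> {..q} \<and> mdeg (?w + w') = d"
    using Suc.hyps(1)[of ?w t1] Suc.hyps(2) Suc.prems(1) deg by simp
  then obtain w' t' where w': "?w + t1 = (?w + w') + t'" "keys (?w + w') \<subseteq> {..q}" "mdeg (?w + w') = d" by blast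
  have "?w + w' = w + (single i 1 + w')" by (simp add: ac_simps)
  with w' \<open>w + t = ?w + t1\<close> show ?case by (intro exI[of _ "single i 1 + w'"] exI[of _ t']) simp
qed

context order_gap
begin

definition gens :: "'n monomial set" where
  "gens = {m. keys m \<subseteq> {..q} \<and> mdeg m = d}"

text \<open>The generators of degree \<open>d\<close> of the initial ideal when \<open>amon\<close>
  leads.\<close>

definition gens' :: "'n monomial set" where
  "gens' = (gens - {bmon}) \<union> {amon}"

lemma gens_psum: "g \<in> gens \<Longrightarrow> psum q g = d"
  by (simp add: gens_def psum_eq_mdeg)

lemma finite_gens: "finite gens" "finite gens'"
proof -
  show "finite gens" unfolding gens_def by (rule finite_subset[OF _ finite_monomials_of_degree[of d]]) auto
  then show "finite gens'" by (simp add: gens'_def)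
qed

lemma gens_mdeg: "g \<in> gens \<Longrightarrow> mdeg g = d" "g \<in> gens' \<Longrightarrow> mdeg g = d"
  by (auto simp: gens'_def gens_def mdeg_amon)

lemma keys_plus_single: "keys (w + single j 1) = insert j (keys w)" for w :: "'n monomial"
  by (auto simp: in_keys_iff lookup_add lookup_single when_def split: if_splits)

lemma strongly_stable_gens: "strongly_stable gens"
  unfolding strongly_stable_def gens_def mem_Collect_eq keys_plus_single by (auto simp: mdeg_add)

text \<open>A move ending in \<open>bmon\<close> would have to replace a variable after x_q, so it
  cannot start in \<open>gens\<close>. From \<open>amon\<close> only x_r can be replaced, and the
  remaining factor x_1 keeps the result different from \<open>bmon\<close>.\<close>

lemma strongly_stable_gens': "strongly_stable gens'"
  unfolding strongly_stable_def
proof (intro allI impI)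
  fix w i j assume w: "w + single j 1 \<in> gens'" and ij: "i < (j :: 'n)"
  show "w + single i 1 \<in> gens'"
  proof (cases "w + single j 1 = amon")
    case True
    have "j \<in> keys amon" unfolding True[symmetric] keys_plus_single by simp
    moreover have "keys amon \<subseteq> {lo, r}"
      unfolding amon_def by (rule keys_plus_subset) auto
    moreover have "j \<noteq> lo" using ij lo_le[of i] by auto
    ultimately have j: "j = r" by blast
    have wl: "w = single lo (d - 1)"
      using True unfolding amon_def j by simp
    have "i \<le> q" using ij r_le[of i] unfolding j by (meson leD leI)
    then have "w + single i 1 \<in> gens"
      using lo_q d2 unfolding gens_def mem_Collect_eq wl keys_plus_single by (simp add: mdeg_add)
    moreover have "lookup (w + single i 1) lo \<noteq> lookup bmon lo"
      using lo_q d2 by (simp add: wl bmon_def lookup_add lookup_single)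
    ultimately show ?thesis unfolding gens'_def by auto
  next
    case False
    then have g: "w + single j 1 \<in> gens" using w by (simp add: gens'_def)
    then have "w + single i 1 \<in> gens" using strongly_stable_gens ij unfolding strongly_stable_def by blast
    moreover have "w + single i 1 \<noteq> bmon"
    proof
      assume eq: "w + single i 1 = bmon"
      have "i \<in> keys bmon" unfolding eq[symmetric] keys_plus_single by simp
      then have "i = q" by (simp add: bmon_def split: if_splits)
      moreover have "j \<le> q" using g unfolding gens_def mem_Collect_eq keys_plus_single by simp
      ultimately show False using ij by simp
    qed
    ultimately show ?thesis by (simp add: gens'_def)
  qed
qed

text \<open>Without variables before x_q, the partial sum at \<open>q\<close> is the exponent of
  x_q; the equation expresses divisibility by truncated subtraction.\<close>

lemma power_dvd: "(\<And>j. j < q \<Longrightarrow> psum j m = 0) \<Longrightarrow> e \<le> psum q m \<Longrightarrow> m - single q e + single q e = m"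
  using psum_eq_lookup[of q m] by (intro minus_single_power_plus) simp

lemma multiples_of_gens: "multiples_of gens = initials bmon"
proof (intro equalityI subsetI)
  fix m assume "m \<in> initials bmon"
  then have "d \<le> psum q (0 + m)" by (auto simp: initials_def core_def psum_add psum_bmon)
  from extend_divisor[OF this] obtain w t where "0 + m = (0 + w) + t" "keys (0 + w) \<subseteq> {..q}" "mdeg (0 + w) = d"
    by auto
  then show "m \<in> multiples_of gens"
    unfolding multiples_of_def gens_def by (intro CollectI exI[of _ t] exI[of _ w]) (simp add: add.commute)
next
  fix m assume "m \<in> multiples_of gens"
  then obtain t g where g: "g \<in> gens" "m = t + g" by (auto simp: multiples_of_def)
  have le: "d \<le> psum q m" using gens_psum[OF g(1)] by (simp add: g(2) psum_add)
  show "m \<in> initials bmon"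
  proof (cases "m \<in> core")
    case True
    then show ?thesis by (simp add: initials_def)
  next
    case False
    with le have *: "\<And>j. j < q \<Longrightarrow> psum j m = 0" "psum q m = d"
      by (auto simp: core_def not_less_eq_eq)
    let ?n = "m - single q d"
    have eq: "?n + bmon = m" using power_dvd[OF *(1), of d] le by (simp add: bmon_def)
    have "psum q (?n + bmon) = d" unfolding eq by (rule *(2))
    then have "?n \<in> tails" by (intro tailsI) (simp add: psum_add psum_bmon)
    then show ?thesis unfolding initials_def using eq[symmetric] by blast
  qed
qed

lemma gens'_core:
  assumes "g \<in> gens" "g \<noteq> bmon"
  obtains j where "j < q" "1 \<le> psum j g"
proof -
  have "\<exists>j<q. 1 \<le> psum j g"
  proof (rule ccontr)
    assume "\<not> (\<exists>j<q. 1 \<le> psum j g)"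
    then have z: "\<And>j. j < q \<Longrightarrow> psum j g = 0" by (auto simp: not_less_eq_eq)
    have eq: "g - single q d + single q d = g" using power_dvd[OF z, of d] gens_psum[OF assms(1)] by simp
    have "mdeg (g - single q d) + d = d"
      using arg_cong[OF eq, of mdeg] gens_mdeg(1)[OF assms(1)] by (simp add: mdeg_add)
    then have "g - single q d = 0" by (simp add: mdeg_eq_0)
    then show False using eq assms(2) by (simp add: bmon_def)
  qed
  then show ?thesis using that by blast
qed

text \<open>Splits the ideal into a strongly stable part generated in degree \<open>d\<close> and
  one generator of degree d + 1, the shape that \<open>resolvable_add_monomial\<close>
  needs.\<close>

lemma multiples_of_gens': "multiples_of gens' \<union> {m + single q (d + 1) | m. True} = initials amon"
proof (intro equalityI subsetI)
  fix m assume "m \<in> initials amon"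
  then consider n where "n \<in> tails" "m = n + amon" | "m \<in> core" by (auto simp: initials_def)
  then show "m \<in> multiples_of gens' \<union> {m + single q (d + 1) | m. True}"
  proof cases
    case 1
    then show ?thesis unfolding multiples_of_def gens'_def by blast
  next
    case 2
    then have le: "d \<le> psum q m" by (simp add: core_def)
    show ?thesis
    proof (cases "\<exists>j<q. 1 \<le> psum j m")
      case True
      then obtain j where "j < q" "0 < psum j m" by auto
      then obtain i where i: "i < q" "0 < lookup m i" using psum_pos[of j m] by (meson le_less_trans)
      have m: "single i 1 + (m - single i 1) = m" using minus_single_plus[OF i(2)] by (simp add: add.commute)
      \<comment> \<open>Growing the divisor from x_i with i < q keeps it different from
        \<open>bmon\<close>.\<close>
      have "\<exists>w t. single i 1 + (m - single i 1) = (single i 1 + w) + t \<and> keys (single i 1 + w) \<subseteq> {..q} \<and> mdeg (single i 1 + w) = d"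
        by (rule extend_divisor) (use le d2 i(1) in \<open>simp_all only: m, simp_all\<close>)
      then obtain w t where w: "m = (single i 1 + w) + t" "single i 1 + w \<in> gens"
        unfolding m gens_def by blast
      have "lookup (single i 1 + w) i \<noteq> lookup bmon i"
        using i(1) by (simp add: bmon_def lookup_add lookup_single)
      then have "single i 1 + w \<in> gens'" using w(2) unfolding gens'_def by auto
      then have "t + (single i 1 + w) \<in> multiples_of gens'"
        unfolding multiples_of_def by (intro CollectI exI[of _ t] exI[of _ "single i 1 + w"]) simp
      then have "m \<in> multiples_of gens'" unfolding w(1) by (simp only: add.commute)
      then show ?thesis by simp
    next
      case False
      then have z: "\<And>j. j < q \<Longrightarrow> psum j m = 0" by (auto simp: not_less_eq_eq)
      have "d + 1 \<le> psum q m" using 2 False unfolding core_def by blast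
      then have "m - single q (d + 1) + single q (d + 1) = m" by (rule power_dvd[rotated]) (rule z)
      then show ?thesis by (intro UnI2 CollectI exI[of _ "m - single q (d + 1)"]) simp
    qed
  qed
next
  fix m assume "m \<in> multiples_of gens' \<union> {m + single q (d + 1) | m. True}"
  then consider t g where "m = t + g" "g \<in> gens" "g \<noteq> bmon" | t where "m = t + amon" | t where "m = t + single q (d + 1)"
    by (auto simp: multiples_of_def gens'_def)
  then show "m \<in> initials amon"
  proof cases
    case 1
    then obtain j where "j < q" "1 \<le> psum j g" using gens'_core by blast
    then have "g \<in> core" using gens_psum[OF 1(2)] by (auto simp: core_def)
    then show ?thesis using core_plus 1(1) by (simp add: initials_def)
  next
    case 2
    then show ?thesis using nontail_amon_core unfolding initials_def by blast
  next
    case 3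
    have "single q (d + 1) \<in> core" by (simp add: core_def psum_single)
    then show ?thesis using core_plus 3 by (simp add: initials_def)
  qed
qed

text \<open>For i < q, x_i x_q^(d+1) is a multiple of x_i x_q^(d-1). Conversely every element of
  \<open>gens'\<close> involves a variable before x_q, which the power of x_q cannot supply.\<close>

lemma gens'_colon: "{m. m + single q (d + 1) \<in> multiples_of gens'} = divisible_by_var {..<q}"
proof (intro equalityI subsetI)
  fix m assume "m \<in> divisible_by_var {..<q}"
  then obtain i where i: "i < q" "0 < lookup m i" by (auto simp: divisible_by_var_def)
  let ?g = "single i 1 + single q (d - 1)"
  have "keys ?g \<subseteq> {..q}" by (rule keys_plus_subset) (use i(1) in auto)
  then have "?g \<in> gens" using d2 by (simp add: gens_def mdeg_add)
  moreover have "lookup ?g i \<noteq> lookup bmon i" using i(1) by (simp add: bmon_def lookup_add lookup_single)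
  ultimately have "?g \<in> gens'" unfolding gens'_def by auto
  moreover have "m + single q (d + 1) = (m - single i 1 + single q 2) + ?g"
  proof -
    have "single q (d + 1) = single q (2::nat) + single q (d - 1)"
      using d2 by (simp flip: single_add)
    moreover have "m = m - single i 1 + single i 1" using minus_single_plus[OF i(2)] by simp
    ultimately have "m + single q (d + 1) = (m - single i 1 + single i 1) + (single q 2 + single q (d - 1))" by simp
    then show ?thesis by (simp only: ac_simps)
  qed
  ultimately show "m \<in> {m. m + single q (d + 1) \<in> multiples_of gens'}"
    unfolding multiples_of_def by blast
next
  fix m assume "m \<in> {m. m + single q (d + 1) \<in> multiples_of gens'}"
  then obtain t g where tg: "g \<in> gens'" "m + single q (d + 1) = t + g" by (auto simp: multiples_of_def)
  have "\<exists>i<q. 0 < lookup g i"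
  proof (cases "g = amon")
    case True
    have "0 < lookup amon lo" using d2 by (simp add: amon_def lookup_add lookup_single)
    then show ?thesis using lo_q True by blast
  next
    case False
    then obtain j where "j < q" "1 \<le> psum j g" using tg(1) gens'_core unfolding gens'_def by blast
    then show ?thesis using psum_pos[of j g] by (metis One_nat_def Suc_le_eq le_less_trans)
  qed
  then obtain i where i: "i < q" "0 < lookup g i" by blast
  have "lookup (m + single q (d + 1)) i = lookup (t + g) i" by (simp only: tg(2))
  then have "lookup m i = lookup t i + lookup g i" using i(1) by (simp add: lookup_add lookup_single)
  then show "m \<in> divisible_by_var {..<q}"
    unfolding divisible_by_var_def using i by (intro CollectI bexI[of _ i]) simp_all
qed

lemma resolvable_rlex_side:
  "\<exists>l. resolvable (\<le>) l d [0] (vec1 ` (monomials_ideal (initials bmon) :: ('n, 'k::field_char_0) mpoly set))"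
  unfolding multiples_of_gens[symmetric]
  \<comment> \<open>\<open>rlex\<close> serves here, and on the other side as well, as the order in
    which the generators are added.\<close>
  by (rule resolvable_strongly_stable[OF monomial_order_rlex finite_gens(1) strongly_stable_gens gens_mdeg(1)])
    (use d2 in auto)

lemma resolvable_other_side:
  "\<exists>l. resolvable (\<le>) l (d + 1) [0] (vec1 ` (monomials_ideal (initials amon) :: ('n, 'k::field_char_0) mpoly set))"
proof -
  have "\<exists>l. resolvable (\<le>) l d [0] (vec1 ` (monomials_ideal (multiples_of gens') :: ('n, 'k) mpoly set))"
    by (rule resolvable_strongly_stable[OF monomial_order_rlex finite_gens(2) strongly_stable_gens' gens_mdeg(2)])
      (use d2 in auto)
  \<comment> \<open>The bound is raised to d + 1, the degree of the generator about to be
    added.\<close>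
  then obtain l where l: "resolvable (\<le>) l (d + 1) [0] (vec1 ` (monomials_ideal (multiples_of gens') :: ('n, 'k) mpoly set))"
    using resolvable_le_mono[of _ d _ _ "d + 1"] by auto
  obtain l' where l': "resolvable (=) l' (Suc (d + 1)) [d + 1]
      (vec1 ` (monomials_ideal {m. m + single q (d + 1) \<in> multiples_of gens'} :: ('n, 'k) mpoly set))"
    unfolding gens'_colon using resolvable_variables by blast
  show ?thesis
    unfolding multiples_of_gens'[symmetric]
    by (rule resolvable_add_monomial[OF _ _ up_closed_multiples_of l _ _ l']) auto
qed

text \<open>A resolution with bound \<open>d\<close> would make x_q^(d+1) a multiple of a monomial
  \<open>m\<close> of degree at most \<open>d\<close> in the ideal. This \<open>m\<close> is a power
  of x_q: its degree is too small for \<open>core\<close>, and x_1 does not divide it, so it is no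
  multiple of \<open>amon\<close>.\<close>

lemma regularity_initials:
  "regularity (monomials_ideal (initials bmon) :: ('n, 'k::field_char_0) mpoly set) <
   regularity (monomials_ideal (initials amon) :: ('n, 'k) mpoly set)"
proof (rule ccontr)
  let ?I = "monomials_ideal (initials amon) :: ('n, 'k) mpoly set"
  assume "\<not> ?thesis"
  moreover have "regularity (monomials_ideal (initials bmon) :: ('n, 'k) mpoly set) \<le> d"
    using resolvable_rlex_side regularity_le by blast
  ultimately have le: "regularity ?I \<le> d" by simp
  obtain a D where res: "minimal_graded_free_resolution ?I a D" "\<forall>i. \<forall>x\<in>set (a i). x \<le> regularity ?I + i"
    using resolvable_other_side regularity_attained by blast
  have gen: "\<forall>x\<in>set (a 0). x \<le> d" using res(2) le by (metis add_0_right order_trans)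
  let ?w = "single q (d + 1) :: 'n monomial"
  have "?w \<in> core" by (simp add: core_def psum_single)
  then have "single ?w 1 \<in> ?I" by (simp add: monomials_ideal_def initials_def)
  moreover have "?w \<in> keys (single ?w (1::'k))" by simp
  ultimately obtain f m m' where f: "f \<in> ?I" "m \<in> keys f" "mdeg m \<le> d" "?w = m + m'"
    using resolution_generator[OF res(1) gen] by blast
  have 0: "lookup m i = 0" if "i \<noteq> q" for i
  proof -
    have "lookup ?w i = lookup m i + lookup m' i" unfolding f(4) lookup_add ..
    then show ?thesis using that by (simp add: lookup_single)
  qed
  have "psum j m = 0" if "j < q" for j using 0 that by (auto simp: psum_eq_0)
  moreover have "psum q m \<le> d" using psum_le_mdeg[of q m] f(3) by simp
  ultimately have "m \<notin> core" by (auto simp: core_def)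
  moreover have "m \<noteq> n + amon" for n
  proof
    assume "m = n + amon"
    then have "lookup m lo = lookup n lo + lookup amon lo" by (simp add: lookup_add)
    moreover have "0 < lookup amon lo" using d2 by (simp add: amon_def lookup_add lookup_single)
    ultimately show False using 0[of lo] lo_q by simp
  qed
  moreover have "m \<in> initials amon" using f(1,2) by (auto simp: monomials_ideal_def)
  ultimately show False by (auto simp: initials_def)
qed

lemma rlex_bmon_amon: "rlex bmon amon"
  unfolding rlex_iff
proof (intro disjI2 conjI exI[of _ r] allI impI)
  show "lookup bmon r < lookup amon r"
    using q_r by (simp add: bmon_def amon_def lookup_add lookup_single)
  fix i assume "r < i"
  then show "lookup bmon i = lookup amon i"
    using q_r lo_q by (auto simp: bmon_def amon_def lookup_add lookup_single when_def)
qed (simp add: mdeg_amon mdeg_bmon)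

lemma regularity_gin_gap_ideal:
  assumes "monomial_order \<tau>" "\<tau> amon bmon"
  shows "regularity (gin \<tau> (gap_ideal :: ('n, 'k::field_char_0) mpoly set)) \<noteq> regularity (gin rlex (gap_ideal :: ('n, 'k) mpoly set))"
proof -
  have "gin \<tau> gap_ideal = (monomials_ideal (initials amon) :: ('n, 'k) mpoly set)"
    by (rule gin_gap_ideal[OF assms]) simp
  moreover have "gin rlex gap_ideal = (monomials_ideal (initials bmon) :: ('n, 'k) mpoly set)"
    by (rule gin_gap_ideal[OF monomial_order_rlex rlex_bmon_amon]) auto
  ultimately show ?thesis using regularity_initials[where 'k = 'k] by simp
qed

end

text \<open>Cancelling common factors from a pair ordered differently leaves a monomial involving \<open>r\<close> and one in
  variables before \<open>r\<close>; these are at most \<open>lo^(d-1) * r\<close> and at least \<open>q^d\<close>, respectively.\<close>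

lemma order_gap_exists:
  fixes \<tau> :: "'n::{finite,linorder} monomial \<Rightarrow> 'n monomial \<Rightarrow> bool"
  assumes \<tau>: "monomial_order \<tau>" and ne: "\<tau> \<noteq> rlex"
  shows "\<exists>lo q r d. order_gap lo q r d \<and> \<tau> (order_gap.amon lo r d) (order_gap.bmon q d)"
proof -
  obtain a b where ab: "\<tau> a b" "rlex b a"
  proof -
    obtain a b where "\<tau> a b \<noteq> rlex a b" using ne by blast
    moreover from this have "a \<noteq> b"
      using monomial_order_irrefl[OF \<tau>] monomial_order_irrefl[OF monomial_order_rlex] by metis
    ultimately show ?thesis
      using that monomial_order_total[OF \<tau>, of a b] monomial_order_total[OF monomial_order_rlex, of a b] by blast
  qed
  have asym: "\<not> (\<sigma> x y \<and> \<sigma> y x)" if "monomial_order \<sigma>" for \<sigma> :: "'n monomial \<Rightarrow> 'n monomial \<Rightarrow> bool" and x y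
    using monomial_order_trans[OF that] monomial_order_irrefl[OF that] by blast
  \<comment> \<open>The degrees must agree, since both orders are graded and disagree on the pair;
    \<open>r\<close> is then the last position where the exponents differ.\<close>
  have "\<not> mdeg b > mdeg a" using asym[OF \<tau>, of a b] ab(1) \<tau> unfolding monomial_order_def by blast
  with ab(2) obtain r where deg: "mdeg a = mdeg b"
    and r: "lookup b r < lookup a r" "\<forall>i>r. lookup b i = lookup a i" unfolding rlex_iff by auto
  define a' where "a' = a - b"
  define b' where "b' = b - a"
  define c where "c = a - a'"
  have a: "a = a' + c" and b: "b = b' + c"
    by (rule poly_mapping_eqI, simp add: a'_def b'_def c_def lookup_add lookup_minus)+
  have deg': "mdeg a' = mdeg b'" using deg unfolding a b by (simp add: mdeg_add)
  have ra: "0 < lookup a' r" using r(1) by (simp add: a'_def lookup_minus)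
  \<comment> \<open>Beyond \<open>r\<close> the exponents agree and at \<open>r\<close> that of
    \<open>b\<close> is smaller, so what is left of \<open>b\<close> lives before
    \<open>r\<close>.\<close>
  have kb: "i < r" if "i \<in> keys b'" for i
  proof (rule ccontr)
    assume "\<not> i < r"
    then consider "i = r" | "r < i" by (meson linorder_neqE)
    then show False using that r by cases (auto simp: b'_def in_keys_iff lookup_minus)
  qed
  have "a' \<noteq> b'"
  proof
    assume "a' = b'"
    then show False using ra kb[of r] by (simp add: in_keys_iff)
  qed
  have ab': "\<tau> a' b'"
  proof (rule ccontr)
    assume "\<not> \<tau> a' b'"
    then have "\<tau> b' a'" using monomial_order_total[OF \<tau> \<open>a' \<noteq> b'\<close>] by blast
    then have "\<tau> b a" unfolding a b by (rule monomial_order_add[OF \<tau>])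
    then show False using asym[OF \<tau>] ab(1) by blast
  qed
  define d where "d = mdeg a'"
  define a1 where "a1 = a' - single r 1"
  have a1: "a' = a1 + single r 1" using minus_single_plus[OF ra] by (simp add: a1_def)
  have d_a1: "d = Suc (mdeg a1)" unfolding d_def by (subst a1) (simp add: mdeg_add)
  have "b' \<noteq> 0" using d_a1 deg' unfolding d_def by auto
  then have "keys b' \<noteq> {}" by simp
  then have ne: "{..<r} \<noteq> {}" using kb by blast
  \<comment> \<open>The predecessor of \<open>r\<close>; it exists because \<open>b'\<close> is a
    nonconstant monomial in variables before \<open>r\<close>.\<close>
  define q where "q = Max {..<r}"
  have qr: "q < r" using Max_in[of "{..<r}"] ne by (simp add: q_def)
  have q_max: "i \<le> q" if "i < r" for i using that by (simp add: q_def)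
  define lo where "lo = Min (UNIV :: 'n set)"
  have lo: "lo \<le> i" for i by (simp add: lo_def)
  have "\<forall>i\<in>keys b'. i \<le> q" using kb q_max by blast
  then have "b' = single q d \<or> \<tau> b' (single q d)"
    using monomial_between(2)[OF \<tau>, of b' q] deg' by (simp add: d_def)
  then have a'q: "\<tau> a' (single q d)" using ab' monomial_order_trans[OF \<tau> ab'] by auto
  have "single lo (d - 1) = a1 \<or> \<tau> (single lo (d - 1)) a1"
    using monomial_between(1)[OF \<tau>, of a1 lo] lo d_a1 by simp
  then have "single lo (d - 1) + single r 1 = a' \<or> \<tau> (single lo (d - 1) + single r 1) a'"
    unfolding a1 using monomial_order_add[OF \<tau>] by blast
  then have gap: "\<tau> (single lo (d - 1) + single r 1) (single q d)"
    using a'q monomial_order_trans[OF \<tau> _ a'q] by auto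
  \<comment> \<open>For x_q = x_1 the inequality \<open>gap\<close> would read x_1^(d-1) x_r >
    x_1^d, and for d = 1 it would read x_r > x_q.\<close>
  have "lo \<noteq> q"
  proof
    assume "lo = q"
    then have "lo < r" using qr by simp
    then have "\<tau> (single lo (d - 1) + single lo 1) (single lo (d - 1) + single r 1)"
      by (intro monomial_order_add'[OF \<tau>] monomial_order_var[OF \<tau>])
    moreover have "single lo (d - 1) + single lo 1 = single q d"
      using d_a1 \<open>lo = q\<close> by (simp flip: single_add)
    ultimately show False using gap asym[OF \<tau>] by metis
  qed
  moreover have "d \<noteq> 1"
  proof
    assume "d = 1"
    with gap have "\<tau> (single r 1) (single q 1)" by simp
    then show False using monomial_order_var[OF \<tau> qr] asym[OF \<tau>] by blast
  qed
  ultimately have "order_gap lo q r d"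
  proof (unfold_locales, goal_cases)
    case (4 i)
    then show ?case using q_max[of i] by (meson leD leI)
  next
    case 5
    then show ?case using d_a1 by linarith
  qed (use lo qr in \<open>auto simp: le_neq_trans\<close>)
  then show ?thesis
    using gap by (intro exI[of _ lo] exI[of _ q] exI[of _ r] exI[of _ d])
      (simp add: order_gap.amon_def order_gap.bmon_def)
qed

theorem theorem4p4:
  fixes \<tau> :: "'n::{finite,linorder} monomial \<Rightarrow> 'n monomial \<Rightarrow> bool"
  assumes "monomial_order \<tau>"
    and "\<And>I :: ('n, 'k::{alg_closed_field,field_char_0}) mpoly set.
           homogeneous_ideal I \<Longrightarrow> regularity (gin \<tau> I) = regularity (gin rlex I)"
  shows "\<tau> = rlex"
proof (rule ccontr)
  assume "\<tau> \<noteq> rlex"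
  then obtain lo q r d where gap: "order_gap lo q r d" "\<tau> (order_gap.amon lo r d) (order_gap.bmon q d)"
    using order_gap_exists[OF assms(1)] by blast
  show False
    using order_gap.regularity_gin_gap_ideal[OF gap(1) assms(1) gap(2), where 'k = 'k]
      assms(2)[OF order_gap.homogeneous_gap_ideal[OF gap(1)]] by blast
qed

end
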